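(* Let $d\in\mathbb{N}$, $a>0$, and let $\kappa$ be a nonnegative multiplicity function on a root system in $\mathbb{R}^d$. In either of the following cases: (1) $d=1$, $0<a\le 1$, and $\langle\kappa\rangle=\frac12-\frac a4$; (2) $d\ge1$, $a\in(1,2)\cup(2,\infty)$, and $\langle\kappa\rangle\ge0$; the kernel $B_{\kappa,a}$ of the $(\kappa,a)$-generalized Fourier transform satisfies $$\|B_{\kappa,a}\|_\infty=\sup_{x,y\in\mathbb{R}^d}|B_{\kappa,a}(x,y)|>1$$ (the supremum being possibly infinite).
   Context: Setting. $\Omega\subset\mathbb{R}^d\setminus\{0\}$ is a (finite) root system, $\sigma_\alpha$ is the reflection in the hyperplane orthogonal to $\alpha\in\Omega$, $G\subset O(d)$ is the finite group generated by the $\sigma_\alpha$, and $\kappa:\Omega\to[0,\infty)$ is $G$-invariant. Put $\langle\kappa\rangle=\frac12\sum_{\alpha\in\Omega}\kappa(\alpha)$, $\lambda_\kappa=\langle\kappa\rangle+\frac{d-2}{2}$, $\lambda=\lambda_{\kappa,a}=2\lambda_\kappa/a$. It is assumed that $2\lambda_\kappa+a>0$, i.e. $\lambda>-1$. Normalized Bessel function: $j_\nu(x)=2^\nu\Gamma(\nu+1)x^{-\nu}J_\nu(x)=\Gamma(\nu+1)\sum_{k\ge0}\frac{(-1)^k(x/2)^{2k}}{k!\,\Gamma(k+\nu+1)}$. Dunkl operators: $T_\xi f(x)=\partial_\xi f(x)+\frac12\sum_{\alpha\in\Omega}\kappa(\alpha)\langle\alpha,\xi\rangle\frac{f(x)-f(\sigma_\alpha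 x)}{\langle\alpha,x\rangle}$. The intertwining operator $V_\kappa$ is the unique linear operator on polynomials on $\mathbb{R}^d$ that preserves the spaces of homogeneous polynomials of each degree and satisfies $V_\kappa 1=1$, $T_\xi V_\kappa=V_\kappa\partial_\xi$ for all $\xi\in\mathbb{R}^d$. $C_j^\eta$ are the Gegenbauer polynomials with generating function $\sum_j C_j^\eta(\tau)z^j=(1-2\tau z+z^2)^{-\eta}$. The kernel. For $d\ge2$, $x=|x|x'$, $y=|y|y'$ with $x',y'\in\mathbb{S}^{d-1}$, $$B_{\kappa,a}(x,y)=\sum_{j=0}^\infty e^{-\frac{i\pi j}{a}}\,\frac{\lambda_\kappa+j}{\lambda_\kappa}\,\frac{\Gamma(\lambda+1)\,(|x||y|)^j}{a^{2j/a}\,\Gamma(\lambda+1+2j/a)}\,j_{\lambda+\frac{2j}{a}}\Bigl(\tfrac2a(|x||y|)^{a/2}\Bigr)\,V_\kappa\bigl[C_j^{\lambda_\kappa}(\langle x',\cdot\rangle)\bigr](y'),$$ where if $\lambda_\kappa=0$ the polynomial $\frac{\lambda_\kappa+j}{\lambda_\kappa}C_j^{\lambda_\kappa}(\tau)$ is replaced by its limit as $\lambda_\kappa\to0$ (namely $1$ for $j=0$ and $2\cos(j\arccos\tau)$ for $j\ge1$). For $d=1$ (writing $\kappa=\langle\kappa\rangle\ge0$, $\lambda=(2\kappa-1)/a$), for $x,y\in\mathbb{R}$, $$B_{\kappa,a}(x,y)=j_\lambda\Bigl(\tfrac2a|xy|^{a/2}\Bigr)+\frac{\Gamma(\lambda+1)}{\Gamma(\lambda+1+2/a)}\,\frac{e^{-i\pi/a}\,xy}{a^{2/a}}\,j_{\lambda+\frac2a}\Bigl(\tfrac2a|xy|^{a/2}\Bigr).$$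 *)

theory Defs
  imports "HOL-Analysis.Analysis" "HOL-Computational_Algebra.Formal_Power_Series"
begin

definition reflection :: "real ^ 'n \<Rightarrow> real ^ 'n \<Rightarrow> real ^ 'n" where
  "reflection \<alpha> x = x - (2 * (\<alpha> \<bullet> x) / (\<alpha> \<bullet> \<alpha>)) *\<^sub>R \<alpha>"

text \<open>Root systems as in Dunkl theory: neither crystallographic nor spanning, possibly empty.\<close>

definition root_system :: "(real ^ 'n) set \<Rightarrow> bool" where
  "root_system \<Omega> \<longleftrightarrow>
     finite \<Omega> \<and> 0 \<notin> \<Omega> \<and>
     (\<forall>\<alpha>\<in>\<Omega>. \<Omega> \<inter> range (\<lambda>t. t *\<^sub>R \<alpha>) = {\<alpha>, - \<alpha>}) \<and>
     (\<forall>\<alpha>\<in>\<Omega>. reflection \<alpha> ` \<Omega> = \<Omega>)"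

text \<open>The generators are involutions, so closing under left multiplication by generators
  gives the whole group they generate.\<close>

inductive_set reflection_group :: "(real ^ 'n) set \<Rightarrow> (real ^ 'n \<Rightarrow> real ^ 'n) set"
  for \<Omega> :: "(real ^ 'n) set" where
  identity: "id \<in> reflection_group \<Omega>"
| step: "\<alpha> \<in> \<Omega> \<Longrightarrow> g \<in> reflection_group \<Omega> \<Longrightarrow> reflection \<alpha> \<circ> g \<in> reflection_group \<Omega>"

definition nonneg_multiplicity :: "(real ^ 'n) set \<Rightarrow> (real ^ 'n \<Rightarrow> real) \<Rightarrow> bool" where
  "nonneg_multiplicity \<Omega> \<kappa> \<longleftrightarrow>
     (\<forall>\<alpha>\<in>\<Omega>. 0 \<le> \<kappa> \<alpha>) \<and> (\<forall>g\<in>reflection_group \<Omega>. \<forall>\<alpha>\<in>\<Omega>. \<kappa> (g \<alpha>) = \<kappa> \<alpha>)"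

definition mult_sum :: "(real ^ 'n) set \<Rightarrow> (real ^ 'n \<Rightarrow> real) \<Rightarrow> real" where
  "mult_sum \<Omega> \<kappa> = (\<Sum>\<alpha>\<in>\<Omega>. \<kappa> \<alpha>) / 2"

definition lambda_k :: "(real ^ 'n) set \<Rightarrow> (real ^ 'n \<Rightarrow> real) \<Rightarrow> real" where
  "lambda_k \<Omega> \<kappa> = mult_sum \<Omega> \<kappa> + (real CARD('n) - 2) / 2"

definition lambda_ka :: "(real ^ 'n) set \<Rightarrow> (real ^ 'n \<Rightarrow> real) \<Rightarrow> real \<Rightarrow> real" where
  "lambda_ka \<Omega> \<kappa> a = 2 * lambda_k \<Omega> \<kappa> / a"

text \<open>Power-series form of \<open>2\<^sup>\<nu> \<Gamma>(\<nu> + 1) x\<^sup>-\<^sup>\<nu> J\<^sub>\<nu>(x)\<close>.\<close>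

definition bessel_j :: "real \<Rightarrow> real \<Rightarrow> real" where
  "bessel_j \<nu> x = Gamma (\<nu> + 1) *
     (\<Sum>k. (-1) ^ k * (x / 2) ^ (2 * k) / (fact k * Gamma (real k + \<nu> + 1)))"

definition dir_deriv :: "real ^ 'n \<Rightarrow> (real ^ 'n \<Rightarrow> real) \<Rightarrow> real ^ 'n \<Rightarrow> real" where
  "dir_deriv \<xi> f x = deriv (\<lambda>t. f (x + t *\<^sub>R \<xi>)) 0"

text \<open>The quotient \<open>(f(x) - f(\<sigma>\<^sub>\<alpha> x)) / \<langle>\<alpha>, x\<rangle>\<close>, extended continuously across
  the hyperplane \<open>\<langle>\<alpha>, x\<rangle> = 0\<close>, where HOL's division by zero would give \<open>0\<close>.
  For a polynomial \<open>f\<close> the result is a polynomial.\<close>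

definition dunkl_quotient :: "real ^ 'n \<Rightarrow> (real ^ 'n \<Rightarrow> real) \<Rightarrow> real ^ 'n \<Rightarrow> real" where
  "dunkl_quotient \<alpha> f x =
     (if \<alpha> \<bullet> x \<noteq> 0 then (f x - f (reflection \<alpha> x)) / (\<alpha> \<bullet> x)
      else Lim (at x within {z. \<alpha> \<bullet> z \<noteq> 0}) (\<lambda>z. (f z - f (reflection \<alpha> z)) / (\<alpha> \<bullet> z)))"

definition dunkl_op ::
  "(real ^ 'n) set \<Rightarrow> (real ^ 'n \<Rightarrow> real) \<Rightarrow> real ^ 'n \<Rightarrow> (real ^ 'n \<Rightarrow> real) \<Rightarrow> real ^ 'n \<Rightarrow> real"
where
  "dunkl_op \<Omega> \<kappa> \<xi> f x =
     dir_deriv \<xi> f x + (\<Sum>\<alpha>\<in>\<Omega>. \<kappa> \<alpha> * (\<alpha> \<bullet> \<xi>) * dunkl_quotient \<alpha> f x) / 2"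

definition homogeneous_poly :: "nat \<Rightarrow> (real ^ 'n \<Rightarrow> real) \<Rightarrow> bool" where
  "homogeneous_poly n p \<longleftrightarrow>
     real_polynomial_function p \<and> (\<forall>t x. p (t *\<^sub>R x) = t ^ n * p x)"

definition is_intertwiner ::
  "(real ^ 'n) set \<Rightarrow> (real ^ 'n \<Rightarrow> real) \<Rightarrow> ((real ^ 'n \<Rightarrow> real) \<Rightarrow> real ^ 'n \<Rightarrow> real) \<Rightarrow> bool"
where
  "is_intertwiner \<Omega> \<kappa> V \<longleftrightarrow>
     (\<forall>p. real_polynomial_function p \<longrightarrow> real_polynomial_function (V p)) \<and>
     (\<forall>p q. real_polynomial_function p \<longrightarrow> real_polynomial_function q \<longrightarrow>
        V (\<lambda>x. p x + q x) = (\<lambda>x. V p x + V q x)) \<and>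
     (\<forall>c p. real_polynomial_function p \<longrightarrow> V (\<lambda>x. c * p x) = (\<lambda>x. c * V p x)) \<and>
     (\<forall>n p. homogeneous_poly n p \<longrightarrow> homogeneous_poly n (V p)) \<and>
     V (\<lambda>x. 1) = (\<lambda>x. 1) \<and>
     (\<forall>\<xi> p. real_polynomial_function p \<longrightarrow> dunkl_op \<Omega> \<kappa> \<xi> (V p) = V (dir_deriv \<xi> p))"

text \<open>For a root system with nonnegative multiplicity function these conditions determine \<open>V\<close>
  uniquely on polynomial functions, and it is only ever applied to those. The choice operator
  merely fixes irrelevant values on other functions.\<close>

definition intertwiner ::
  "(real ^ 'n) set \<Rightarrow> (real ^ 'n \<Rightarrow> real) \<Rightarrow> (real ^ 'n \<Rightarrow> real) \<Rightarrow> real ^ 'n \<Rightarrow> real"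
where
  "intertwiner \<Omega> \<kappa> = (SOME V. is_intertwiner \<Omega> \<kappa> V)"

text \<open>Coefficient of \<open>z\<^sup>j\<close> in \<open>(1 - 2 \<tau> z + z\<^sup>2)\<^sup>-\<^sup>\<eta>\<close>, where \<open>fps_binomial c\<close> is \<open>(1 + X)\<^sup>c\<close>.\<close>

definition gegenbauer :: "nat \<Rightarrow> real \<Rightarrow> real \<Rightarrow> real" where
  "gegenbauer j \<eta> \<tau> =
     fps_nth (fps_binomial (- \<eta>) oo (fps_X ^ 2 - fps_const (2 * \<tau>) * fps_X)) j"

text \<open>The polynomial \<open>((\<eta> + j) / \<eta>) C\<^sub>j\<^sup>\<eta>(\<tau>)\<close>. At \<open>\<eta> = 0\<close> it is the limit as
  \<open>\<eta> \<rightarrow> 0\<close>: \<open>1\<close> for \<open>j = 0\<close>, and \<open>2 cos (j arccos \<tau>)\<close>, i.e. twice the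
  Chebyshev polynomial, for \<open>j \<ge> 1\<close>. The limit is used because the values at
  \<open>\<bar>\<tau>\<bar> > 1\<close>, where \<open>arccos\<close> is unspecified, matter for the intertwiner.\<close>

definition gegenbauer_weighted :: "nat \<Rightarrow> real \<Rightarrow> real \<Rightarrow> real" where
  "gegenbauer_weighted j \<eta> \<tau> =
     (if \<eta> = 0 then Lim (at 0) (\<lambda>e. (e + real j) / e * gegenbauer j e \<tau>)
      else (\<eta> + real j) / \<eta> * gegenbauer j \<eta> \<tau>)"

text \<open>In dimension one \<open>x \<bullet> y\<close> is the product \<open>xy\<close>. In higher dimensions \<open>sgn x\<close> is the unit
  vector \<open>x'\<close>; \<open>sgn 0 = 0\<close> is harmless, because if \<open>x = 0\<close> or \<open>y = 0\<close> the terms with \<open>j \<ge> 1\<close>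
  vanish and the term for \<open>j = 0\<close> does not depend on \<open>x'\<close> and \<open>y'\<close>.\<close>

definition kernel_B ::
  "(real ^ 'n) set \<Rightarrow> (real ^ 'n \<Rightarrow> real) \<Rightarrow> real \<Rightarrow> real ^ 'n \<Rightarrow> real ^ 'n \<Rightarrow> complex"
where
  "kernel_B \<Omega> \<kappa> a x y =
    (let \<eta> = lambda_k \<Omega> \<kappa>; \<nu> = lambda_ka \<Omega> \<kappa> a in
     if CARD('n) = 1 then
       of_real (bessel_j \<nu> (2 / a * \<bar>x \<bullet> y\<bar> powr (a / 2))) +
       of_real (Gamma (\<nu> + 1) / Gamma (\<nu> + 1 + 2 / a)) *
       (exp (- (\<i> * of_real (pi / a))) * of_real ((x \<bullet> y) / a powr (2 / a))) *
       of_real (bessel_j (\<nu> + 2 / a) (2 / a * \<bar>x \<bullet> y\<bar> powr (a / 2)))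
     else
       (\<Sum>j. exp (- (\<i> * of_real (pi * real j / a))) *
          of_real
            (Gamma (\<nu> + 1) * (norm x * norm y) ^ j /
               (a powr (2 * real j / a) * Gamma (\<nu> + 1 + 2 * real j / a)) *
             bessel_j (\<nu> + 2 * real j / a) (2 / a * (norm x * norm y) powr (a / 2)) *
             intertwiner \<Omega> \<kappa> (\<lambda>u. gegenbauer_weighted j \<eta> (sgn x \<bullet> u)) (sgn y))))"

end

(* For a > 1 the kernel is expanded at the origin: with z = |x||y|, the term j = 0 is 1 - O(z^a), the
   term j = 1 is e^(-i pi/a) c z V[<x', .>](y'), and the tail is O(z^2). The functional V[<x', .>] is odd
   and nonzero, so y' can be chosen to make cos(pi/a) V[<x', .>](y') positive, and Re B > 1 for small z.
   The tail needs |V[<x', .>^m]| <= 1 on the sphere, a maximum principle: p = V[<x', .>^m] satisfies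
   (m + <k>) p(x) = m <x', x> V[<x', .>^(m-1)](x) + (1/2) sum k(alpha) p(sigma_alpha x).
   In the critical one-dimensional case, j_(-1/2) = cos equals -1 at pi while the second Bessel factor
   does not vanish there, so B = -1 + r e^(-i pi/a) with r nonzero of either sign.
   The intertwining operator has to be constructed first: commutativity of the Dunkl operators makes
   a degree by degree recursion V p = (n + <k> - A)^(-1) sum_b x_b V[d_b p] work, where
   A f = (1/2) sum k(alpha) f o sigma_alpha. *)

theory Submission
  imports Defs
begin

section \<open>Polynomial functions and reflections\<close>

text \<open>\<open>intertwiner\<close> is a choice, so until existence is shown nothing is known
  about it. The operator \<open>V\<close> only makes the choice meaningful; every later estimate is
  derived from the intertwining relation itself. The recursion solves that relation in the radial
  direction alone, where the denominators of the Dunkl operators cancel. In the other directions the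
  defect \<open>T \<xi> (V p) - V (dir_deriv \<xi> p)\<close> is linear in \<xi>, vanishes at \<xi>
  = x and is closed with respect to the Dunkl operators, which is where their commutativity enters;
  a maximum principle forces such a form to vanish. Commutativity cannot be checked root by root:
  the terms with two difference quotients cancel only in the sum over all pairs of roots. The range
  of a comes from comparing powers at the origin: the loss z^a of the leading Bessel factor is o(z)
  exactly when a > 1, and the real part of the linear term carries the factor cos(pi/a), which
  vanishes at a = 2. For a \<le> 1 that comparison fails, and the critical case works instead at a
  point where the leading factor has modulus 1 again.\<close>

lemma polynomial_gradient:
  fixes f :: "'a::euclidean_space \<Rightarrow> real"
  assumes "real_polynomial_function f"
  shows "\<exists>D. (\<forall>\<xi>. real_polynomial_function (D \<xi>)) \<and> (\<forall>x. (f has_derivative (\<lambda>\<xi>. D \<xi> x)) (at x))"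
  using assms
proof induction
  case (linear f)
  have "(f has_derivative (\<lambda>\<xi>. f \<xi>)) (at x)" for x
    using linear by (simp add: bounded_linear_imp_has_derivative)
  then show ?case by (intro exI[of _ "\<lambda>\<xi> x. f \<xi>"]) auto
next
  case (const c)
  then show ?case by (intro exI[of _ "\<lambda>\<xi> x. 0"]) auto
next
  case (add f g)
  then obtain D1 D2 where "\<forall>\<xi>. real_polynomial_function (D1 \<xi>)" "\<forall>\<xi>. real_polynomial_function (D2 \<xi>)"
    "\<And>x. (f has_derivative (\<lambda>\<xi>. D1 \<xi> x)) (at x)" "\<And>x. (g has_derivative (\<lambda>\<xi>. D2 \<xi> x)) (at x)"
    by blast
  then show ?case by (intro exI[of _ "\<lambda>\<xi> x. D1 \<xi> x + D2 \<xi> x"]) (auto intro!: derivative_intros)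
next
  case (mult f g)
  then obtain D1 D2 where "\<forall>\<xi>. real_polynomial_function (D1 \<xi>)" "\<forall>\<xi>. real_polynomial_function (D2 \<xi>)"
    "\<And>x. (f has_derivative (\<lambda>\<xi>. D1 \<xi> x)) (at x)" "\<And>x. (g has_derivative (\<lambda>\<xi>. D2 \<xi> x)) (at x)"
    by blast
  with mult.hyps show ?case
    by (intro exI[of _ "\<lambda>\<xi> x. f x * D2 \<xi> x + D1 \<xi> x * g x"])
      (auto intro!: derivative_intros real_polynomial_function.intros(3,4))
qed

text \<open>\<open>deriv\<close> has a usable value only where the derivative exists, so every
  computation with \<open>dir_deriv\<close> goes through a total derivative, by the chain rule along
  the line \<open>x + t *\<^sub>R \<xi>\<close>.\<close>

lemma dir_deriv_eqI:
  assumes "(f has_derivative D) (at x)"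
  shows "dir_deriv \<xi> f x = D \<xi>"
proof -
  have "((\<lambda>t. x + t *\<^sub>R \<xi>) has_derivative (\<lambda>t. t *\<^sub>R \<xi>)) (at (0::real))"
    by (auto intro!: derivative_eq_intros)
  moreover have "(f has_derivative D) (at (x + 0 *\<^sub>R \<xi>))"
    using assms by simp
  ultimately have "((\<lambda>t. f (x + t *\<^sub>R \<xi>)) has_derivative (\<lambda>t. D (t *\<^sub>R \<xi>))) (at 0)"
    by (rule has_derivative_compose)
  moreover have "D (t *\<^sub>R \<xi>) = t * D \<xi>" for t
    using has_derivative_linear[OF assms] by (simp add: linear_cmul)
  ultimately have "((\<lambda>t. f (x + t *\<^sub>R \<xi>)) has_field_derivative D \<xi>) (at 0)"
    unfolding has_field_derivative_def by (simp add: mult.commute[of _ "D \<xi>"])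
  then show ?thesis
    unfolding dir_deriv_def by (rule DERIV_imp_deriv)
qed

lemma polynomial_has_derivative:
  assumes "real_polynomial_function f"
  shows "(f has_derivative (\<lambda>\<xi>. dir_deriv \<xi> f x)) (at x)"
proof -
  obtain D where D: "\<And>x. (f has_derivative (\<lambda>\<xi>. D \<xi> x)) (at x)"
    using polynomial_gradient[OF assms] by blast
  then have "dir_deriv \<xi> f x = D \<xi> x" for \<xi>
    by (rule dir_deriv_eqI)
  with D show ?thesis by simp
qed

lemma polynomial_dir_deriv [intro]:
  assumes "real_polynomial_function f"
  shows "real_polynomial_function (dir_deriv \<xi> f)"
proof -
  obtain D where D: "\<And>\<xi>. real_polynomial_function (D \<xi>)" "\<And>x. (f has_derivative (\<lambda>\<xi>. D \<xi> x)) (at x)"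
    using polynomial_gradient[OF assms] by blast
  then have "dir_deriv \<xi> f = D \<xi>"
    by (intro ext dir_deriv_eqI)
  with D show ?thesis by simp
qed

lemma linear_dir_deriv:
  assumes "real_polynomial_function f"
  shows "linear (\<lambda>\<xi>. dir_deriv \<xi> f x)"
  using polynomial_has_derivative[OF assms] by (rule has_derivative_linear)

lemma dir_deriv_const [simp]: "dir_deriv \<xi> (\<lambda>x. c) = (\<lambda>x. 0)"
  by (intro ext dir_deriv_eqI) (rule has_derivative_const)

lemma dir_deriv_linear:
  assumes "bounded_linear f"
  shows "dir_deriv \<xi> f = (\<lambda>x. f \<xi>)"
  by (intro ext dir_deriv_eqI) (use assms in \<open>simp add: bounded_linear_imp_has_derivative\<close>)

lemma dir_deriv_add:
  assumes "real_polynomial_function f" "real_polynomial_function g"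
  shows "dir_deriv \<xi> (\<lambda>x. f x + g x) = (\<lambda>x. dir_deriv \<xi> f x + dir_deriv \<xi> g x)"
  by (intro ext dir_deriv_eqI has_derivative_add polynomial_has_derivative assms)

lemma dir_deriv_mult:
  assumes "real_polynomial_function f" "real_polynomial_function g"
  shows "dir_deriv \<xi> (\<lambda>x. f x * g x) = (\<lambda>x. f x * dir_deriv \<xi> g x + dir_deriv \<xi> f x * g x)"
  by (intro ext dir_deriv_eqI has_derivative_mult polynomial_has_derivative assms)

lemma dir_deriv_cmult:
  assumes "real_polynomial_function f"
  shows "dir_deriv \<xi> (\<lambda>x. c * f x) = (\<lambda>x. c * dir_deriv \<xi> f x)"
  using dir_deriv_mult[OF real_polynomial_function.intros(2) assms] by simp

lemma dir_deriv_sum: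
  assumes "finite I" "\<And>i. i \<in> I \<Longrightarrow> real_polynomial_function (f i)"
  shows "dir_deriv \<xi> (\<lambda>x. \<Sum>i\<in>I. f i x) = (\<lambda>x. \<Sum>i\<in>I. dir_deriv \<xi> (f i) x)"
  by (intro ext dir_deriv_eqI has_derivative_sum polynomial_has_derivative assms)

lemma dir_deriv_commute:
  assumes "real_polynomial_function f"
  shows "dir_deriv \<xi> (dir_deriv \<eta> f) = dir_deriv \<eta> (dir_deriv \<xi> f)"
  using assms
proof induction
  case (mult f g)
  then show ?case
    by (simp add: dir_deriv_mult dir_deriv_add real_polynomial_function.intros(4) polynomial_dir_deriv fun_eq_iff algebra_simps)
qed (auto simp: dir_deriv_linear dir_deriv_add polynomial_dir_deriv fun_eq_iff)

lemma dir_deriv_compose_linear: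
  assumes "real_polynomial_function f" "linear h"
  shows "dir_deriv \<xi> (\<lambda>x. f (h x)) x = dir_deriv (h \<xi>) f (h x)"
proof (rule dir_deriv_eqI)
  have "(h has_derivative h) (at x)"
    using assms(2) by (simp add: linear_imp_has_derivative)
  then show "((\<lambda>x. f (h x)) has_derivative (\<lambda>\<xi>. dir_deriv (h \<xi>) f (h x))) (at x)"
    using polynomial_has_derivative[OF assms(1)] by (rule has_derivative_compose)
qed

lemma polynomial_compose_linear:
  fixes h :: "'a::euclidean_space \<Rightarrow> 'b::euclidean_space"
  assumes "real_polynomial_function f" "linear h"
  shows "real_polynomial_function (\<lambda>x. f (h x))"
  using real_polynomial_function_compose[OF polynomial_function_bounded_linear assms(1), of h] assms(2)
  by (simp add: o_def linear_conv_bounded_linear)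

lemma polynomial_isCont:
  fixes f :: "'a::euclidean_space \<Rightarrow> real"
  assumes "real_polynomial_function f"
  shows "isCont f x"
  using polynomial_gradient[OF assms] has_derivative_continuous by blast

section \<open>Reflections acting on polynomials\<close>

lemma linear_reflection: "linear (reflection \<alpha>)"
  by (rule linearI) (simp_all add: reflection_def algebra_simps add_divide_distrib)

lemma reflection_reflection [simp]: "reflection \<alpha> (reflection \<alpha> x) = x"
  by (cases "\<alpha> = 0") (simp_all add: reflection_def inner_diff_right algebra_simps)

lemma inner_reflection_commute: "reflection \<alpha> x \<bullet> y = x \<bullet> reflection \<alpha> y"
  by (simp add: reflection_def inner_diff_right inner_diff_left inner_commute)

lemma inner_reflection: "reflection \<alpha> x \<bullet> reflection \<alpha> y = x \<bullet> y"
  by (simp add: inner_reflection_commute)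

lemma norm_reflection [simp]: "norm (reflection \<alpha> x) = norm x"
  by (simp add: norm_eq_sqrt_inner inner_reflection)

lemma reflection_inner_zero: "\<alpha> \<bullet> x = 0 \<Longrightarrow> reflection \<alpha> x = x"
  by (simp add: reflection_def)

lemma reflection_conj:
  "reflection (reflection \<beta> \<alpha>) x = reflection \<beta> (reflection \<alpha> (reflection \<beta> x))"
proof -
  have "reflection \<beta> (reflection \<alpha> (reflection \<beta> x))
      = reflection \<beta> (reflection \<beta> x - (2 * (\<alpha> \<bullet> reflection \<beta> x) / (\<alpha> \<bullet> \<alpha>)) *\<^sub>R \<alpha>)"
    by (simp add: reflection_def[of \<alpha>])
  also have "\<dots> = x - (2 * (\<alpha> \<bullet> reflection \<beta> x) / (\<alpha> \<bullet> \<alpha>)) *\<^sub>R reflection \<beta> \<alpha>"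
    by (simp add: linear_diff[OF linear_reflection] linear_cmul[OF linear_reflection])
  also have "\<dots> = reflection (reflection \<beta> \<alpha>) x"
    by (simp add: reflection_def[of "reflection \<beta> \<alpha>"] inner_reflection inner_reflection_commute)
  finally show ?thesis ..
qed

lemma polynomial_reflection:
  "real_polynomial_function f \<Longrightarrow> real_polynomial_function (\<lambda>x. f (reflection \<alpha> x))"
  by (rule polynomial_compose_linear[OF _ linear_reflection])

lemma polynomial_inner_left [intro]: "real_polynomial_function (\<lambda>x. \<alpha> \<bullet> x)"
  and polynomial_inner_right [intro]: "real_polynomial_function (\<lambda>x. x \<bullet> \<alpha>)"
  by (auto intro: real_polynomial_function.intros(1) bounded_linear_inner_right bounded_linear_inner_left)

text \<open>Induction over the generation of polynomials. A product is split as f g - f' g' = (f -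
  f') g + f' (g - g'), the prime denoting composition with the reflection, so that each summand
  yields a factor \<open>\<alpha> \<bullet> x\<close>.\<close>

lemma polynomial_reflection_diff_quotient:
  assumes "real_polynomial_function f"
  shows "\<exists>q. real_polynomial_function q \<and> (\<forall>x. f x - f (reflection \<alpha> x) = (\<alpha> \<bullet> x) * q x)"
  using assms
proof induction
  case (linear f)
  then interpret bounded_linear f .
  have "f x - f (reflection \<alpha> x) = (\<alpha> \<bullet> x) * (2 * f \<alpha> / (\<alpha> \<bullet> \<alpha>))" for x
    by (simp add: reflection_def diff scaleR)
  then show ?case by blast
next
  case (const c)
  then show ?case by (intro exI[of _ "\<lambda>x. 0"]) auto
next
  case (add f g)
  then obtain p q where pq: "real_polynomial_function p" "real_polynomial_function q"
    "\<And>x. f x - f (reflection \<alpha> x) = (\<alpha> \<bullet> x) * p x" "\<And>x. g x - g (reflection \<alpha> x) = (\<alpha> \<bullet> x) * q x"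
    by blast
  have "f x + g x - (f (reflection \<alpha> x) + g (reflection \<alpha> x)) = (\<alpha> \<bullet> x) * (p x + q x)" for x
    using pq(3,4)[of x] by (simp add: algebra_simps)
  with pq(1,2) show ?case by blast
next
  case (mult f g)
  then obtain p q where pq: "real_polynomial_function p" "real_polynomial_function q"
    "\<And>x. f x - f (reflection \<alpha> x) = (\<alpha> \<bullet> x) * p x" "\<And>x. g x - g (reflection \<alpha> x) = (\<alpha> \<bullet> x) * q x"
    by blast
  have "f x * g x - f (reflection \<alpha> x) * g (reflection \<alpha> x)
      = (f x - f (reflection \<alpha> x)) * g x + f (reflection \<alpha> x) * (g x - g (reflection \<alpha> x))" for x
    by (simp add: algebra_simps)
  then have "f x * g x - f (reflection \<alpha> x) * g (reflection \<alpha> x)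
      = (\<alpha> \<bullet> x) * (p x * g x + f (reflection \<alpha> x) * q x)" for x
    unfolding pq(3,4) by (simp add: distrib_left mult.left_commute)
  moreover have "real_polynomial_function (\<lambda>x. p x * g x + f (reflection \<alpha> x) * q x)"
    by (intro real_polynomial_function.intros(3,4) polynomial_reflection pq(1,2) mult.hyps)
  ultimately show ?case by blast
qed

section \<open>Density off the hyperplanes and the difference quotient of a polynomial\<close>

lemma negligible_imp_dense_Compl:
  fixes S :: "'a::euclidean_space set"
  assumes "negligible S"
  shows "closure (- S) = UNIV"
proof -
  have "interior S = {}"
    using assms negligible_subset[OF assms interior_subset] open_not_negligible open_interior by blast
  then show ?thesis by (simp add: closure_complement)
qed

lemma dense_Compl_hyperplanes:
  fixes \<Omega> :: "'a::euclidean_space set"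
  assumes "finite \<Omega>" "0 \<notin> \<Omega>"
  shows "closure {x. \<forall>\<alpha>\<in>\<Omega>. \<alpha> \<bullet> x \<noteq> 0} = UNIV"
proof -
  have "negligible (\<Union>\<alpha>\<in>\<Omega>. {x. \<alpha> \<bullet> x = 0})"
    using assms by (intro negligible_Union) (auto intro!: negligible_hyperplane)
  moreover have "{x. \<forall>\<alpha>\<in>\<Omega>. \<alpha> \<bullet> x \<noteq> 0} = - (\<Union>\<alpha>\<in>\<Omega>. {x. \<alpha> \<bullet> x = 0})"
    by auto
  ultimately show ?thesis using negligible_imp_dense_Compl by metis
qed

text \<open>Continuity of both sides. Identities for Dunkl operators can thereby be checked off the
  reflecting hyperplanes, where difference quotients are ordinary fractions.\<close>

lemma polynomial_eq_on_dense:
  fixes f g :: "'a::euclidean_space \<Rightarrow> real"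
  assumes "real_polynomial_function f" "real_polynomial_function g"
    and "closure S = UNIV" "\<And>x. x \<in> S \<Longrightarrow> f x = g x"
  shows "f x = g x"
proof -
  have "continuous_on (closure S) (\<lambda>x. f x - g x)"
    using assms(1,2) polynomial_isCont continuous_at_imp_continuous_on by (intro continuous_intros) blast+
  then have "f x - g x = 0"
    by (rule continuous_constant_on_closure[where S=S]) (use assms in auto)
  then show ?thesis by simp
qed

text \<open>On the hyperplane the definition takes a limit within the complement. The complement is
  dense, so the filter is nontrivial, and by continuity the limit is the value of the polynomial
  quotient.\<close>

lemma dunkl_quotient_polynomial:
  assumes "real_polynomial_function f" "\<alpha> \<noteq> 0"
  shows "real_polynomial_function (dunkl_quotient \<alpha> f)"
    and "(\<alpha> \<bullet> x) * dunkl_quotient \<alpha> f x = f x - f (reflection \<alpha> x)"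
proof -
  obtain q where q: "real_polynomial_function q" "\<And>x. f x - f (reflection \<alpha> x) = (\<alpha> \<bullet> x) * q x"
    using polynomial_reflection_diff_quotient[OF assms(1)] by blast
  have "dunkl_quotient \<alpha> f x = q x" for x
  proof (cases "\<alpha> \<bullet> x = 0")
    case True
    let ?S = "{z. \<alpha> \<bullet> z \<noteq> 0}"
    have "closure ?S = UNIV"
      using dense_Compl_hyperplanes[of "{\<alpha>}"] assms by simp
    then have nt: "\<not> trivial_limit (at x within ?S)"
      using True closure_iff_nhds_not_empty[of x ?S] unfolding trivial_limit_within 
      by (simp add: islimpt_in_closure)
    have "(q \<longlongrightarrow> q x) (at x within ?S)"
      using polynomial_isCont[OF q(1), of x] by (simp add: continuous_within tendsto_within_subset[OF _ subset_UNIV] isCont_def)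
    moreover have "\<forall>\<^sub>F z in at x within ?S. (f z - f (reflection \<alpha> z)) / (\<alpha> \<bullet> z) = q z"
      by (simp add: eventually_at_filter q(2))
    ultimately have "((\<lambda>z. (f z - f (reflection \<alpha> z)) / (\<alpha> \<bullet> z)) \<longlongrightarrow> q x) (at x within ?S)"
      by (simp add: tendsto_cong)
    then show ?thesis
      using True nt by (simp add: dunkl_quotient_def tendsto_Lim)
  qed (simp add: dunkl_quotient_def q(2))
  then have "dunkl_quotient \<alpha> f = q" by blast
  with q show "real_polynomial_function (dunkl_quotient \<alpha> f)"
    "(\<alpha> \<bullet> x) * dunkl_quotient \<alpha> f x = f x - f (reflection \<alpha> x)" by simp_all
qed

text \<open>Off the hyperplane the factor \<open>\<alpha> \<bullet> x\<close> cancels, and density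
  gives the rest. Rules for quotients can now be proved by exhibiting a polynomial with the right
  product, without returning to the limit.\<close>

lemma dunkl_quotient_unique:
  assumes "real_polynomial_function f" "\<alpha> \<noteq> 0" "real_polynomial_function q"
    and "\<And>x. (\<alpha> \<bullet> x) * q x = f x - f (reflection \<alpha> x)"
  shows "dunkl_quotient \<alpha> f = q"
proof
  fix x
  have "closure {z. \<alpha> \<bullet> z \<noteq> 0} = UNIV"
    using dense_Compl_hyperplanes[of "{\<alpha>}"] assms by simp
  moreover have "dunkl_quotient \<alpha> f x = q x" if "\<alpha> \<bullet> x \<noteq> 0" for x
    using that dunkl_quotient_polynomial(2)[OF assms(1,2), of x] assms(4)[of x] by (metis mult_left_cancel)
  ultimately show "dunkl_quotient \<alpha> f x = q x"
    using polynomial_eq_on_dense[OF dunkl_quotient_polynomial(1)[OF assms(1,2)] assms(3), of "{z. \<alpha> \<bullet> z \<noteq> 0}"]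
    by simp
qed

section \<open>Dunkl operators\<close>

text \<open>Derivatives and difference quotients lose a factor \<open>t\<close> by cancellation,
  which is possible only for \<open>t \<noteq> 0\<close>. For fixed x both sides are polynomials in
  t, so the value at 0 follows by density.\<close>

lemma homogeneous_polyI:
  assumes "real_polynomial_function p" "\<And>t x. t \<noteq> 0 \<Longrightarrow> p (t *\<^sub>R x) = t ^ n * p x"
  shows "homogeneous_poly n p"
  unfolding homogeneous_poly_def
proof (intro conjI allI)
  fix t x
  have "real_polynomial_function (\<lambda>t. p (t *\<^sub>R x))"
    by (rule polynomial_compose_linear[OF assms(1)]) (simp add: linear_iff algebra_simps)
  moreover have "real_polynomial_function (\<lambda>t::real. t ^ n * p x)"
    by (intro real_polynomial_function.intros(2,4) real_polynomial_function_power real_polynomial_function.intros(1) bounded_linear_ident)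
  moreover have "closure (- {0::real}) = UNIV"
    by (rule negligible_imp_dense_Compl) simp
  ultimately show "p (t *\<^sub>R x) = t ^ n * p x"
    using assms(2) by (rule polynomial_eq_on_dense) simp
qed (rule assms)

lemma homogeneous_polyD:
  assumes "homogeneous_poly n p"
  shows "real_polynomial_function p" "p (t *\<^sub>R x) = t ^ n * p x"
  using assms by (auto simp: homogeneous_poly_def)

lemma homogeneous_poly_add:
  "homogeneous_poly n p \<Longrightarrow> homogeneous_poly n q \<Longrightarrow> homogeneous_poly n (\<lambda>x. p x + q x)"
  unfolding homogeneous_poly_def by (auto simp: algebra_simps)

lemma homogeneous_poly_cmult:
  "homogeneous_poly n p \<Longrightarrow> homogeneous_poly n (\<lambda>x. c * p x)"
  unfolding homogeneous_poly_def by (auto simp: algebra_simps)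

lemma homogeneous_poly_zero: "homogeneous_poly n (\<lambda>x. 0)"
  unfolding homogeneous_poly_def by auto

lemma homogeneous_poly_diff:
  "homogeneous_poly n p \<Longrightarrow> homogeneous_poly n q \<Longrightarrow> homogeneous_poly n (\<lambda>x. p x - q x)"
  unfolding homogeneous_poly_def by (auto simp: algebra_simps)

lemma homogeneous_poly_sum:
  "finite I \<Longrightarrow> (\<And>i. i \<in> I \<Longrightarrow> homogeneous_poly n (f i)) \<Longrightarrow> homogeneous_poly n (\<lambda>x. \<Sum>i\<in>I. f i x)"
  by (induction I rule: finite_induct) (auto intro: homogeneous_poly_add homogeneous_poly_zero)

lemma homogeneous_poly_mult:
  "homogeneous_poly m p \<Longrightarrow> homogeneous_poly n q \<Longrightarrow> homogeneous_poly (m + n) (\<lambda>x. p x * q x)"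
  unfolding homogeneous_poly_def by (auto simp: algebra_simps power_add)

lemma homogeneous_poly_inner: "homogeneous_poly 1 (\<lambda>x. x \<bullet> b)"
  unfolding homogeneous_poly_def by auto

lemma homogeneous_poly_inner_power: "homogeneous_poly n (\<lambda>x. (\<xi> \<bullet> x) ^ n)"
  unfolding homogeneous_poly_def by (auto simp: power_mult_distrib)

lemma homogeneous_poly_compose_linear:
  "homogeneous_poly n p \<Longrightarrow> linear h \<Longrightarrow> homogeneous_poly n (\<lambda>x. p (h x))"
  unfolding homogeneous_poly_def using polynomial_compose_linear[of p h] by (auto simp: linear_cmul)

lemma homogeneous_poly_0_const: "homogeneous_poly 0 p \<Longrightarrow> p x = p 0"
  using homogeneous_polyD(2)[of 0 p 0 x] by simp

lemma dir_deriv_scale: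
  assumes "homogeneous_poly n f"
  shows "t * dir_deriv \<xi> f (t *\<^sub>R x) = t ^ n * dir_deriv \<xi> f x"
proof -
  note f = homogeneous_polyD[OF assms]
  have "t * dir_deriv \<xi> f (t *\<^sub>R x) = dir_deriv (t *\<^sub>R \<xi>) f (t *\<^sub>R x)"
    using linear_cmul[OF linear_dir_deriv[OF f(1)]] by simp
  also have "\<dots> = dir_deriv \<xi> (\<lambda>x. f (t *\<^sub>R x)) x"
    by (rule dir_deriv_compose_linear[OF f(1), symmetric]) (simp add: linear_iff algebra_simps)
  also have "\<dots> = t ^ n * dir_deriv \<xi> f x"
    by (simp add: f(2) dir_deriv_cmult[OF f(1)])
  finally show ?thesis .
qed

lemma homogeneous_poly_dir_deriv:
  assumes "homogeneous_poly (Suc n) f"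
  shows "homogeneous_poly n (dir_deriv \<xi> f)"
proof (rule homogeneous_polyI)
  show "dir_deriv \<xi> f (t *\<^sub>R x) = t ^ n * dir_deriv \<xi> f x" if "t \<noteq> 0" for t x
    using dir_deriv_scale[OF assms, of t \<xi> x] that by simp
qed (use homogeneous_polyD(1)[OF assms] in blast)

lemma homogeneous_poly_0_dir_deriv:
  assumes "homogeneous_poly 0 f"
  shows "dir_deriv \<xi> f = (\<lambda>x. 0)"
proof -
  have "f = (\<lambda>x. f 0)"
    using homogeneous_poly_0_const[OF assms] by blast
  then show ?thesis by (metis dir_deriv_const)
qed

lemma euler_homogeneous:
  assumes "homogeneous_poly n f"
  shows "dir_deriv x f x = real n * f x"
proof -
  have "((\<lambda>t. (1 + t) ^ n * f x) has_field_derivative real n * f x) (at 0)"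
    by (auto intro!: derivative_eq_intros)
  moreover have "f (x + t *\<^sub>R x) = (1 + t) ^ n * f x" for t
    using homogeneous_polyD(2)[OF assms, of "1 + t" x] by (simp add: algebra_simps)
  ultimately show ?thesis
    unfolding dir_deriv_def by (simp add: DERIV_imp_deriv)
qed

lemma homogeneous_poly_dunkl_quotient:
  assumes "homogeneous_poly (Suc n) f" "\<alpha> \<noteq> 0"
  shows "homogeneous_poly n (dunkl_quotient \<alpha> f)"
proof (rule homogeneous_polyI)
  note f = homogeneous_polyD[OF assms(1)]
  let ?q = "dunkl_quotient \<alpha> f"
  show q: "real_polynomial_function ?q"
    using f(1) assms(2) by (rule dunkl_quotient_polynomial)
  fix t :: real and x assume "t \<noteq> 0"
  have "?q (t *\<^sub>R x) = t ^ n * ?q x" if "\<alpha> \<bullet> x \<noteq> 0" for x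
  proof -
    have "t * (\<alpha> \<bullet> x) * ?q (t *\<^sub>R x) = t ^ Suc n * (f x - f (reflection \<alpha> x))"
      using dunkl_quotient_polynomial(2)[OF f(1) assms(2), of "t *\<^sub>R x"]
      by (simp add: f(2) linear_cmul[OF linear_reflection] right_diff_distrib)
    also have "\<dots> = t * (\<alpha> \<bullet> x) * (t ^ n * ?q x)"
      using dunkl_quotient_polynomial(2)[OF f(1) assms(2), of x] by simp
    finally have "t * (\<alpha> \<bullet> x) * ?q (t *\<^sub>R x) = t * (\<alpha> \<bullet> x) * (t ^ n * ?q x)" .
    then show ?thesis using that \<open>t \<noteq> 0\<close> by simp
  qed
  moreover have "closure {z. \<alpha> \<bullet> z \<noteq> 0} = UNIV"
    using dense_Compl_hyperplanes[of "{\<alpha>}"] assms by simp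
  moreover have "real_polynomial_function (\<lambda>x. ?q (t *\<^sub>R x))"
    by (rule polynomial_compose_linear[OF q]) (simp add: linear_iff algebra_simps)
  moreover have "real_polynomial_function (\<lambda>x. t ^ n * ?q x)"
    by (rule real_polynomial_function.intros(4)[OF real_polynomial_function.intros(2) q])
  ultimately show "?q (t *\<^sub>R x) = t ^ n * ?q x"
    using polynomial_eq_on_dense[of "\<lambda>x. ?q (t *\<^sub>R x)" "\<lambda>x. t ^ n * ?q x"] by blast
qed

lemma dunkl_quotient_regular:
  "\<alpha> \<bullet> x \<noteq> 0 \<Longrightarrow> dunkl_quotient \<alpha> f x = (f x - f (reflection \<alpha> x)) / (\<alpha> \<bullet> x)"
  by (simp add: dunkl_quotient_def)

lemma dunkl_quotient_add:
  assumes "real_polynomial_function f" "real_polynomial_function g" "\<alpha> \<noteq> 0"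
  shows "dunkl_quotient \<alpha> (\<lambda>x. f x + g x) = (\<lambda>x. dunkl_quotient \<alpha> f x + dunkl_quotient \<alpha> g x)"
  using assms dunkl_quotient_polynomial[OF assms(1,3)] dunkl_quotient_polynomial[OF assms(2,3)]
  by (intro dunkl_quotient_unique) (auto simp: distrib_left)

lemma dunkl_quotient_cmult:
  assumes "real_polynomial_function f" "\<alpha> \<noteq> 0"
  shows "dunkl_quotient \<alpha> (\<lambda>x. c * f x) = (\<lambda>x. c * dunkl_quotient \<alpha> f x)"
  using assms dunkl_quotient_polynomial[OF assms]
  by (intro dunkl_quotient_unique) (auto simp: mult.left_commute right_diff_distrib)

lemma dunkl_quotient_const:
  assumes "\<alpha> \<noteq> 0"
  shows "dunkl_quotient \<alpha> (\<lambda>x. c) = (\<lambda>x. 0)"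
  using assms by (intro dunkl_quotient_unique) auto

text \<open>Twisted Leibniz rule: the coordinate \<open>x \<bullet> b\<close> has the constant
  difference quotient \<open>2 * (\<alpha> \<bullet> b) / (\<alpha> \<bullet> \<alpha>)\<close>,
  which multiplies f at the reflected point.\<close>

lemma dunkl_quotient_inner_mult:
  assumes "real_polynomial_function f" "\<alpha> \<noteq> 0"
  shows "dunkl_quotient \<alpha> (\<lambda>x. (x \<bullet> b) * f x) =
    (\<lambda>x. (x \<bullet> b) * dunkl_quotient \<alpha> f x + 2 * (\<alpha> \<bullet> b) / (\<alpha> \<bullet> \<alpha>) * f (reflection \<alpha> x))"
proof (rule dunkl_quotient_unique)
  fix x
  have "(\<alpha> \<bullet> x) * (2 * (\<alpha> \<bullet> b) / (\<alpha> \<bullet> \<alpha>)) = x \<bullet> b - reflection \<alpha> x \<bullet> b"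
    by (simp add: reflection_def inner_diff_left)
  then have "(\<alpha> \<bullet> x) * (2 * (\<alpha> \<bullet> b) / (\<alpha> \<bullet> \<alpha>)) * f (reflection \<alpha> x)
     = (x \<bullet> b - reflection \<alpha> x \<bullet> b) * f (reflection \<alpha> x)"
    by simp
  moreover have "(x \<bullet> b) * ((\<alpha> \<bullet> x) * dunkl_quotient \<alpha> f x) = (x \<bullet> b) * (f x - f (reflection \<alpha> x))"
    by (simp add: dunkl_quotient_polynomial(2)[OF assms])
  ultimately show "(\<alpha> \<bullet> x) * ((x \<bullet> b) * dunkl_quotient \<alpha> f x + 2 * (\<alpha> \<bullet> b) / (\<alpha> \<bullet> \<alpha>) * f (reflection \<alpha> x))
    = (x \<bullet> b) * f x - (reflection \<alpha> x \<bullet> b) * f (reflection \<alpha> x)"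
    by (simp add: algebra_simps)
next
  show "real_polynomial_function
     (\<lambda>x. (x \<bullet> b) * dunkl_quotient \<alpha> f x + 2 * (\<alpha> \<bullet> b) / (\<alpha> \<bullet> \<alpha>) * f (reflection \<alpha> x))"
    by (intro real_polynomial_function.intros(2-4) polynomial_inner_right polynomial_reflection
        dunkl_quotient_polynomial assms)
qed (use assms in auto)

section \<open>Dunkl operators of a root system with nonnegative multiplicity\<close>

locale dunkl =
  fixes \<Omega> :: "(real ^ 'n) set" and \<kappa> :: "real ^ 'n \<Rightarrow> real"
  assumes rs: "root_system \<Omega>" and mult: "nonneg_multiplicity \<Omega> \<kappa>"
begin

abbreviation "T \<equiv> dunkl_op \<Omega> \<kappa>"

abbreviation "\<gamma> \<equiv> mult_sum \<Omega> \<kappa>"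

lemma finite_roots [simp]: "finite \<Omega>" and zero_notin: "0 \<notin> \<Omega>"
  using rs by (auto simp: root_system_def)

lemma root_nonzero [simp]: "\<alpha> \<in> \<Omega> \<Longrightarrow> \<alpha> \<noteq> 0"
  using zero_notin by blast

lemma reflection_root [simp]: "\<beta> \<in> \<Omega> \<Longrightarrow> \<alpha> \<in> \<Omega> \<Longrightarrow> reflection \<beta> \<alpha> \<in> \<Omega>"
  using rs by (auto simp: root_system_def)

lemma \<kappa>_nonneg: "\<alpha> \<in> \<Omega> \<Longrightarrow> 0 \<le> \<kappa> \<alpha>"
  using mult by (auto simp: nonneg_multiplicity_def)

lemma \<kappa>_reflection [simp]: "\<beta> \<in> \<Omega> \<Longrightarrow> \<alpha> \<in> \<Omega> \<Longrightarrow> \<kappa> (reflection \<beta> \<alpha>) = \<kappa> \<alpha>"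
  using mult reflection_group.step[OF _ reflection_group.identity, of \<beta> \<Omega>]
  by (auto simp: nonneg_multiplicity_def)

lemma \<gamma>_nonneg: "0 \<le> \<gamma>"
  by (simp add: mult_sum_def sum_nonneg \<kappa>_nonneg)

lemma dense_regular: "closure {x. \<forall>\<alpha>\<in>\<Omega>. \<alpha> \<bullet> x \<noteq> 0} = UNIV"
  by (rule dense_Compl_hyperplanes) (simp_all add: zero_notin)

lemma sum_reflect:
  assumes "\<beta> \<in> \<Omega>"
  shows "(\<Sum>\<alpha>\<in>\<Omega>. g (reflection \<beta> \<alpha>)) = (\<Sum>\<alpha>\<in>\<Omega>. g \<alpha>)"
  by (rule sum.reindex_bij_witness[of _ "reflection \<beta>" "reflection \<beta>"]) (use assms in auto)

lemma polynomial_dunkl_op [intro]: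
  assumes "real_polynomial_function f"
  shows "real_polynomial_function (T \<xi> f)"
  unfolding dunkl_op_def using assms
  by (intro real_polynomial_function.intros(2-4) real_polynomial_function_divide real_polynomial_function_sum
      dunkl_quotient_polynomial polynomial_dir_deriv) auto

lemma linear_dunkl_op:
  assumes "real_polynomial_function f"
  shows "linear (\<lambda>\<xi>. T \<xi> f x)"
  using linear_dir_deriv[OF assms, of x]
  by (auto simp: linear_iff dunkl_op_def sum.distrib sum_distrib_left distrib_left distrib_right
      inner_add_right add_divide_distrib mult_ac)

lemma dunkl_op_add:
  assumes "real_polynomial_function f" "real_polynomial_function g"
  shows "T \<xi> (\<lambda>x. f x + g x) = (\<lambda>x. T \<xi> f x + T \<xi> g x)"
  using assms by (auto simp: dunkl_op_def dir_deriv_add dunkl_quotient_add fun_eq_iff distrib_left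
     sum.distrib add_divide_distrib)

lemma dunkl_op_cmult:
  assumes "real_polynomial_function f"
  shows "T \<xi> (\<lambda>x. c * f x) = (\<lambda>x. c * T \<xi> f x)"
  using assms by (auto simp: dunkl_op_def dir_deriv_cmult dunkl_quotient_cmult fun_eq_iff distrib_left
     sum_distrib_left mult_ac intro!: sum.cong)

lemma dunkl_op_const: "T \<xi> (\<lambda>x. c) = (\<lambda>x. 0)"
  by (auto simp: dunkl_op_def dunkl_quotient_const fun_eq_iff)

lemma dunkl_op_diff:
  assumes "real_polynomial_function f" "real_polynomial_function g"
  shows "T \<xi> (\<lambda>x. f x - g x) = (\<lambda>x. T \<xi> f x - T \<xi> g x)"
proof -
  have "T \<xi> (\<lambda>x. f x + (-1) * g x) = (\<lambda>x. T \<xi> f x + (-1) * T \<xi> g x)"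
    using assms by (subst dunkl_op_add) (auto simp: dunkl_op_cmult[OF assms(2), of _ "-1", simplified])
  then show ?thesis by simp
qed

lemma dunkl_op_sum:
  assumes "finite I" "\<And>i. i \<in> I \<Longrightarrow> real_polynomial_function (f i)"
  shows "T \<xi> (\<lambda>x. \<Sum>i\<in>I. f i x) = (\<lambda>x. \<Sum>i\<in>I. T \<xi> (f i) x)"
  using assms
proof (induction I rule: finite_induct)
  case (insert i I)
  then show ?case
    using dunkl_op_add[of "f i" "\<lambda>x. \<Sum>i\<in>I. f i x" \<xi>] by (simp add: real_polynomial_function_sum)
qed (simp add: dunkl_op_const)

lemma dunkl_op_inner_mult:
  assumes "real_polynomial_function f"
  shows "T \<eta> (\<lambda>x. (x \<bullet> b) * f x) x = (\<eta> \<bullet> b) * f x + (x \<bullet> b) * T \<eta> f x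
    + (\<Sum>\<alpha>\<in>\<Omega>. \<kappa> \<alpha> * ((\<alpha> \<bullet> \<eta>) * (2 * (\<alpha> \<bullet> b) / (\<alpha> \<bullet> \<alpha>))) * f (reflection \<alpha> x)) / 2"
proof -
  have "dir_deriv \<eta> (\<lambda>x. (x \<bullet> b) * f x) x = (x \<bullet> b) * dir_deriv \<eta> f x + (\<eta> \<bullet> b) * f x"
    by (subst dir_deriv_mult) (auto simp: assms polynomial_inner_right dir_deriv_linear[OF bounded_linear_inner_left])
  moreover have "(\<Sum>\<alpha>\<in>\<Omega>. \<kappa> \<alpha> * (\<alpha> \<bullet> \<eta>) * dunkl_quotient \<alpha> (\<lambda>x. (x \<bullet> b) * f x) x)
     = (x \<bullet> b) * (\<Sum>\<alpha>\<in>\<Omega>. \<kappa> \<alpha> * (\<alpha> \<bullet> \<eta>) * dunkl_quotient \<alpha> f x)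
       + (\<Sum>\<alpha>\<in>\<Omega>. \<kappa> \<alpha> * ((\<alpha> \<bullet> \<eta>) * (2 * (\<alpha> \<bullet> b) / (\<alpha> \<bullet> \<alpha>))) * f (reflection \<alpha> x))"
    unfolding sum_distrib_left sum.distrib[symmetric]
    by (intro sum.cong refl, subst dunkl_quotient_inner_mult) (auto simp: assms algebra_simps)
  ultimately show ?thesis
    by (simp add: dunkl_op_def algebra_simps add_divide_distrib)
qed

lemma dunkl_op_self:
  assumes "real_polynomial_function f"
  shows "T x f x = dir_deriv x f x + (\<Sum>\<alpha>\<in>\<Omega>. \<kappa> \<alpha> * (f x - f (reflection \<alpha> x))) / 2"
  using dunkl_quotient_polynomial(2)[OF assms]
  by (auto simp: dunkl_op_def mult.assoc intro!: sum.cong)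

text \<open>Euler's identity for Dunkl operators: in the radial direction the factor
  \<open>\<alpha> \<bullet> x\<close> cancels the denominators, and on degree n only n + \<gamma> -
  A remains, A being half the \<kappa>-weighted sum over the reflections. Both the construction of
  the intertwiner and its bound rest on this operator.\<close>

lemma dunkl_op_euler:
  assumes "homogeneous_poly n f"
  shows "T x f x = (real n + \<gamma>) * f x - (\<Sum>\<alpha>\<in>\<Omega>. \<kappa> \<alpha> * f (reflection \<alpha> x)) / 2"
  using dunkl_op_self[OF homogeneous_polyD(1)[OF assms]]
  by (simp add: euler_homogeneous[OF assms] right_diff_distrib sum_subtractf mult_sum_def
      diff_divide_distrib distrib_right flip: sum_distrib_right)

lemma homogeneous_poly_dunkl_op:
  assumes "homogeneous_poly (Suc n) f"
  shows "homogeneous_poly n (T \<xi> f)"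
proof -
  have "T \<xi> f = (\<lambda>x. dir_deriv \<xi> f x + (\<Sum>\<alpha>\<in>\<Omega>. (\<kappa> \<alpha> * (\<alpha> \<bullet> \<xi>) / 2) * dunkl_quotient \<alpha> f x))"
    by (simp add: dunkl_op_def fun_eq_iff sum_divide_distrib)
  moreover have "homogeneous_poly n \<dots>"
    using assms by (intro homogeneous_poly_add homogeneous_poly_sum homogeneous_poly_cmult
        homogeneous_poly_dir_deriv homogeneous_poly_dunkl_quotient) auto
  ultimately show ?thesis by simp
qed

text \<open>The summands telescope along \<open>(\<beta>, \<alpha>) \<mapsto> (\<alpha>, reflection \<alpha> \<beta>)\<close>, a bijection that preserves
  the rotation \<open>reflection \<beta> \<circ> reflection \<alpha>\<close>, the weight \<open>\<kappa> \<beta> * \<kappa> \<alpha>\<close> and, up to sign,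
  the bivector of the pair and the vector \<open>u\<close> below.\<close>

lemma rotation_sum_zero:
  assumes reg: "\<And>\<alpha>. \<alpha> \<in> \<Omega> \<Longrightarrow> \<alpha> \<bullet> x \<noteq> 0"
  shows "(\<Sum>\<beta>\<in>\<Omega>. \<Sum>\<alpha>\<in>\<Omega>. \<kappa> \<beta> * \<kappa> \<alpha> * ((\<beta> \<bullet> \<xi>) * (\<alpha> \<bullet> \<eta>) - (\<beta> \<bullet> \<eta>) * (\<alpha> \<bullet> \<xi>))
      / ((\<beta> \<bullet> x) * (\<alpha> \<bullet> x)) * f (reflection \<beta> (reflection \<alpha> x))) = 0"
    (is "(\<Sum>\<beta>\<in>\<Omega>. \<Sum>\<alpha>\<in>\<Omega>. ?w \<beta> \<alpha>) = 0")
proof -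
  define B where "B \<beta> \<alpha> = (\<beta> \<bullet> \<xi>) * (\<alpha> \<bullet> \<eta>) - (\<beta> \<bullet> \<eta>) * (\<alpha> \<bullet> \<xi>)" for \<beta> \<alpha>
  \<comment> \<open>Up to sign, \<open>u\<close> is the bivector of the pair contracted with x. It
    is orthogonal to x and, at a regular point, vanishes only for parallel roots.\<close>
  define u where "u \<beta> \<alpha> = (\<beta> \<bullet> x) *\<^sub>R \<alpha> - (\<alpha> \<bullet> x) *\<^sub>R \<beta>" for \<beta> \<alpha>
  define F where "F \<beta> \<alpha> = \<kappa> \<beta> * \<kappa> \<alpha> * (B \<beta> \<alpha> / (u \<beta> \<alpha> \<bullet> u \<beta> \<alpha>)) * ((\<beta> \<bullet> u \<beta> \<alpha>) / (\<beta> \<bullet> x))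
      * f (reflection \<beta> (reflection \<alpha> x))" for \<beta> \<alpha>
  have w: "?w \<beta> \<alpha> = F \<alpha> (reflection \<alpha> \<beta>) - F \<beta> \<alpha>" if "\<beta> \<in> \<Omega>" "\<alpha> \<in> \<Omega>" for \<beta> \<alpha>
  proof -
    note nz = reg[OF that(1)] reg[OF that(2)]
    have u': "u \<alpha> (reflection \<alpha> \<beta>) = - u \<beta> \<alpha>"
      by (simp add: u_def reflection_def inner_diff_left algebra_simps)
    have B': "B \<alpha> (reflection \<alpha> \<beta>) = - B \<beta> \<alpha>"
      by (simp add: B_def reflection_def inner_diff_left algebra_simps)
    have F': "F \<alpha> (reflection \<alpha> \<beta>) = \<kappa> \<beta> * \<kappa> \<alpha> * (B \<beta> \<alpha> / (u \<beta> \<alpha> \<bullet> u \<beta> \<alpha>)) * ((\<alpha> \<bullet> u \<beta> \<alpha>) / (\<alpha> \<bullet> x))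
      * f (reflection \<beta> (reflection \<alpha> x))"
      using that by (simp add: F_def u' B' reflection_conj)
    show ?thesis
    proof (cases "u \<beta> \<alpha> = 0")
      \<comment> \<open>Parallel roots: the bivector B vanishes as well, so the zero denominator in
        F is harmless.\<close>
      case True
      then have "(1 / (\<beta> \<bullet> x)) *\<^sub>R ((\<beta> \<bullet> x) *\<^sub>R \<alpha>) = (1 / (\<beta> \<bullet> x)) *\<^sub>R ((\<alpha> \<bullet> x) *\<^sub>R \<beta>)"
        by (simp add: u_def)
      then have "\<alpha> = ((\<alpha> \<bullet> x) / (\<beta> \<bullet> x)) *\<^sub>R \<beta>"
        using nz by simp
      then have "B \<beta> \<alpha> = 0"
        unfolding B_def by (metis (no_types, lifting) inner_scaleR_left mult.assoc mult.commute diff_self)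
      then show ?thesis unfolding F' unfolding F_def by (simp flip: B_def)
    next
      case False
      \<comment> \<open>Partial fractions: this is the numerator of the difference of the two
        fractions below, and it cancels the normalisation by the squared length of \<open>u\<close>
        in F.\<close>
      have eq: "(\<alpha> \<bullet> u \<beta> \<alpha>) * (\<beta> \<bullet> x) - (\<beta> \<bullet> u \<beta> \<alpha>) * (\<alpha> \<bullet> x) = u \<beta> \<alpha> \<bullet> u \<beta> \<alpha>"
        by (simp add: u_def inner_diff_left inner_diff_right algebra_simps)
      have "F \<alpha> (reflection \<alpha> \<beta>) - F \<beta> \<alpha> = \<kappa> \<beta> * \<kappa> \<alpha> * (B \<beta> \<alpha> / (u \<beta> \<alpha> \<bullet> u \<beta> \<alpha>))
         * ((\<alpha> \<bullet> u \<beta> \<alpha>) / (\<alpha> \<bullet> x) - (\<beta> \<bullet> u \<beta> \<alpha>) / (\<beta> \<bullet> x)) * f (reflection \<beta> (reflection \<alpha> x))"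
        unfolding F' unfolding F_def by (simp add: algebra_simps)
      also have "(\<alpha> \<bullet> u \<beta> \<alpha>) / (\<alpha> \<bullet> x) - (\<beta> \<bullet> u \<beta> \<alpha>) / (\<beta> \<bullet> x) = (u \<beta> \<alpha> \<bullet> u \<beta> \<alpha>) / ((\<beta> \<bullet> x) * (\<alpha> \<bullet> x))"
        using nz by (simp add: diff_frac_eq mult.commute flip: eq)
      finally show ?thesis using False by (simp flip: B_def)
    qed
  qed
  have "(\<Sum>\<beta>\<in>\<Omega>. \<Sum>\<alpha>\<in>\<Omega>. ?w \<beta> \<alpha>) = (\<Sum>\<beta>\<in>\<Omega>. \<Sum>\<alpha>\<in>\<Omega>. F \<alpha> (reflection \<alpha> \<beta>)) - (\<Sum>\<beta>\<in>\<Omega>. \<Sum>\<alpha>\<in>\<Omega>. F \<beta> \<alpha>)"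
    unfolding sum_subtractf[symmetric] by (intro sum.cong refl w)
  also have "(\<Sum>\<beta>\<in>\<Omega>. \<Sum>\<alpha>\<in>\<Omega>. F \<alpha> (reflection \<alpha> \<beta>)) = (\<Sum>\<beta>\<in>\<Omega>. \<Sum>\<alpha>\<in>\<Omega>. F \<beta> \<alpha>)"
    by (subst sum.swap) (simp add: sum_reflect)
  finally show ?thesis by simp
qed

text \<open>Sort by the point at which f is evaluated. The terms at x are antisymmetric under
  exchange of the two roots. Those at a single reflection cancel after replacing \<alpha> by
  \<open>reflection \<beta> \<alpha>\<close> and exchanging the roots. Those at a double reflection
  become \<open>rotation_sum_zero\<close> by the same replacement.\<close>

lemma difference_sum_zero:
  assumes reg: "\<And>\<alpha>. \<alpha> \<in> \<Omega> \<Longrightarrow> \<alpha> \<bullet> x \<noteq> 0"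
  shows "(\<Sum>\<beta>\<in>\<Omega>. \<Sum>\<alpha>\<in>\<Omega>. \<kappa> \<beta> * \<kappa> \<alpha> * ((\<beta> \<bullet> \<xi>) * (\<alpha> \<bullet> \<eta>) - (\<beta> \<bullet> \<eta>) * (\<alpha> \<bullet> \<xi>)) *
      (((f x - f (reflection \<alpha> x)) / (\<alpha> \<bullet> x)
       - (f (reflection \<beta> x) - f (reflection \<alpha> (reflection \<beta> x))) / (\<alpha> \<bullet> reflection \<beta> x)) / (\<beta> \<bullet> x))) = 0"
    (is "(\<Sum>\<beta>\<in>\<Omega>. \<Sum>\<alpha>\<in>\<Omega>. ?w \<beta> \<alpha>) = 0")
proof -
  define B where "B \<beta> \<alpha> = \<kappa> \<beta> * \<kappa> \<alpha> * ((\<beta> \<bullet> \<xi>) * (\<alpha> \<bullet> \<eta>) - (\<beta> \<bullet> \<eta>) * (\<alpha> \<bullet> \<xi>))" for \<beta> \<alpha>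
  have B_swap: "B \<beta> \<alpha> = - B \<alpha> \<beta>" for \<alpha> \<beta>
    by (simp add: B_def algebra_simps)
  \<comment> \<open>\<open>reflection \<beta> \<alpha>\<close> differs from \<alpha> by a multiple
    of \<beta>, which the antisymmetric form does not see.\<close>
  have B_refl: "B \<beta> (reflection \<beta> \<alpha>) = B \<beta> \<alpha>" if "\<alpha> \<in> \<Omega>" "\<beta> \<in> \<Omega>" for \<alpha> \<beta>
    using that by (simp add: B_def) (simp add: reflection_def inner_diff_left algebra_simps)
  define S1 where "S1 \<beta> \<alpha> = B \<beta> \<alpha> / ((\<beta> \<bullet> x) * (\<alpha> \<bullet> x)) * f x" for \<beta> \<alpha>
  define S2 where "S2 \<beta> \<alpha> = B \<beta> \<alpha> / ((\<beta> \<bullet> x) * (\<alpha> \<bullet> x)) * f (reflection \<alpha> x)" for \<beta> \<alpha>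
  define S3 where "S3 \<beta> \<alpha> = B \<beta> \<alpha> / ((\<beta> \<bullet> x) * (\<alpha> \<bullet> reflection \<beta> x)) * f (reflection \<beta> x)" for \<beta> \<alpha>
  define S4 where "S4 \<beta> \<alpha> = B \<beta> \<alpha> / ((\<beta> \<bullet> x) * (\<alpha> \<bullet> reflection \<beta> x)) * f (reflection \<alpha> (reflection \<beta> x))" for \<beta> \<alpha>
  let ?SS = "\<lambda>S. \<Sum>\<beta>\<in>\<Omega>. \<Sum>\<alpha>\<in>\<Omega>. (S \<beta> \<alpha> :: real)"
  have "?w \<beta> \<alpha> = S1 \<beta> \<alpha> - S2 \<beta> \<alpha> - S3 \<beta> \<alpha> + S4 \<beta> \<alpha>" for \<beta> \<alpha>
    unfolding B_def[symmetric] S1_def S2_def S3_def S4_def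
    by (simp add: diff_divide_distrib right_diff_distrib mult.commute)
  then have "?SS ?w = ?SS S1 - ?SS S2 - ?SS S3 + ?SS S4"
    by (simp add: sum.distrib sum_subtractf)
  moreover have "?SS S1 = - ?SS S1"
  proof -
    have "?SS S1 = (\<Sum>\<beta>\<in>\<Omega>. \<Sum>\<alpha>\<in>\<Omega>. S1 \<alpha> \<beta>)" by (rule sum.swap)
    also have "\<dots> = - ?SS S1"
      unfolding sum_negf[symmetric] S1_def by (subst B_swap) (simp add: mult.commute)
    finally show ?thesis .
  qed
  moreover have "?SS S3 = - ?SS S2"
  proof -
    have "?SS S3 = (\<Sum>\<beta>\<in>\<Omega>. \<Sum>\<alpha>\<in>\<Omega>. S3 \<beta> (reflection \<beta> \<alpha>))"
      by (simp add: sum_reflect)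
    also have "\<dots> = (\<Sum>\<beta>\<in>\<Omega>. \<Sum>\<alpha>\<in>\<Omega>. - S2 \<alpha> \<beta>)"
    proof (intro sum.cong refl)
      fix \<beta> \<alpha> assume "\<beta> \<in> \<Omega>" "\<alpha> \<in> \<Omega>"
      then show "S3 \<beta> (reflection \<beta> \<alpha>) = - S2 \<alpha> \<beta>"
        unfolding S3_def S2_def B_swap[of \<alpha> \<beta>] by (simp add: B_refl inner_reflection mult.commute)
    qed
    also have "\<dots> = - ?SS S2"
      by (subst sum.swap) (simp add: sum_negf)
    finally show ?thesis .
  qed
  moreover have "?SS S4 = 0"
  proof -
    have "?SS S4 = (\<Sum>\<beta>\<in>\<Omega>. \<Sum>\<alpha>\<in>\<Omega>. S4 \<beta> (reflection \<beta> \<alpha>))"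
      by (simp add: sum_reflect)
    also have "\<dots> = (\<Sum>\<beta>\<in>\<Omega>. \<Sum>\<alpha>\<in>\<Omega>. B \<beta> \<alpha> / ((\<beta> \<bullet> x) * (\<alpha> \<bullet> x)) * f (reflection \<beta> (reflection \<alpha> x)))"
      by (intro sum.cong refl) (simp add: S4_def B_refl inner_reflection reflection_conj)
    also have "\<dots> = 0"
      unfolding B_def by (rule rotation_sum_zero[OF reg])
    finally show ?thesis .
  qed
  ultimately show ?thesis by linarith
qed

text \<open>Multiply by \<open>\<alpha> \<bullet> x\<close> and differentiate the equation defining
  the quotient. The chain rule produces the derivative in direction
  \<open>reflection \<alpha> \<xi>\<close>, whose deviation from direction \<xi> carries the factor
  \<open>\<alpha> \<bullet> \<xi>\<close>; weighted by \<open>\<alpha> \<bullet> \<eta>\<close>,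
  this correction is symmetric in \<xi> and \<eta>.\<close>

lemma dunkl_op_first_order_symmetric:
  assumes f: "real_polynomial_function f" and \<alpha>: "\<alpha> \<bullet> x \<noteq> 0"
  shows "(\<alpha> \<bullet> \<eta>) * dir_deriv \<xi> (dunkl_quotient \<alpha> f) x + (\<alpha> \<bullet> \<xi>) * dunkl_quotient \<alpha> (dir_deriv \<eta> f) x
    = (\<alpha> \<bullet> \<xi>) * dir_deriv \<eta> (dunkl_quotient \<alpha> f) x + (\<alpha> \<bullet> \<eta>) * dunkl_quotient \<alpha> (dir_deriv \<xi> f) x"
proof -
  have [simp]: "\<alpha> \<noteq> 0" using \<alpha> by auto
  let ?q = "dunkl_quotient \<alpha> f" and ?D = "\<lambda>\<xi>. dir_deriv \<xi> f (reflection \<alpha> x)"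
  note q = dunkl_quotient_polynomial[OF f \<open>\<alpha> \<noteq> 0\<close>]
  interpret D: linear ?D by (rule linear_dir_deriv[OF f])
  have D_refl: "?D (reflection \<alpha> \<zeta>) = ?D \<zeta> - 2 * (\<alpha> \<bullet> \<zeta>) / (\<alpha> \<bullet> \<alpha>) * ?D \<alpha>" for \<zeta>
    by (simp add: reflection_def[of \<alpha> \<zeta>] D.diff D.scale)
  have deriv: "(\<alpha> \<bullet> x) * dir_deriv \<zeta> ?q x
      = dir_deriv \<zeta> f x - ?D (reflection \<alpha> \<zeta>) - (\<alpha> \<bullet> \<zeta>) * ?q x" for \<zeta>
  proof -
    have "dir_deriv \<zeta> (\<lambda>x. (\<alpha> \<bullet> x) * ?q x) x = (\<alpha> \<bullet> x) * dir_deriv \<zeta> ?q x + (\<alpha> \<bullet> \<zeta>) * ?q x"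
      by (subst dir_deriv_mult) (auto simp: q polynomial_inner_left dir_deriv_linear[OF bounded_linear_inner_right])
    moreover have "dir_deriv \<zeta> (\<lambda>x. f x + (-1) * f (reflection \<alpha> x)) x = dir_deriv \<zeta> f x + (-1) * ?D (reflection \<alpha> \<zeta>)"
      by (subst dir_deriv_add)
        (auto simp: f polynomial_reflection dir_deriv_cmult[OF polynomial_reflection[OF f], of _ "-1", simplified]
          dir_deriv_compose_linear[OF f linear_reflection])
    ultimately show ?thesis by (simp add: q(2))
  qed
  have quot: "(\<alpha> \<bullet> x) * dunkl_quotient \<alpha> (dir_deriv \<zeta> f) x = dir_deriv \<zeta> f x - ?D \<zeta>" for \<zeta>
    by (rule dunkl_quotient_polynomial(2)) (use f in auto)
  have "(\<alpha> \<bullet> x) * ((\<alpha> \<bullet> \<eta>) * dir_deriv \<xi> ?q x + (\<alpha> \<bullet> \<xi>) * dunkl_quotient \<alpha> (dir_deriv \<eta> f) x)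
    = (\<alpha> \<bullet> \<eta>) * ((\<alpha> \<bullet> x) * dir_deriv \<xi> ?q x) + (\<alpha> \<bullet> \<xi>) * ((\<alpha> \<bullet> x) * dunkl_quotient \<alpha> (dir_deriv \<eta> f) x)"
    by (simp add: algebra_simps)
  also have "\<dots> = (\<alpha> \<bullet> \<xi>) * ((\<alpha> \<bullet> x) * dir_deriv \<eta> ?q x) + (\<alpha> \<bullet> \<eta>) * ((\<alpha> \<bullet> x) * dunkl_quotient \<alpha> (dir_deriv \<xi> f) x)"
    unfolding deriv quot D_refl by (simp add: algebra_simps)
  also have "\<dots> = (\<alpha> \<bullet> x) * ((\<alpha> \<bullet> \<xi>) * dir_deriv \<eta> ?q x + (\<alpha> \<bullet> \<eta>) * dunkl_quotient \<alpha> (dir_deriv \<xi> f) x)"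
    by (simp add: algebra_simps)
  finally show ?thesis using \<alpha> by simp
qed

text \<open>The terms are grouped by their number of difference quotients, because the three groups
  are symmetric in \<xi> and \<eta> for three different reasons. Off the hyperplanes the quotient of
  a sum splits as a plain fraction.\<close>

lemma dunkl_op_twice_regular:
  assumes f: "real_polynomial_function f" and reg: "\<And>\<alpha>. \<alpha> \<in> \<Omega> \<Longrightarrow> \<alpha> \<bullet> x \<noteq> 0"
  shows "T \<xi> (T \<eta> f) x = dir_deriv \<xi> (dir_deriv \<eta> f) x
    + (\<Sum>\<alpha>\<in>\<Omega>. \<kappa> \<alpha> * ((\<alpha> \<bullet> \<eta>) * dir_deriv \<xi> (dunkl_quotient \<alpha> f) x + (\<alpha> \<bullet> \<xi>) * dunkl_quotient \<alpha> (dir_deriv \<eta> f) x)) / 2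
    + (\<Sum>\<beta>\<in>\<Omega>. \<Sum>\<alpha>\<in>\<Omega>. \<kappa> \<beta> * \<kappa> \<alpha> * ((\<beta> \<bullet> \<xi>) * (\<alpha> \<bullet> \<eta>)) * dunkl_quotient \<beta> (dunkl_quotient \<alpha> f) x) / 4"
proof -
  let ?q = "\<lambda>\<alpha>. dunkl_quotient \<alpha> f"
  have Tf: "T \<eta> f = (\<lambda>x. dir_deriv \<eta> f x + (\<Sum>\<alpha>\<in>\<Omega>. (\<kappa> \<alpha> * (\<alpha> \<bullet> \<eta>) / 2) * ?q \<alpha> x))"
    by (simp add: dunkl_op_def fun_eq_iff sum_divide_distrib)
  have p: "real_polynomial_function (?q \<alpha>)" if "\<alpha> \<in> \<Omega>" for \<alpha>
    using dunkl_quotient_polynomial(1)[OF f root_nonzero[OF that]] .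
  have pc: "real_polynomial_function (\<lambda>x. c * ?q \<alpha> x)" if "\<alpha> \<in> \<Omega>" for \<alpha> c
    by (rule real_polynomial_function.intros(4)[OF real_polynomial_function.intros(2) p[OF that]])
  have ps: "real_polynomial_function (\<lambda>x. \<Sum>\<alpha>\<in>\<Omega>. (\<kappa> \<alpha> * (\<alpha> \<bullet> \<eta>) / 2) * ?q \<alpha> x)"
    using pc by (intro real_polynomial_function_sum) auto
  have 1: "dir_deriv \<xi> (T \<eta> f) x = dir_deriv \<xi> (dir_deriv \<eta> f) x
      + (\<Sum>\<alpha>\<in>\<Omega>. (\<kappa> \<alpha> * (\<alpha> \<bullet> \<eta>) / 2) * dir_deriv \<xi> (?q \<alpha>) x)"
    unfolding Tf dir_deriv_add[OF polynomial_dir_deriv[OF f] ps]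
    by (subst dir_deriv_sum) (use pc in \<open>auto simp: dir_deriv_cmult[OF p] simp del: times_divide_eq_left\<close>)
  have 2: "dunkl_quotient \<beta> (T \<eta> f) x = dunkl_quotient \<beta> (dir_deriv \<eta> f) x
      + (\<Sum>\<alpha>\<in>\<Omega>. (\<kappa> \<alpha> * (\<alpha> \<bullet> \<eta>) / 2) * dunkl_quotient \<beta> (?q \<alpha>) x)" if "\<beta> \<in> \<Omega>" for \<beta>
    using reg[OF that] unfolding Tf
    by (simp add: dunkl_quotient_regular[of \<beta>] add_divide_distrib diff_divide_distrib right_diff_distrib
       sum_subtractf sum_divide_distrib)
  have "T \<xi> (T \<eta> f) x = dir_deriv \<xi> (T \<eta> f) x + (\<Sum>\<beta>\<in>\<Omega>. \<kappa> \<beta> * (\<beta> \<bullet> \<xi>) * dunkl_quotient \<beta> (T \<eta> f) x) / 2"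
    by (simp add: dunkl_op_def[of _ _ \<xi>])
  also have "(\<Sum>\<beta>\<in>\<Omega>. \<kappa> \<beta> * (\<beta> \<bullet> \<xi>) * dunkl_quotient \<beta> (T \<eta> f) x)
    = (\<Sum>\<beta>\<in>\<Omega>. \<kappa> \<beta> * (\<beta> \<bullet> \<xi>) * dunkl_quotient \<beta> (dir_deriv \<eta> f) x)
     + (\<Sum>\<beta>\<in>\<Omega>. \<Sum>\<alpha>\<in>\<Omega>. \<kappa> \<beta> * \<kappa> \<alpha> * ((\<beta> \<bullet> \<xi>) * (\<alpha> \<bullet> \<eta>)) * dunkl_quotient \<beta> (?q \<alpha>) x) / 2"
    unfolding sum_divide_distrib sum.distrib[symmetric]
    by (rule sum.cong) (simp_all add: 2 distrib_left sum_distrib_left sum_divide_distrib mult_ac)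
  finally show ?thesis unfolding 1
    by (simp add: sum.distrib distrib_left add_divide_distrib sum_divide_distrib mult_ac)
qed

text \<open>At regular points, second derivatives commute, terms with one quotient match root by
  root, and terms with two quotients match after summation over pairs of roots. Density extends the
  equality of the two polynomials.\<close>

theorem dunkl_op_commute:
  assumes f: "real_polynomial_function f"
  shows "T \<xi> (T \<eta> f) = T \<eta> (T \<xi> f)"
proof
  fix x
  show "T \<xi> (T \<eta> f) x = T \<eta> (T \<xi> f) x"
  proof (rule polynomial_eq_on_dense[OF _ _ dense_regular])
    fix x assume "x \<in> {x. \<forall>\<alpha>\<in>\<Omega>. \<alpha> \<bullet> x \<noteq> 0}"
    then have reg: "\<And>\<alpha>. \<alpha> \<in> \<Omega> \<Longrightarrow> \<alpha> \<bullet> x \<noteq> 0" by auto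
    let ?Q = "\<lambda>\<beta> \<alpha>. dunkl_quotient \<beta> (dunkl_quotient \<alpha> f) x"
    have Q: "?Q \<beta> \<alpha> = ((f x - f (reflection \<alpha> x)) / (\<alpha> \<bullet> x)
       - (f (reflection \<beta> x) - f (reflection \<alpha> (reflection \<beta> x))) / (\<alpha> \<bullet> reflection \<beta> x)) / (\<beta> \<bullet> x)"
      if "\<alpha> \<in> \<Omega>" "\<beta> \<in> \<Omega>" for \<alpha> \<beta>
    proof -
      \<comment> \<open>Reflections permute the roots, so the reflected point avoids the hyperplanes
        too.\<close>
      have "\<alpha> \<bullet> reflection \<beta> x \<noteq> 0"
        using reg[of "reflection \<beta> \<alpha>"] that by (simp add: inner_reflection_commute)
      then show ?thesis using reg that by (simp add: dunkl_quotient_regular)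
    qed
    have "(\<Sum>\<beta>\<in>\<Omega>. \<Sum>\<alpha>\<in>\<Omega>. \<kappa> \<beta> * \<kappa> \<alpha> * ((\<beta> \<bullet> \<xi>) * (\<alpha> \<bullet> \<eta>)) * ?Q \<beta> \<alpha>)
        - (\<Sum>\<beta>\<in>\<Omega>. \<Sum>\<alpha>\<in>\<Omega>. \<kappa> \<beta> * \<kappa> \<alpha> * ((\<beta> \<bullet> \<eta>) * (\<alpha> \<bullet> \<xi>)) * ?Q \<beta> \<alpha>)
       = (\<Sum>\<beta>\<in>\<Omega>. \<Sum>\<alpha>\<in>\<Omega>. \<kappa> \<beta> * \<kappa> \<alpha> * ((\<beta> \<bullet> \<xi>) * (\<alpha> \<bullet> \<eta>) - (\<beta> \<bullet> \<eta>) * (\<alpha> \<bullet> \<xi>)) * ?Q \<beta> \<alpha>)"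
      by (simp add: sum_subtractf right_diff_distrib left_diff_distrib)
    also have "\<dots> = 0"
      using difference_sum_zero[OF reg, of \<xi> \<eta> f] by (simp add: Q)
    finally have eq: "(\<Sum>\<beta>\<in>\<Omega>. \<Sum>\<alpha>\<in>\<Omega>. \<kappa> \<beta> * \<kappa> \<alpha> * ((\<beta> \<bullet> \<xi>) * (\<alpha> \<bullet> \<eta>)) * ?Q \<beta> \<alpha>)
        = (\<Sum>\<beta>\<in>\<Omega>. \<Sum>\<alpha>\<in>\<Omega>. \<kappa> \<beta> * \<kappa> \<alpha> * ((\<beta> \<bullet> \<eta>) * (\<alpha> \<bullet> \<xi>)) * ?Q \<beta> \<alpha>)"
      by simp
    have "(\<Sum>\<alpha>\<in>\<Omega>. \<kappa> \<alpha> * ((\<alpha> \<bullet> \<eta>) * dir_deriv \<xi> (dunkl_quotient \<alpha> f) x + (\<alpha> \<bullet> \<xi>) * dunkl_quotient \<alpha> (dir_deriv \<eta> f) x))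
      = (\<Sum>\<alpha>\<in>\<Omega>. \<kappa> \<alpha> * ((\<alpha> \<bullet> \<xi>) * dir_deriv \<eta> (dunkl_quotient \<alpha> f) x + (\<alpha> \<bullet> \<eta>) * dunkl_quotient \<alpha> (dir_deriv \<xi> f) x))"
      using dunkl_op_first_order_symmetric[OF f reg] by (intro sum.cong refl) simp
    then show "T \<xi> (T \<eta> f) x = T \<eta> (T \<xi> f) x"
      using eq dir_deriv_commute[OF f, of \<xi> \<eta>] dunkl_op_twice_regular[OF f reg, where \<xi>=\<xi> and \<eta>=\<eta>]
        dunkl_op_twice_regular[OF f reg, where \<xi>=\<eta> and \<eta>=\<xi>] by simp
  qed (use f in blast)+
qed

end

section \<open>The intertwining operator\<close>

lemma linear_functional_expand:
  fixes L :: "'a::euclidean_space \<Rightarrow> real"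
  assumes "linear L"
  shows "L v = (\<Sum>b\<in>Basis. (v \<bullet> b) * L b)"
  by (subst euclidean_representation[of v, symmetric]) (simp only: linear_sum[OF assms] linear_cmul[OF assms] real_scaleR_def)

section \<open>The reflection group and its finiteness\<close>

lemma reflection_group_linear: "g \<in> reflection_group \<Omega> \<Longrightarrow> linear g"
proof (induction rule: reflection_group.induct)
  case identity
  then show ?case by (simp add: id_def linear_id linear_ident)
next
  case (step \<alpha> g)
  then show ?case using linear_compose[OF _ linear_reflection] by blast
qed

lemma reflection_group_fixes:
  "g \<in> reflection_group \<Omega> \<Longrightarrow> \<forall>\<alpha>\<in>\<Omega>. \<alpha> \<bullet> x = 0 \<Longrightarrow> g x = x"
  by (induction rule: reflection_group.induct) (auto simp: reflection_inner_zero)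

text \<open>The inductive definition multiplies on the left, whereas reflecting the argument in
  \<open>resolvent_eq\<close> multiplies group elements on the right.\<close>

lemma reflection_group_right:
  "g \<in> reflection_group \<Omega> \<Longrightarrow> \<beta> \<in> \<Omega> \<Longrightarrow> g \<circ> reflection \<beta> \<in> reflection_group \<Omega>"
proof (induction rule: reflection_group.induct)
  case identity
  then show ?case using reflection_group.step[OF _ reflection_group.identity] by simp
next
  case (step \<alpha> g)
  then show ?case using reflection_group.step[of \<alpha> \<Omega> "g \<circ> reflection \<beta>"] by (metis comp_assoc)
qed

context dunkl
begin

lemma reflection_group_maps: "g \<in> reflection_group \<Omega> \<Longrightarrow> \<alpha> \<in> \<Omega> \<Longrightarrow> g \<alpha> \<in> \<Omega>"
  by (induction rule: reflection_group.induct) auto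

text \<open>A group element permutes the finitely many roots and fixes the orthogonal complement of
  their span, so its restriction to the roots determines it, even if they do not span the
  space.\<close>

lemma finite_reflection_group [simp]: "finite (reflection_group \<Omega>)"
proof (rule inj_on_finite)
  show "finite (\<Omega> \<rightarrow>\<^sub>E \<Omega>)"
    by (intro finite_PiE) auto
  show "(\<lambda>g. restrict g \<Omega>) ` reflection_group \<Omega> \<subseteq> \<Omega> \<rightarrow>\<^sub>E \<Omega>"
    using reflection_group_maps by auto
  show "inj_on (\<lambda>g. restrict g \<Omega>) (reflection_group \<Omega>)"
  proof (rule inj_onI, rule ext)
    fix g h x assume g: "g \<in> reflection_group \<Omega>" and h: "h \<in> reflection_group \<Omega>"
      and eq: "restrict g \<Omega> = restrict h \<Omega>"
    note lin = reflection_group_linear[OF g] reflection_group_linear[OF h]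
    obtain y z where yz: "y \<in> span \<Omega>" "\<And>w. w \<in> span \<Omega> \<Longrightarrow> orthogonal z w" "x = y + z"
      using orthogonal_subspace_decomp_exists[of \<Omega> x] by blast
    have "g \<alpha> = h \<alpha>" if "\<alpha> \<in> \<Omega>" for \<alpha>
      using eq that by (metis restrict_apply')
    then have "g y = h y"
      using linear_eq_on_span[OF lin] yz(1) by blast
    moreover have "\<forall>\<alpha>\<in>\<Omega>. \<alpha> \<bullet> z = 0"
      using yz(2) span_base by (auto simp: orthogonal_def inner_commute)
    then have "g z = h z"
      using reflection_group_fixes[OF g] reflection_group_fixes[OF h] by metis
    ultimately show "g x = h x"
      by (simp add: yz(3) linear_add[OF lin(1)] linear_add[OF lin(2)])
  qed
qed

text \<open>With \<open>A f x = (\<Sum>\<alpha>\<in>\<Omega>. \<kappa> \<alpha> * f (reflection \<alpha> x)) / 2\<close>, the number \<open>walk k g\<close> is the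
  coefficient of \<open>g\<close> in \<open>A\<^sup>k\<close>, and \<open>resolvent s\<close> is the Neumann series of \<open>(s - A)\<^sup>-\<^sup>1\<close>. Staying in
  the algebra of a finite group makes it map polynomials to polynomials.\<close>

primrec walk :: "nat \<Rightarrow> (real ^ 'n \<Rightarrow> real ^ 'n) \<Rightarrow> real" where
  "walk 0 g = (if g = id then 1 else 0)"
| "walk (Suc k) g = (\<Sum>\<alpha>\<in>\<Omega>. \<kappa> \<alpha> * walk k (g \<circ> reflection \<alpha>)) / 2"

definition resolvent_coeff :: "real \<Rightarrow> (real ^ 'n \<Rightarrow> real ^ 'n) \<Rightarrow> real" where
  "resolvent_coeff s g = (\<Sum>k. walk k g / s ^ Suc k)"

definition resolvent :: "real \<Rightarrow> (real ^ 'n \<Rightarrow> real) \<Rightarrow> real ^ 'n \<Rightarrow> real" where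
  "resolvent s h x = (\<Sum>g\<in>reflection_group \<Omega>. resolvent_coeff s g * h (g x))"

text \<open>The weights \<open>\<kappa> \<alpha> / 2\<close> add up to \<gamma>, so each application
  of A multiplies the bound on a single coefficient by \<gamma>. Hence the Neumann series converges
  for s > \<gamma>.\<close>

lemma walk_bounds: "0 \<le> walk k g \<and> walk k g \<le> \<gamma> ^ k"
proof (induction k arbitrary: g)
  case (Suc k)
  have "(\<Sum>\<alpha>\<in>\<Omega>. \<kappa> \<alpha> * walk k (g \<circ> reflection \<alpha>)) \<le> (\<Sum>\<alpha>\<in>\<Omega>. \<kappa> \<alpha> * \<gamma> ^ k)"
    using Suc by (intro sum_mono mult_left_mono) (auto simp: \<kappa>_nonneg)
  also have "\<dots> / 2 = \<gamma> ^ Suc k"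
    by (simp add: mult_sum_def flip: sum_distrib_right)
  finally show ?case
    using Suc by (simp add: sum_nonneg \<kappa>_nonneg)
qed auto

lemma summable_walk:
  assumes "\<gamma> < s"
  shows "summable (\<lambda>k. walk k g / s ^ Suc k)"
proof (rule summable_comparison_test)
  have s: "0 < s" using assms \<gamma>_nonneg by linarith
  show "\<exists>N. \<forall>k\<ge>N. norm (walk k g / s ^ Suc k) \<le> (\<gamma> / s) ^ k / s"
  proof (intro exI allI impI)
    fix k
    have "walk k g / s ^ Suc k \<le> \<gamma> ^ k / s ^ Suc k"
      using walk_bounds s by (intro divide_right_mono) auto
    then show "norm (walk k g / s ^ Suc k) \<le> (\<gamma> / s) ^ k / s"
      using walk_bounds s by (simp add: power_divide mult.commute)
  qed
  show "summable (\<lambda>k. (\<gamma> / s) ^ k / s)"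
    using assms s \<gamma>_nonneg by (intro summable_divide summable_geometric) simp
qed

lemma resolvent_coeff_eq:
  assumes "\<gamma> < s"
  shows "s * resolvent_coeff s g - (\<Sum>\<alpha>\<in>\<Omega>. \<kappa> \<alpha> * resolvent_coeff s (g \<circ> reflection \<alpha>)) / 2
    = (if g = id then 1 else 0)"
proof -
  have s: "0 < s" using assms \<gamma>_nonneg by linarith
  note sm = summable_walk[OF assms]
  have sums: "(\<lambda>k. walk k g / s ^ Suc k) sums resolvent_coeff s g" for g
    unfolding resolvent_coeff_def using sm by (rule summable_sums)
  have "(\<lambda>k. (\<Sum>\<alpha>\<in>\<Omega>. \<kappa> \<alpha> * (walk k (g \<circ> reflection \<alpha>) / s ^ Suc k)) / 2)
      sums ((\<Sum>\<alpha>\<in>\<Omega>. \<kappa> \<alpha> * resolvent_coeff s (g \<circ> reflection \<alpha>)) / 2)"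
    by (intro sums_divide sums_sum sums_mult sums)
  then have 1: "(\<lambda>k. walk (Suc k) g / s ^ Suc k)
      sums ((\<Sum>\<alpha>\<in>\<Omega>. \<kappa> \<alpha> * resolvent_coeff s (g \<circ> reflection \<alpha>)) / 2)"
    by (simp add: sum_divide_distrib mult_ac)
  have "(\<lambda>k. s * (walk k g / s ^ Suc k)) sums (s * resolvent_coeff s g)"
    by (intro sums_mult sums)
  then have "(\<lambda>k. walk k g / s ^ k) sums (s * resolvent_coeff s g)"
    using s by simp
  \<comment> \<open>Shifting the index removes the term k = 0, which is the unit of the group
    algebra and becomes the right-hand side.\<close>
  then have "(\<lambda>k. walk (Suc k) g / s ^ Suc k) sums (s * resolvent_coeff s g - walk 0 g / s ^ 0)"
    by (subst sums_Suc_iff) simp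
  then have "(\<Sum>\<alpha>\<in>\<Omega>. \<kappa> \<alpha> * resolvent_coeff s (g \<circ> reflection \<alpha>)) / 2
      = s * resolvent_coeff s g - walk 0 g / s ^ 0"
    using sums_unique2[OF 1] by blast
  moreover have "walk 0 g / s ^ 0 = (if g = id then 1 else 0)"
    by simp
  ultimately show ?thesis by linarith
qed

text \<open>Right multiplication by a reflection is an involution of the group. Reindexing by it
  moves the reflection from the argument of h to the coefficients, where
  \<open>resolvent_coeff_eq\<close> applies.\<close>

lemma resolvent_eq:
  assumes "\<gamma> < s"
  shows "s * resolvent s h x - (\<Sum>\<alpha>\<in>\<Omega>. \<kappa> \<alpha> * resolvent s h (reflection \<alpha> x)) / 2 = h x"
proof -
  let ?G = "reflection_group \<Omega>"
  define b where "b g = (\<Sum>\<alpha>\<in>\<Omega>. \<kappa> \<alpha> * resolvent_coeff s (g \<circ> reflection \<alpha>))" for g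
  have "resolvent s h (reflection \<alpha> x) = (\<Sum>g\<in>?G. resolvent_coeff s (g \<circ> reflection \<alpha>) * h (g x))"
    if "\<alpha> \<in> \<Omega>" for \<alpha>
    unfolding resolvent_def
    by (rule sum.reindex_bij_witness[of _ "\<lambda>g. g \<circ> reflection \<alpha>" "\<lambda>g. g \<circ> reflection \<alpha>"])
      (use that reflection_group_right in \<open>auto simp: comp_def\<close>)
  then have "(\<Sum>\<alpha>\<in>\<Omega>. \<kappa> \<alpha> * resolvent s h (reflection \<alpha> x))
     = (\<Sum>\<alpha>\<in>\<Omega>. \<kappa> \<alpha> * (\<Sum>g\<in>?G. resolvent_coeff s (g \<circ> reflection \<alpha>) * h (g x)))"
    by (intro sum.cong) auto
  also have "\<dots> = (\<Sum>g\<in>?G. b g * h (g x))"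
    unfolding sum_distrib_left sum_distrib_right b_def by (subst sum.swap) (simp add: mult.assoc)
  finally have eq: "(\<Sum>\<alpha>\<in>\<Omega>. \<kappa> \<alpha> * resolvent s h (reflection \<alpha> x)) = (\<Sum>g\<in>?G. b g * h (g x))" .
  have "s * resolvent s h x - (\<Sum>\<alpha>\<in>\<Omega>. \<kappa> \<alpha> * resolvent s h (reflection \<alpha> x)) / 2
    = (\<Sum>g\<in>?G. (s * resolvent_coeff s g - b g / 2) * h (g x))"
    unfolding eq unfolding resolvent_def
    by (simp add: sum_distrib_left sum_divide_distrib left_diff_distrib sum_subtractf mult.assoc)
  also have "\<dots> = (\<Sum>g\<in>?G. if g = id then h x else 0)"
    unfolding b_def resolvent_coeff_eq[OF assms] by (intro sum.cong) auto
  also have "\<dots> = h x"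
    by (simp add: reflection_group.identity)
  finally show ?thesis .
qed

lemma homogeneous_poly_resolvent:
  assumes "homogeneous_poly n h"
  shows "homogeneous_poly n (resolvent s h)"
proof -
  have "homogeneous_poly n (\<lambda>x. h (g x))" if "g \<in> reflection_group \<Omega>" for g
    using assms reflection_group_linear[OF that] by (rule homogeneous_poly_compose_linear)
  then show ?thesis
    unfolding resolvent_def by (intro homogeneous_poly_sum homogeneous_poly_cmult) auto
qed

lemma resolvent_add: "resolvent s (\<lambda>x. f x + g x) = (\<lambda>x. resolvent s f x + resolvent s g x)"
  by (simp add: resolvent_def fun_eq_iff distrib_left sum.distrib)

lemma resolvent_cmult: "resolvent s (\<lambda>x. c * f x) = (\<lambda>x. c * resolvent s f x)"
  by (simp add: resolvent_def fun_eq_iff sum_distrib_left mult.left_commute)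

text \<open>Applying a Dunkl operator to \<open>w x x = 0\<close> gives a mean value identity for \<open>w\<close> under the
  reflections, with total weight less than one, so the maximum principle applies.\<close>

lemma closed_form_eq_zero:
  assumes hom: "\<And>\<xi>. homogeneous_poly n (w \<xi>)"
    and lin: "\<And>x. linear (\<lambda>\<xi>. w \<xi> x)"
    and diag: "\<And>x. w x x = 0"
    and closed: "\<And>\<xi> \<eta> x. T \<eta> (w \<xi>) x = T \<xi> (w \<eta>) x"
  shows "w \<eta> x = 0"
proof -
  have poly: "real_polynomial_function (w \<xi>)" for \<xi>
    using hom by (rule homogeneous_polyD)
  note expand = linear_functional_expand
  have mean: "(real n + 1 + \<gamma>) * w \<eta> x = (\<Sum>\<alpha>\<in>\<Omega>. \<kappa> \<alpha> * w (reflection \<alpha> \<eta>) (reflection \<alpha> x)) / 2" for \<eta> x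
  proof -
    have "(\<lambda>x. \<Sum>b\<in>Basis. (x \<bullet> b) * w b x) = (\<lambda>x. 0)"
      using diag by (simp add: fun_eq_iff flip: expand[OF lin])
    then have "0 = T \<eta> (\<lambda>x. \<Sum>b\<in>Basis. (x \<bullet> b) * w b x) x"
      by (simp add: dunkl_op_const)
    also have "\<dots> = (\<Sum>b\<in>Basis. T \<eta> (\<lambda>x. (x \<bullet> b) * w b x) x)"
      by (subst dunkl_op_sum) (auto intro!: real_polynomial_function.intros(4) poly)
    \<comment> \<open>Closedness exchanges the directions, \<open>T \<eta> (w b)\<close> becoming
      \<open>T b (w \<eta>)\<close>. The basis sum then collapses to the radial
      \<open>T x (w \<eta>) x\<close>, to which Euler's identity applies.\<close>
    also have "\<dots> = (\<Sum>b\<in>Basis. (\<eta> \<bullet> b) * w b x) + (\<Sum>b\<in>Basis. (x \<bullet> b) * T b (w \<eta>) x)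
        + (\<Sum>b\<in>Basis. \<Sum>\<alpha>\<in>\<Omega>. \<kappa> \<alpha> * ((\<alpha> \<bullet> \<eta>) * (2 * (\<alpha> \<bullet> b) / (\<alpha> \<bullet> \<alpha>))) * w b (reflection \<alpha> x)) / 2"
      by (simp add: dunkl_op_inner_mult poly closed[of \<eta>] sum.distrib sum_divide_distrib)
    also have "(\<Sum>b\<in>Basis. (\<eta> \<bullet> b) * w b x) = w \<eta> x"
      by (rule expand[OF lin, symmetric])
    also have "(\<Sum>b\<in>Basis. (x \<bullet> b) * T b (w \<eta>) x) = T x (w \<eta>) x"
      by (rule expand[OF linear_dunkl_op[OF poly], symmetric])
    also have "T x (w \<eta>) x = (real n + \<gamma>) * w \<eta> x - (\<Sum>\<alpha>\<in>\<Omega>. \<kappa> \<alpha> * w \<eta> (reflection \<alpha> x)) / 2"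
      by (rule dunkl_op_euler[OF hom])
    also have "(\<Sum>b\<in>Basis. \<Sum>\<alpha>\<in>\<Omega>. \<kappa> \<alpha> * ((\<alpha> \<bullet> \<eta>) * (2 * (\<alpha> \<bullet> b) / (\<alpha> \<bullet> \<alpha>))) * w b (reflection \<alpha> x))
        = (\<Sum>\<alpha>\<in>\<Omega>. \<kappa> \<alpha> * (2 * (\<alpha> \<bullet> \<eta>) / (\<alpha> \<bullet> \<alpha>)) * w \<alpha> (reflection \<alpha> x))"
    proof (subst sum.swap, intro sum.cong refl)
      fix \<alpha>
      have "(\<Sum>b\<in>Basis. \<kappa> \<alpha> * ((\<alpha> \<bullet> \<eta>) * (2 * (\<alpha> \<bullet> b) / (\<alpha> \<bullet> \<alpha>))) * w b (reflection \<alpha> x))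
        = \<kappa> \<alpha> * (2 * (\<alpha> \<bullet> \<eta>) / (\<alpha> \<bullet> \<alpha>)) * (\<Sum>b\<in>Basis. (\<alpha> \<bullet> b) * w b (reflection \<alpha> x))"
        unfolding sum_distrib_left by (intro sum.cong refl) simp
      then show "(\<Sum>b\<in>Basis. \<kappa> \<alpha> * ((\<alpha> \<bullet> \<eta>) * (2 * (\<alpha> \<bullet> b) / (\<alpha> \<bullet> \<alpha>))) * w b (reflection \<alpha> x))
        = \<kappa> \<alpha> * (2 * (\<alpha> \<bullet> \<eta>) / (\<alpha> \<bullet> \<alpha>)) * w \<alpha> (reflection \<alpha> x)"
        by (simp flip: expand[OF lin])
    qed
    \<comment> \<open>The 1 comes from differentiating the coordinates, n + \<gamma> from Euler's
      identity. The two reflection sums combine so that the direction is reflected along with the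
      point.\<close>
    finally have "(real n + 1 + \<gamma>) * w \<eta> x = ((\<Sum>\<alpha>\<in>\<Omega>. \<kappa> \<alpha> * w \<eta> (reflection \<alpha> x))
        - (\<Sum>\<alpha>\<in>\<Omega>. \<kappa> \<alpha> * (2 * (\<alpha> \<bullet> \<eta>) / (\<alpha> \<bullet> \<alpha>)) * w \<alpha> (reflection \<alpha> x))) / 2"
      by (simp add: algebra_simps)
    also have "(\<Sum>\<alpha>\<in>\<Omega>. \<kappa> \<alpha> * w \<eta> (reflection \<alpha> x))
        - (\<Sum>\<alpha>\<in>\<Omega>. \<kappa> \<alpha> * (2 * (\<alpha> \<bullet> \<eta>) / (\<alpha> \<bullet> \<alpha>)) * w \<alpha> (reflection \<alpha> x))
      = (\<Sum>\<alpha>\<in>\<Omega>. \<kappa> \<alpha> * w (reflection \<alpha> \<eta>) (reflection \<alpha> x))"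
      unfolding sum_subtractf[symmetric]
    proof (intro sum.cong refl)
      fix \<alpha>
      show "\<kappa> \<alpha> * w \<eta> (reflection \<alpha> x) - \<kappa> \<alpha> * (2 * (\<alpha> \<bullet> \<eta>) / (\<alpha> \<bullet> \<alpha>)) * w \<alpha> (reflection \<alpha> x)
        = \<kappa> \<alpha> * w (reflection \<alpha> \<eta>) (reflection \<alpha> x)"
        by (subst (3) reflection_def) (simp add: linear_diff[OF lin] linear_cmul[OF lin] algebra_simps)
    qed
    finally show ?thesis .
  qed
  let ?S = "sphere (0 :: real ^ 'n) 1"
  \<comment> \<open>Joint continuity is not among the hypotheses; expanding the direction in the
    basis reduces it to that of finitely many polynomials.\<close>
  have "continuous_on (?S \<times> ?S) (\<lambda>(\<eta>, x). \<bar>\<Sum>b\<in>Basis. (\<eta> \<bullet> b) * w b x\<bar>)"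
    unfolding case_prod_unfold
    using polynomial_isCont[OF poly]
    by (intro continuous_intros continuous_on_compose2[OF continuous_at_imp_continuous_on, of UNIV "w b" for b]) auto
  then have "continuous_on (?S \<times> ?S) (\<lambda>(\<eta>, x). \<bar>w \<eta> x\<bar>)"
    by (simp flip: expand[OF lin])
  moreover have "?S \<times> ?S \<noteq> {}"
    by (simp add: sphere_eq_empty)
  ultimately obtain \<eta>0 x0 where max: "(\<eta>0, x0) \<in> ?S \<times> ?S"
    "\<And>\<eta> x. (\<eta>, x) \<in> ?S \<times> ?S \<Longrightarrow> \<bar>w \<eta> x\<bar> \<le> \<bar>w \<eta>0 x0\<bar>"
    using continuous_attains_sup[of "?S \<times> ?S" "\<lambda>(\<eta>, x). \<bar>w \<eta> x\<bar>"] by (auto simp: compact_Times)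
  have "(real n + 1 + \<gamma>) * \<bar>w \<eta>0 x0\<bar> = \<bar>(real n + 1 + \<gamma>) * w \<eta>0 x0\<bar>"
    using \<gamma>_nonneg by (simp add: abs_mult)
  also have "\<dots> \<le> (\<Sum>\<alpha>\<in>\<Omega>. \<bar>\<kappa> \<alpha> * w (reflection \<alpha> \<eta>0) (reflection \<alpha> x0)\<bar>) / 2"
    unfolding mean by (simp add: sum_abs)
  also have "\<dots> \<le> (\<Sum>\<alpha>\<in>\<Omega>. \<kappa> \<alpha> * \<bar>w \<eta>0 x0\<bar>) / 2"
    using max by (intro divide_right_mono sum_mono) (auto simp: abs_mult \<kappa>_nonneg intro!: mult_left_mono)
  also have "\<dots> = \<gamma> * \<bar>w \<eta>0 x0\<bar>"
    by (simp add: mult_sum_def sum_distrib_right)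
  finally have "(real n + 1) * \<bar>w \<eta>0 x0\<bar> \<le> 0"
    by (simp add: algebra_simps)
  then have "\<bar>w \<eta>0 x0\<bar> = 0"
    by (simp add: mult_le_0_iff)
  then have zero: "w \<eta> x = 0" if "norm \<eta> = 1" "norm x = 1" for \<eta> x
    using max(2)[of \<eta> x] that by simp
  have unit: "\<exists>t u. norm u = 1 \<and> v = t *\<^sub>R u" for v :: "real ^ 'n"
  proof (cases "v = 0")
    case True
    moreover obtain u :: "real ^ 'n" where "norm u = 1" using vector_choose_size[of 1] by auto
    ultimately show ?thesis by (intro exI[of _ 0] exI[of _ u]) simp
  next
    case False
    then show ?thesis by (intro exI[of _ "norm v"] exI[of _ "sgn v"]) (simp add: norm_sgn sgn_div_norm)
  qed
  obtain s u where "norm u = 1" "\<eta> = s *\<^sub>R u" using unit by blast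
  moreover obtain t v where "norm v = 1" "x = t *\<^sub>R v" using unit by blast
  ultimately show ?thesis
    by (simp add: linear_cmul[OF lin] homogeneous_polyD(2)[OF hom] zero)
qed

text \<open>Taking \<xi> = x in \<open>T \<xi> (V p) = V (dir_deriv \<xi> p)\<close> forces, by
  Euler's identity in degree n + 1, that n + 1 + \<gamma> - A maps V p to the sum of the x_b V(d_b
  p). The recursion inverts this operator; its parameter exceeds \<gamma>, so the resolvent equation
  is available.\<close>

primrec homogeneous_intertwiner :: "nat \<Rightarrow> (real ^ 'n \<Rightarrow> real) \<Rightarrow> real ^ 'n \<Rightarrow> real" where
  "homogeneous_intertwiner 0 p = p"
| "homogeneous_intertwiner (Suc n) p = resolvent (real (Suc n) + \<gamma>)
     (\<lambda>x. \<Sum>b\<in>Basis. (x \<bullet> b) * homogeneous_intertwiner n (dir_deriv b p) x)"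

lemma homogeneous_poly_intertwiner:
  "homogeneous_poly n p \<Longrightarrow> homogeneous_poly n (homogeneous_intertwiner n p)"
proof (induction n arbitrary: p)
  case (Suc n)
  have "homogeneous_poly (1 + n) (\<lambda>x. (x \<bullet> b) * homogeneous_intertwiner n (dir_deriv b p) x)" for b
    by (intro homogeneous_poly_mult homogeneous_poly_inner Suc.IH homogeneous_poly_dir_deriv Suc.prems)
  then show ?case
    by (auto intro!: homogeneous_poly_resolvent homogeneous_poly_sum)
qed simp

lemma homogeneous_intertwiner_add:
  "real_polynomial_function p \<Longrightarrow> real_polynomial_function q \<Longrightarrow>
    homogeneous_intertwiner n (\<lambda>x. p x + q x)
      = (\<lambda>x. homogeneous_intertwiner n p x + homogeneous_intertwiner n q x)"
proof (induction n arbitrary: p q)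
  case (Suc n)
  then show ?case
    by (simp add: dir_deriv_add polynomial_dir_deriv distrib_left sum.distrib resolvent_add)
qed simp

lemma homogeneous_intertwiner_cmult:
  "real_polynomial_function p \<Longrightarrow>
    homogeneous_intertwiner n (\<lambda>x. c * p x) = (\<lambda>x. c * homogeneous_intertwiner n p x)"
proof (induction n arbitrary: p)
  case (Suc n)
  then show ?case
    by (simp add: dir_deriv_cmult polynomial_dir_deriv mult.left_commute[of _ c] resolvent_cmult flip: sum_distrib_left)
qed simp

lemma homogeneous_intertwiner_zero: "homogeneous_intertwiner n (\<lambda>x. 0) = (\<lambda>x. 0)"
  using homogeneous_intertwiner_cmult[of "\<lambda>x. 0" n 0] by (simp add: real_polynomial_function.intros(2))

lemma linear_homogeneous_intertwiner_dir_deriv: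
  assumes "real_polynomial_function p"
  shows "linear (\<lambda>\<xi>. homogeneous_intertwiner n (dir_deriv \<xi> p) x)"
proof (rule linearI)
  fix \<xi> \<eta> and c :: real
  have "dir_deriv (\<xi> + \<eta>) p = (\<lambda>x. dir_deriv \<xi> p x + dir_deriv \<eta> p x)"
    "dir_deriv (c *\<^sub>R \<xi>) p = (\<lambda>x. c * dir_deriv \<xi> p x)"
    using linear_add[OF linear_dir_deriv[OF assms]] linear_cmul[OF linear_dir_deriv[OF assms]]
    by (auto simp: fun_eq_iff)
  then show "homogeneous_intertwiner n (dir_deriv (\<xi> + \<eta>) p) x
      = homogeneous_intertwiner n (dir_deriv \<xi> p) x + homogeneous_intertwiner n (dir_deriv \<eta> p) x"
    "homogeneous_intertwiner n (dir_deriv (c *\<^sub>R \<xi>) p) x = c *\<^sub>R homogeneous_intertwiner n (dir_deriv \<xi> p) x"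
    using assms by (simp_all add: homogeneous_intertwiner_add homogeneous_intertwiner_cmult polynomial_dir_deriv)
qed

text \<open>The recursion guarantees the relation only for \<xi> = x. The defect \<open>w\<close> is
  closed: \<open>T \<eta> (T \<xi> q)\<close> is symmetric by commutativity, and by induction its
  second part turns into the image of a mixed second derivative of p.
  \<open>closed_form_eq_zero\<close> then covers all directions.\<close>

lemma dunkl_op_homogeneous_intertwiner:
  "homogeneous_poly (Suc n) p \<Longrightarrow>
    T \<xi> (homogeneous_intertwiner (Suc n) p) = homogeneous_intertwiner n (dir_deriv \<xi> p)"
proof (induction n arbitrary: p \<xi> rule: less_induct)
  case (less n)
  note IH = less.IH and p = less.prems
  note poly = homogeneous_polyD(1)[OF p]
  define q where "q = homogeneous_intertwiner (Suc n) p"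
  have q: "homogeneous_poly (Suc n) q"
    unfolding q_def using p by (rule homogeneous_poly_intertwiner)
  define w where "w \<xi> x = T \<xi> q x - homogeneous_intertwiner n (dir_deriv \<xi> p) x" for \<xi> x
  have hom: "homogeneous_poly n (homogeneous_intertwiner n (dir_deriv \<xi> p))" for \<xi>
    using p by (intro homogeneous_poly_intertwiner homogeneous_poly_dir_deriv)
  have deriv: "T \<eta> (homogeneous_intertwiner n (dir_deriv \<xi> p)) = T \<xi> (homogeneous_intertwiner n (dir_deriv \<eta> p))" for \<xi> \<eta>
  proof (cases n)
    case 0
    have "homogeneous_intertwiner n (dir_deriv \<xi> p) = (\<lambda>x. homogeneous_intertwiner n (dir_deriv \<xi> p) 0)" for \<xi>
      using homogeneous_poly_0_const hom[of \<xi>] 0 by auto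
    then have "T \<eta> (homogeneous_intertwiner n (dir_deriv \<xi> p)) = (\<lambda>x. 0)" for \<xi> \<eta>
      using dunkl_op_const[of \<eta> "homogeneous_intertwiner n (dir_deriv \<xi> p) 0"] by simp
    then show ?thesis by simp
  next
    case (Suc m)
    have "homogeneous_poly (Suc m) (dir_deriv \<xi> p)" for \<xi>
      using p Suc by (auto intro: homogeneous_poly_dir_deriv)
    then have "T \<eta> (homogeneous_intertwiner n (dir_deriv \<xi> p)) = homogeneous_intertwiner m (dir_deriv \<eta> (dir_deriv \<xi> p))" for \<xi> \<eta>
      unfolding Suc by (intro IH) (simp_all add: Suc)
    then show ?thesis
      by (simp add: dir_deriv_commute[OF poly, of \<eta> \<xi>])
  qed
  have "w \<eta> x = 0" for \<eta> x
  proof (rule closed_form_eq_zero)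
    show "homogeneous_poly n (w \<xi>)" for \<xi>
      unfolding w_def by (intro homogeneous_poly_diff homogeneous_poly_dunkl_op q hom)
    show "linear (\<lambda>\<xi>. w \<xi> x)" for x
      unfolding w_def by (intro linear_compose_sub linear_dunkl_op homogeneous_polyD(1)[OF q]
          linear_homogeneous_intertwiner_dir_deriv poly)
    show "w x x = 0" for x
    proof -
      have "T x q x = (\<Sum>b\<in>Basis. (x \<bullet> b) * homogeneous_intertwiner n (dir_deriv b p) x)"
        unfolding dunkl_op_euler[OF q] unfolding q_def homogeneous_intertwiner.simps
        by (rule resolvent_eq) simp
      also have "\<dots> = homogeneous_intertwiner n (dir_deriv x p) x"
        by (rule linear_functional_expand[OF linear_homogeneous_intertwiner_dir_deriv[OF poly], symmetric])
      finally show ?thesis by (simp add: w_def)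
    qed
    show "T \<eta> (w \<xi>) x = T \<xi> (w \<eta>) x" for \<xi> \<eta> x
      unfolding w_def
      by (subst (1 2) dunkl_op_diff)
        (auto simp: deriv[of \<eta> \<xi>] dunkl_op_commute[OF homogeneous_polyD(1)[OF q], of \<eta> \<xi>]
          intro: homogeneous_polyD(1)[OF q] homogeneous_polyD(1)[OF hom])
  qed
  then show "T \<xi> (homogeneous_intertwiner (Suc n) p) = homogeneous_intertwiner n (dir_deriv \<xi> p)"
    by (auto simp: w_def q_def fun_eq_iff)
qed

end

section \<open>Decomposition of polynomial functions into homogeneous parts\<close>

lemma polynomial_on_lines:
  fixes p :: "real ^ 'n \<Rightarrow> real"
  assumes "real_polynomial_function p"
  shows "\<exists>Q N. (\<forall>x t. poly (Q x) t = p (t *\<^sub>R x)) \<and>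
    (\<forall>n. homogeneous_poly n (\<lambda>x. coeff (Q x) n)) \<and> (\<forall>x. degree (Q x) \<le> N)"
  using assms
proof induction
  case (linear f)
  note f = real_polynomial_function.intros(1)[OF linear]
  interpret bounded_linear f by (rule linear)
  have "homogeneous_poly n (\<lambda>x. coeff [:0, f x:] n)" for n
  proof (cases "n = 1")
    case True
    then show ?thesis
      using f by (simp add: homogeneous_poly_def scaleR)
  next
    case False
    then have "coeff [:0, f x:] n = 0" for x
      by (cases n; cases "n - 1") auto
    then show ?thesis by (simp only: homogeneous_poly_zero)
  qed
  then show ?case
    by (intro exI[of _ "\<lambda>x. [:0, f x:]"] exI[of _ 1]) (auto simp: scaleR)
next
  case (const c)
  have "homogeneous_poly n (\<lambda>x. coeff [:c:] n)" for n
    by (cases n) (auto simp: homogeneous_poly_def)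
  then show ?case
    by (intro exI[of _ "\<lambda>x. [:c:]"] exI[of _ 0]) auto
next
  case (add f g)
  then obtain F M G N where
    "\<forall>x t. poly (F x) t = f (t *\<^sub>R x)" "\<forall>n. homogeneous_poly n (\<lambda>x. coeff (F x) n)" "\<forall>x. degree (F x) \<le> M"
    "\<forall>x t. poly (G x) t = g (t *\<^sub>R x)" "\<forall>n. homogeneous_poly n (\<lambda>x. coeff (G x) n)" "\<forall>x. degree (G x) \<le> N"
    by blast
  then show ?case
    by (intro exI[of _ "\<lambda>x. F x + G x"] exI[of _ "max M N"])
      (auto simp: homogeneous_poly_add intro!: degree_add_le_max[THEN order_trans] max.mono)
next
  case (mult f g)
  then obtain F M G N where FG:
    "\<forall>x t. poly (F x) t = f (t *\<^sub>R x)" "\<forall>n. homogeneous_poly n (\<lambda>x. coeff (F x) n)" "\<forall>x. degree (F x) \<le> M"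
    "\<forall>x t. poly (G x) t = g (t *\<^sub>R x)" "\<forall>n. homogeneous_poly n (\<lambda>x. coeff (G x) n)" "\<forall>x. degree (G x) \<le> N"
    by blast
  have "homogeneous_poly n (\<lambda>x. coeff (F x * G x) n)" for n
    unfolding coeff_mult
  proof (intro homogeneous_poly_sum)
    fix i assume "i \<in> {..n}"
    then show "homogeneous_poly n (\<lambda>x. coeff (F x) i * coeff (G x) (n - i))"
      using homogeneous_poly_mult[of i "\<lambda>x. coeff (F x) i" "n - i" "\<lambda>x. coeff (G x) (n - i)"] FG(2,5) by simp
  qed simp
  then show ?case
    using FG by (intro exI[of _ "\<lambda>x. F x * G x"] exI[of _ "M + N"])
      (auto intro!: degree_mult_le[THEN order_trans] add_mono)
qed

definition line_poly :: "(real ^ 'n \<Rightarrow> real) \<Rightarrow> real ^ 'n \<Rightarrow> real poly" where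
  "line_poly p x = (THE P. \<forall>t. poly P t = p (t *\<^sub>R x))"

text \<open>Polynomials are functions here, so their parts are read off on lines through the origin:
  p(tx) is a polynomial in t, of degree bounded uniformly in x, and its coefficient of t^n is
  homogeneous of degree n in x.\<close>

definition homogeneous_part :: "nat \<Rightarrow> (real ^ 'n \<Rightarrow> real) \<Rightarrow> real ^ 'n \<Rightarrow> real" where
  "homogeneous_part n p x = coeff (line_poly p x) n"

lemma line_poly_eqI:
  assumes "\<And>t. poly P t = p (t *\<^sub>R x)"
  shows "line_poly p x = P"
  unfolding line_poly_def
proof (rule the_equality)
  fix Q assume "\<forall>t. poly Q t = p (t *\<^sub>R x)"
  then have "poly Q = poly P" using assms by auto
  then show "Q = P" by (simp add: poly_eq_poly_eq_iff)
qed (use assms in simp)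

lemma poly_line_poly:
  assumes "real_polynomial_function p"
  shows "poly (line_poly p x) t = p (t *\<^sub>R x)"
  using polynomial_on_lines[OF assms] line_poly_eqI[of _ p x] by metis

lemma homogeneous_poly_homogeneous_part:
  assumes "real_polynomial_function p"
  shows "homogeneous_poly n (homogeneous_part n p)"
proof -
  obtain Q where Q: "\<And>x t. poly (Q x) t = p (t *\<^sub>R x)" "\<And>n. homogeneous_poly n (\<lambda>x. coeff (Q x) n)"
    using polynomial_on_lines[OF assms] by blast
  have "line_poly p x = Q x" for x
    using Q(1) by (rule line_poly_eqI)
  then have "homogeneous_part n p = (\<lambda>x. coeff (Q x) n)"
    by (simp add: homogeneous_part_def fun_eq_iff)
  then show ?thesis using Q(2) by simp
qed

lemma homogeneous_part_eventually_zero: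
  fixes p :: "real ^ 'n \<Rightarrow> real"
  assumes "real_polynomial_function p"
  obtains N where "\<And>n. N < n \<Longrightarrow> homogeneous_part n p = (\<lambda>x. 0)"
    "p = (\<lambda>x. \<Sum>n\<le>N. homogeneous_part n p x)"
proof -
  obtain Q N where Q: "\<And>x t. poly (Q x) t = p (t *\<^sub>R x)" "\<And>x. degree (Q x) \<le> N"
    using polynomial_on_lines[OF assms] by blast
  have line: "line_poly p x = Q x" for x
    using Q(1) by (rule line_poly_eqI)
  have "homogeneous_part n p = (\<lambda>x. 0)" if "N < n" for n
  proof
    show "homogeneous_part n p x = 0" for x
      unfolding homogeneous_part_def line using Q(2)[of x] that by (intro coeff_eq_0) linarith
  qed
  moreover have "p x = (\<Sum>n\<le>N. homogeneous_part n p x)" for x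
  proof -
    have "p x = (\<Sum>n\<le>degree (Q x). coeff (Q x) n)"
      using Q(1)[of x 1] by (simp add: poly_altdef)
    also have "\<dots> = (\<Sum>n\<le>N. coeff (Q x) n)"
      using Q(2)[of x] by (intro sum.mono_neutral_left) (auto intro: coeff_eq_0)
    finally show ?thesis by (simp add: homogeneous_part_def line)
  qed
  ultimately show ?thesis using that by blast
qed

lemma homogeneous_part_add:
  assumes "real_polynomial_function p" "real_polynomial_function q"
  shows "homogeneous_part n (\<lambda>x. p x + q x) = (\<lambda>x. homogeneous_part n p x + homogeneous_part n q x)"
proof
  fix x
  have "line_poly (\<lambda>x. p x + q x) x = line_poly p x + line_poly q x"
    by (rule line_poly_eqI) (simp add: poly_line_poly assms)
  then show "homogeneous_part n (\<lambda>x. p x + q x) x = homogeneous_part n p x + homogeneous_part n q x"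
    by (simp add: homogeneous_part_def)
qed

lemma homogeneous_part_cmult:
  assumes "real_polynomial_function p"
  shows "homogeneous_part n (\<lambda>x. c * p x) = (\<lambda>x. c * homogeneous_part n p x)"
proof
  fix x
  have "line_poly (\<lambda>x. c * p x) x = smult c (line_poly p x)"
    by (rule line_poly_eqI) (simp add: poly_line_poly assms)
  then show "homogeneous_part n (\<lambda>x. c * p x) x = c * homogeneous_part n p x"
    by (simp add: homogeneous_part_def)
qed

lemma homogeneous_part_homogeneous:
  assumes "homogeneous_poly n p"
  shows "homogeneous_part m p = (if m = n then p else (\<lambda>x. 0))"
proof
  fix x
  have "line_poly p x = monom (p x) n"
    by (rule line_poly_eqI) (simp add: poly_monom homogeneous_polyD(2)[OF assms])
  then show "homogeneous_part m p x = (if m = n then p else (\<lambda>x. 0)) x"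
    by (simp add: homogeneous_part_def)
qed

lemma homogeneous_part_sum:
  assumes "finite I" "\<And>i. i \<in> I \<Longrightarrow> real_polynomial_function (f i)"
  shows "homogeneous_part n (\<lambda>x. \<Sum>i\<in>I. f i x) = (\<lambda>x. \<Sum>i\<in>I. homogeneous_part n (f i) x)"
  using assms
proof (induction I rule: finite_induct)
  case empty
  show ?case using homogeneous_part_homogeneous[OF homogeneous_poly_zero, of n n] by simp
next
  case (insert i I)
  then show ?case
    using homogeneous_part_add[of "f i" "\<lambda>x. \<Sum>i\<in>I. f i x" n] by (simp add: real_polynomial_function_sum)
qed

text \<open>Differentiation lowers the degree of each part by one and kills the constant part, so
  exactly one part of p contributes to degree n.\<close>

lemma homogeneous_part_dir_deriv:
  assumes "real_polynomial_function p"
  shows "homogeneous_part n (dir_deriv \<xi> p) = dir_deriv \<xi> (homogeneous_part (Suc n) p)"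
proof -
  obtain N where N: "\<And>n. N < n \<Longrightarrow> homogeneous_part n p = (\<lambda>x. 0)"
    "p = (\<lambda>x. \<Sum>n\<le>N. homogeneous_part n p x)"
    using homogeneous_part_eventually_zero[OF assms] by blast
  note hom = homogeneous_poly_homogeneous_part[OF assms]
  note poly = homogeneous_polyD(1)[OF hom]
  have part: "homogeneous_part n (dir_deriv \<xi> (homogeneous_part m p))
      = (if m = Suc n then dir_deriv \<xi> (homogeneous_part (Suc n) p) else (\<lambda>x. 0))" for m
  proof (cases m)
    case 0
    then have "dir_deriv \<xi> (homogeneous_part m p) = (\<lambda>x. 0)"
      using hom[of 0] homogeneous_poly_0_dir_deriv by blast
    then show ?thesis
      using homogeneous_part_homogeneous[OF homogeneous_poly_zero, of n n] 0 by simp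
  next
    case (Suc k)
    then have "homogeneous_poly k (dir_deriv \<xi> (homogeneous_part m p))"
      using hom[of "Suc k"] homogeneous_poly_dir_deriv by blast
    then show ?thesis
      using Suc by (auto simp: homogeneous_part_homogeneous)
  qed
  have "dir_deriv \<xi> p = (\<lambda>x. \<Sum>m\<le>N. dir_deriv \<xi> (homogeneous_part m p) x)"
    by (subst N(2)) (intro dir_deriv_sum finite_atMost poly)
  then have "homogeneous_part n (dir_deriv \<xi> p)
      = (\<lambda>x. \<Sum>m\<le>N. homogeneous_part n (dir_deriv \<xi> (homogeneous_part m p)) x)"
    by (simp add: homogeneous_part_sum poly polynomial_dir_deriv)
  also have "\<dots> = (\<lambda>x. \<Sum>m\<le>N. if m = Suc n then dir_deriv \<xi> (homogeneous_part (Suc n) p) x else 0)"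
    by (intro ext sum.cong refl) (simp add: part)
  also have "\<dots> = dir_deriv \<xi> (homogeneous_part (Suc n) p)"
    using N(1)[of "Suc n"] by (cases "Suc n \<le> N") auto
  finally show ?thesis .
qed

section \<open>The intertwining operator on all polynomials\<close>

context dunkl
begin

text \<open>On a polynomial only finitely many summands are nonzero, so the series is a finite sum;
  writing it as a series avoids choosing a degree bound.\<close>

definition V where
  "V p x = (\<Sum>n. homogeneous_intertwiner n (homogeneous_part n p) x)"

lemma V_eq:
  assumes "\<And>n. N < n \<Longrightarrow> homogeneous_part n p = (\<lambda>x. 0)"
  shows "V p = (\<lambda>x. \<Sum>n\<le>N. homogeneous_intertwiner n (homogeneous_part n p) x)"
  unfolding V_def using assms by (intro ext suminf_finite) (auto simp: homogeneous_intertwiner_zero)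

lemma V_homogeneous:
  assumes "homogeneous_poly n p"
  shows "V p = homogeneous_intertwiner n p"
proof -
  have "V p = (\<lambda>x. \<Sum>m\<le>n. homogeneous_intertwiner m (homogeneous_part m p) x)"
    by (rule V_eq) (simp add: homogeneous_part_homogeneous[OF assms])
  also have "\<dots> = (\<lambda>x. \<Sum>m\<le>n. if m = n then homogeneous_intertwiner n p x else 0)"
    by (intro ext sum.cong) (auto simp: homogeneous_part_homogeneous[OF assms] homogeneous_intertwiner_zero)
  also have "\<dots> = homogeneous_intertwiner n p"
    by simp
  finally show ?thesis .
qed

lemma V_dunkl_op:
  assumes p: "real_polynomial_function p"
  shows "T \<xi> (V p) = V (dir_deriv \<xi> p)"
proof -
  obtain N where N: "\<And>n. N < n \<Longrightarrow> homogeneous_part n p = (\<lambda>x. 0)"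
    using homogeneous_part_eventually_zero[OF p] by blast
  note hom = homogeneous_poly_homogeneous_part[OF p]
  note hom' = homogeneous_poly_intertwiner[OF hom]
  \<comment> \<open>The bound \<open>Suc N\<close> adds only a zero term. Once the constant part is
    annihilated, the degrees \<open>Suc n\<close> with \<open>n \<le> N\<close> remain, matching the
    parts of the derivative.\<close>
  have "V p = (\<lambda>x. \<Sum>n\<le>Suc N. homogeneous_intertwiner n (homogeneous_part n p) x)"
    by (rule V_eq) (simp add: N)
  then have "T \<xi> (V p) = (\<lambda>x. \<Sum>n\<le>Suc N. T \<xi> (homogeneous_intertwiner n (homogeneous_part n p)) x)"
    by (simp only: dunkl_op_sum[OF finite_atMost homogeneous_polyD(1)[OF hom']])
  also have "\<dots> = (\<lambda>x. \<Sum>n\<le>N. T \<xi> (homogeneous_intertwiner (Suc n) (homogeneous_part (Suc n) p)) x)"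
  proof -
    have "homogeneous_part 0 p = (\<lambda>x. homogeneous_part 0 p 0)"
      using homogeneous_poly_0_const[OF hom] by blast
    then have "T \<xi> (homogeneous_part 0 p) = (\<lambda>x. 0)"
      by (metis dunkl_op_const)
    then show ?thesis
      by (simp only: sum.atMost_Suc_shift homogeneous_intertwiner.simps(1)) simp
  qed
  also have "\<dots> = (\<lambda>x. \<Sum>n\<le>N. homogeneous_intertwiner n (homogeneous_part n (dir_deriv \<xi> p)) x)"
    by (simp only: dunkl_op_homogeneous_intertwiner[OF hom] homogeneous_part_dir_deriv[OF p])
  also have "\<dots> = V (dir_deriv \<xi> p)"
    by (rule V_eq[symmetric]) (simp add: homogeneous_part_dir_deriv[OF p] N)
  finally show ?thesis .
qed

theorem is_intertwiner_V: "is_intertwiner \<Omega> \<kappa> V"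
  unfolding is_intertwiner_def
proof (intro conjI allI impI)
  fix p :: "real ^ 'n \<Rightarrow> real" assume p: "real_polynomial_function p"
  obtain N where N: "\<And>n. N < n \<Longrightarrow> homogeneous_part n p = (\<lambda>x. 0)"
    using homogeneous_part_eventually_zero[OF p] by blast
  note hom = homogeneous_poly_intertwiner[OF homogeneous_poly_homogeneous_part[OF p]]
  have Vp: "V p = (\<lambda>x. \<Sum>n\<le>N. homogeneous_intertwiner n (homogeneous_part n p) x)"
    by (rule V_eq) (rule N)
  show "real_polynomial_function (V p)"
    unfolding Vp by (intro real_polynomial_function_sum homogeneous_polyD(1)[OF hom]) simp
  show "V (\<lambda>x. c * p x) = (\<lambda>x. c * V p x)" for c
    unfolding Vp using N
    by (subst V_eq[of N]) (simp_all add: homogeneous_part_cmult[OF p] sum_distrib_left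
        homogeneous_intertwiner_cmult homogeneous_polyD(1)[OF homogeneous_poly_homogeneous_part[OF p]])
  show "T \<xi> (V p) = V (dir_deriv \<xi> p)" for \<xi>
    using p by (rule V_dunkl_op)
  fix q :: "real ^ 'n \<Rightarrow> real" assume q: "real_polynomial_function q"
  obtain M where M: "\<And>n. M < n \<Longrightarrow> homogeneous_part n q = (\<lambda>x. 0)"
    using homogeneous_part_eventually_zero[OF q] by blast
  show "V (\<lambda>x. p x + q x) = (\<lambda>x. V p x + V q x)"
    using N M
    by (subst (1 2 3) V_eq[of "max M N"]) (simp_all add: homogeneous_part_add[OF p q] sum.distrib
        homogeneous_intertwiner_add homogeneous_polyD(1)[OF homogeneous_poly_homogeneous_part[OF p]]
        homogeneous_polyD(1)[OF homogeneous_poly_homogeneous_part[OF q]])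
next
  fix n p assume p: "homogeneous_poly n (p :: real ^ 'n \<Rightarrow> real)"
  then show "homogeneous_poly n (V p)"
    by (simp add: V_homogeneous homogeneous_poly_intertwiner)
next
  have "homogeneous_poly 0 (\<lambda>x :: real ^ 'n. 1)"
    by (auto simp: homogeneous_poly_def)
  then show "V (\<lambda>x. 1) = (\<lambda>x. 1)"
    by (simp add: V_homogeneous)
qed

text \<open>\<open>V\<close> witnesses that the choice is not vacuous; from here on only the
  defining properties of the chosen operator are used.\<close>

lemma is_intertwiner_intertwiner: "is_intertwiner \<Omega> \<kappa> (intertwiner \<Omega> \<kappa>)"
  unfolding intertwiner_def by (rule someI[of "is_intertwiner \<Omega> \<kappa>", OF is_intertwiner_V])

end

section \<open>Bounds for the intertwining operator, Gegenbauer polynomials and Bessel functions\<close>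

lemma obtain_unit_scaleR:
  fixes v :: "'a::euclidean_space"
  obtains t u where "norm u = 1" "v = t *\<^sub>R u"
proof (cases "v = 0")
  case True
  obtain u :: 'a where "norm u = 1" using vector_choose_size[of 1] by auto
  then show ?thesis using that[of u 0] True by simp
next
  case False
  then show ?thesis using that[of "sgn v" "norm v"] by (simp add: norm_sgn sgn_div_norm)
qed

lemma polynomial_inner_power:
  fixes \<xi> :: "real ^ 'n"
  shows "real_polynomial_function (\<lambda>u. (\<xi> \<bullet> u) ^ m)"
  by (rule homogeneous_polyD(1)[OF homogeneous_poly_inner_power])

lemma dir_deriv_inner_power:
  "dir_deriv \<eta> (\<lambda>u. (\<xi> \<bullet> u) ^ Suc m) = (\<lambda>u. real (Suc m) * (\<xi> \<bullet> \<eta>) * (\<xi> \<bullet> u) ^ m)"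
proof (intro ext dir_deriv_eqI)
  fix u
  have "((\<lambda>u. \<xi> \<bullet> u) has_derivative (\<lambda>h. \<xi> \<bullet> h)) (at u)"
    by (auto intro!: derivative_eq_intros)
  from has_derivative_power[OF this, of "Suc m"]
  show "((\<lambda>u. (\<xi> \<bullet> u) ^ Suc m) has_derivative (\<lambda>\<eta>. real (Suc m) * (\<xi> \<bullet> \<eta>) * (\<xi> \<bullet> u) ^ m)) (at u)"
    by (simp del: power_Suc)
qed

section \<open>The intertwiner on powers of linear forms\<close>

context dunkl
begin

abbreviation "U \<equiv> intertwiner \<Omega> \<kappa>"

lemma
  shows U_add: "real_polynomial_function p \<Longrightarrow> real_polynomial_function q \<Longrightarrow>
      U (\<lambda>x. p x + q x) = (\<lambda>x. U p x + U q x)"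
    and U_cmult: "real_polynomial_function p \<Longrightarrow> U (\<lambda>x. c * p x) = (\<lambda>x. c * U p x)"
    and U_homogeneous: "homogeneous_poly n p \<Longrightarrow> homogeneous_poly n (U p)"
    and U_one: "U (\<lambda>x. 1) = (\<lambda>x. 1)"
    and U_dunkl_op: "real_polynomial_function p \<Longrightarrow> T \<xi> (U p) = U (dir_deriv \<xi> p)"
  by (simp_all add: is_intertwiner_intertwiner[unfolded is_intertwiner_def])

lemma U_sum:
  assumes "finite I" "\<And>i. i \<in> I \<Longrightarrow> real_polynomial_function (f i)"
  shows "U (\<lambda>x. \<Sum>i\<in>I. f i x) = (\<lambda>x. \<Sum>i\<in>I. U (f i) x)"
  using assms
proof (induction I rule: finite_induct)
  case empty
  show ?case using U_cmult[of "\<lambda>x. 1" 0] by (simp add: real_polynomial_function.intros(2))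
next
  case (insert i I)
  then show ?case
    using U_add[of "f i" "\<lambda>x. \<Sum>i\<in>I. f i x"] by (simp add: real_polynomial_function_sum)
qed

text \<open>The intertwining relation in the radial direction, rewritten by
  \<open>dunkl_op_euler\<close>, lowers the exponent by one, hence the induction. The bound is
  uniform in m, as summation over all degrees requires.\<close>

lemma abs_U_power_le:
  assumes \<xi>: "norm \<xi> = 1" and "norm x = 1"
  shows "\<bar>U (\<lambda>u. (\<xi> \<bullet> u) ^ m) x\<bar> \<le> 1"
  using assms(2)
proof (induction m arbitrary: x)
  case 0
  then show ?case by (simp add: U_one)
next
  case (Suc m)
  define p where "p = U (\<lambda>u. (\<xi> \<bullet> u) ^ Suc m)"
  have p: "homogeneous_poly (Suc m) p"
    unfolding p_def by (intro U_homogeneous homogeneous_poly_inner_power)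
  have "continuous_on (sphere 0 1) (\<lambda>x. \<bar>p x\<bar>)"
    using polynomial_isCont[OF homogeneous_polyD(1)[OF p]] continuous_at_imp_continuous_on
    by (intro continuous_intros) blast
  then obtain x0 where x0: "norm x0 = 1" "\<And>x. norm x = 1 \<Longrightarrow> \<bar>p x\<bar> \<le> \<bar>p x0\<bar>"
    using continuous_attains_sup[of "sphere (0 :: real ^ 'n) 1" "\<lambda>x. \<bar>p x\<bar>"] by (auto simp: sphere_eq_empty)
  have "T x0 p x0 = real (Suc m) * (\<xi> \<bullet> x0) * U (\<lambda>u. (\<xi> \<bullet> u) ^ m) x0"
    unfolding p_def
    by (simp only: U_dunkl_op polynomial_inner_power dir_deriv_inner_power U_cmult)
  then have "(real (Suc m) + \<gamma>) * p x0
      = real (Suc m) * ((\<xi> \<bullet> x0) * U (\<lambda>u. (\<xi> \<bullet> u) ^ m) x0) + (\<Sum>\<alpha>\<in>\<Omega>. \<kappa> \<alpha> * p (reflection \<alpha> x0)) / 2"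
    using dunkl_op_euler[OF p, of x0] by (simp add: mult.assoc)
  then have "(real (Suc m) + \<gamma>) * \<bar>p x0\<bar>
      = \<bar>real (Suc m) * ((\<xi> \<bullet> x0) * U (\<lambda>u. (\<xi> \<bullet> u) ^ m) x0) + (\<Sum>\<alpha>\<in>\<Omega>. \<kappa> \<alpha> * p (reflection \<alpha> x0)) / 2\<bar>"
    using \<gamma>_nonneg by (metis abs_mult abs_of_nonneg add_nonneg_nonneg of_nat_0_le_iff)
  also have "\<dots> \<le> real (Suc m) * 1 + \<gamma> * \<bar>p x0\<bar>"
  proof (rule order_trans[OF abs_triangle_ineq], rule add_mono)
    have "\<bar>\<xi> \<bullet> x0\<bar> \<le> 1"
      using Cauchy_Schwarz_ineq2[of \<xi> x0] \<xi> x0(1) by simp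
    then have "\<bar>\<xi> \<bullet> x0\<bar> * \<bar>U (\<lambda>u. (\<xi> \<bullet> u) ^ m) x0\<bar> \<le> 1 * 1"
      using Suc.IH[OF x0(1)] by (intro mult_mono) auto
    then show "\<bar>real (Suc m) * ((\<xi> \<bullet> x0) * U (\<lambda>u. (\<xi> \<bullet> u) ^ m) x0)\<bar> \<le> real (Suc m) * 1"
      unfolding abs_mult by (intro mult_mono) auto
    have "\<bar>\<Sum>\<alpha>\<in>\<Omega>. \<kappa> \<alpha> * p (reflection \<alpha> x0)\<bar> \<le> (\<Sum>\<alpha>\<in>\<Omega>. \<kappa> \<alpha> * \<bar>p x0\<bar>)"
      by (rule order_trans[OF sum_abs], rule sum_mono)
        (auto simp: abs_mult \<kappa>_nonneg x0 intro!: mult_left_mono)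
    then show "\<bar>(\<Sum>\<alpha>\<in>\<Omega>. \<kappa> \<alpha> * p (reflection \<alpha> x0)) / 2\<bar> \<le> \<gamma> * \<bar>p x0\<bar>"
      by (simp add: mult_sum_def sum_distrib_right)
  qed
  \<comment> \<open>Reflections preserve the sphere, so the reflected values are at most the
    maximum; their total weight \<gamma> is absorbed by the left-hand side.\<close>
  finally have "real (Suc m) * \<bar>p x0\<bar> \<le> real (Suc m) * 1"
    by (simp only: distrib_right add_le_cancel_right)
  then have "\<bar>p x0\<bar> \<le> 1"
    by (simp only: mult_le_cancel_left_pos of_nat_0_less_iff zero_less_Suc)
  then show ?case using x0(2)[OF Suc.prems] unfolding p_def by linarith
qed

text \<open>Applying \<open>T \<xi>\<close> to the image of \<open>\<xi> \<bullet> u\<close> gives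
  the constant 1, so that image is not zero; homogeneity of degree 1 carries a nonzero value to the
  sphere and changes its sign at the antipode.\<close>

lemma U_linear_sign:
  assumes "norm \<xi> = 1" "s \<noteq> 0"
  shows "\<exists>y. norm y = 1 \<and> s * U (\<lambda>u. \<xi> \<bullet> u) y > 0"
proof -
  let ?p = "U (\<lambda>u. \<xi> \<bullet> u)"
  have "homogeneous_poly 1 (\<lambda>u. \<xi> \<bullet> u)"
    using homogeneous_poly_inner_power[of 1 \<xi>] by simp
  then have p: "homogeneous_poly 1 ?p"
    by (rule U_homogeneous)
  have "T \<xi> ?p = (\<lambda>x. 1)"
    using assms(1) by (simp add: U_dunkl_op polynomial_inner_left dir_deriv_linear[OF bounded_linear_inner_right]
        norm_eq_1 U_one)
  moreover have "T \<xi> ?p = (\<lambda>x. 0)" if "\<And>x. ?p x = 0"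
  proof -
    have "?p = (\<lambda>x. 0)" using that by blast
    then show ?thesis by (metis dunkl_op_const)
  qed
  ultimately obtain x where "?p x \<noteq> 0"
    by (metis zero_neq_one)
  moreover obtain t u where u: "norm u = 1" "x = t *\<^sub>R u"
    using obtain_unit_scaleR by blast
  ultimately have "s * ?p u \<noteq> 0"
    using homogeneous_polyD(2)[OF p, of t u] assms(2) by auto
  moreover have "s * ?p (- u) = - (s * ?p u)"
    using homogeneous_polyD(2)[OF p, of "-1" u] by simp
  ultimately have "s * ?p u > 0 \<or> s * ?p (- u) > 0"
    by linarith
  then show ?thesis
    using u(1) norm_minus_cancel[of u] by metis
qed

end

section \<open>Explicit Gegenbauer sums and their growth\<close>

lemma fps_X_plus_const_power_nth:
  "fps_nth ((fps_X + fps_const c) ^ k) n = real (k choose n) * c ^ (k - n)"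
proof (induction k arbitrary: n)
  case 0
  show ?case by (cases n) auto
next
  case (Suc k)
  note IH = Suc.IH
  have step: "fps_nth ((fps_X + fps_const c) ^ Suc k) n
      = (if n = 0 then 0 else fps_nth ((fps_X + fps_const c) ^ k) (n - 1)) + c * fps_nth ((fps_X + fps_const c) ^ k) n"
    by (simp add: distrib_right)
  show ?case
  proof (cases n)
    case 0
    then show ?thesis unfolding step unfolding Suc.IH by simp
  next
    case (Suc m)
    show ?thesis
    proof (cases "m < k")
      case True
      then have "k - m = Suc (k - Suc m)" by simp
      then show ?thesis unfolding step unfolding IH Suc by (simp add: algebra_simps)
    next
      case False
      then show ?thesis unfolding step unfolding IH Suc by simp
    qed
  qed
qed

text \<open>Writing z^2 - 2 \<tau> z = z (z - 2 \<tau>), the k-th power contributes the coefficient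
  of z^(j - k) in (z - 2 \<tau>)^k. The truncated exponent \<open>2 * k - j\<close> is harmless: for
  2k < j the binomial coefficient is 0.\<close>

lemma gegenbauer_eq_sum:
  "gegenbauer j \<eta> \<tau> = (\<Sum>k\<le>j. (- \<eta> gchoose k) * (real (k choose (j - k)) * (- (2 * \<tau>)) ^ (2 * k - j)))"
proof -
  have "fps_X ^ 2 - fps_const (2 * \<tau>) * fps_X = fps_X * (fps_X + fps_const (- (2 * \<tau>)))"
    by (simp add: power2_eq_square algebra_simps flip: fps_const_neg)
  then have pow: "(fps_X ^ 2 - fps_const (2 * \<tau>) * fps_X) ^ k
      = fps_X ^ k * (fps_X + fps_const (- (2 * \<tau>))) ^ k" for k
    by (simp only: power_mult_distrib)
  show ?thesis
    unfolding gegenbauer_def fps_compose_nth atLeast0AtMost pow fps_X_power_mult_nth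
      fps_X_plus_const_power_nth fps_binomial_nth
  proof (intro sum.cong refl)
    fix k assume "k \<in> {..j}"
    then have "k - (j - k) = 2 * k - j" "\<not> j < k" by auto
    then show "(- \<eta> gchoose k) * (if j < k then 0 else real (k choose (j - k)) * (- (2 * \<tau>)) ^ (k - (j - k)))
        = (- \<eta> gchoose k) * (real (k choose (j - k)) * (- (2 * \<tau>)) ^ (2 * k - j))"
      by (simp only: if_False)
  qed
qed

text \<open>The factor 1/\<eta> has been cancelled against the first factor of the rising factorial
  of \<eta>, so for k \<ge> 1 the formula remains meaningful at \<eta> = 0.\<close>

definition gegenbauer_coeff :: "nat \<Rightarrow> real \<Rightarrow> nat \<Rightarrow> real" where
  "gegenbauer_coeff j \<eta> k = (- 1) ^ k * ((\<eta> + real j) * pochhammer (\<eta> + 1) (k - 1) / fact k) *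
     (real (k choose (j - k)) * (- 2) ^ (2 * k - j))"

lemma gegenbauer_weighted_0 [simp]: "gegenbauer_weighted 0 \<eta> \<tau> = 1"
proof (cases "\<eta> = 0")
  case True
  have "((\<lambda>e::real. e / e) \<longlongrightarrow> 1) (at 0)"
    by (rule Lim_transform_eventually[OF tendsto_const]) (simp add: eventually_at_filter)
  then show ?thesis
    using True by (simp add: gegenbauer_weighted_def gegenbauer_eq_sum tendsto_Lim)
qed (simp add: gegenbauer_weighted_def gegenbauer_eq_sum)

text \<open>With the pole cancelled the closed form is continuous in the parameter, so at parameter
  0 the limit in the definition is simply its value.\<close>

lemma gegenbauer_weighted_eq_sum:
  assumes "j > 0"
  shows "gegenbauer_weighted j \<eta> \<tau> = (\<Sum>k\<in>{1..j}. gegenbauer_coeff j \<eta> k * \<tau> ^ (2 * k - j))"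
proof -
  have eq: "(e + real j) / e * gegenbauer j e \<tau> = (\<Sum>k\<in>{1..j}. gegenbauer_coeff j e k * \<tau> ^ (2 * k - j))"
    if "e \<noteq> 0" for e
  proof -
    have "(e + real j) / e * gegenbauer j e \<tau> = (\<Sum>k\<le>j. (e + real j) / e *
        ((- e gchoose k) * (real (k choose (j - k)) * (- (2 * \<tau>)) ^ (2 * k - j))))"
      by (simp add: gegenbauer_eq_sum sum_distrib_left)
    \<comment> \<open>The term k = 0 disappears because \<open>0 choose j\<close> is 0 for j >
      0.\<close>
    also have "\<dots> = (\<Sum>k\<in>{1..j}. (e + real j) / e *
        ((- e gchoose k) * (real (k choose (j - k)) * (- (2 * \<tau>)) ^ (2 * k - j))))"
      using assms by (intro sum.mono_neutral_right) (auto simp: not_less_eq_eq)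
    also have "\<dots> = (\<Sum>k\<in>{1..j}. gegenbauer_coeff j e k * \<tau> ^ (2 * k - j))"
    proof (intro sum.cong refl)
      fix k assume "k \<in> {1..j}"
      then obtain m where k: "k = Suc m" by (cases k) auto
      have "(- (2 * \<tau>)) ^ i = (- 2) ^ i * \<tau> ^ i" for i
        by (simp flip: power_mult_distrib)
      moreover have "(e + real j) / e * (- e gchoose k)
          = (- 1) ^ k * ((e + real j) * pochhammer (e + 1) (k - 1) / fact k)"
        using that unfolding k gbinomial_pochhammer by (simp add: pochhammer_rec)
      ultimately show "(e + real j) / e * ((- e gchoose k) * (real (k choose (j - k)) * (- (2 * \<tau>)) ^ (2 * k - j)))
          = gegenbauer_coeff j e k * \<tau> ^ (2 * k - j)"
        unfolding gegenbauer_coeff_def by (metis (no_types, lifting) mult.assoc)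
    qed
    finally show ?thesis .
  qed
  show ?thesis
  proof (cases "\<eta> = 0")
    case True
    let ?f = "\<lambda>e. \<Sum>k\<in>{1..j}. gegenbauer_coeff j e k * \<tau> ^ (2 * k - j)"
    have "isCont ?f 0"
      unfolding gegenbauer_coeff_def
      by (intro continuous_intros isCont_o2[OF _ isCont_pochhammer]) auto
    then have "(?f \<longlongrightarrow> ?f 0) (at 0)"
      by (simp add: isCont_def)
    then have "((\<lambda>e. (e + real j) / e * gegenbauer j e \<tau>) \<longlongrightarrow> ?f 0) (at 0)"
    proof (rule Lim_transform_eventually)
      show "\<forall>\<^sub>F e in at 0. ?f e = (e + real j) / e * gegenbauer j e \<tau>"
        unfolding eventually_at_filter by (intro always_eventually allI impI) (rule eq[symmetric])
    qed
    then show ?thesis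
      using True by (simp add: gegenbauer_weighted_def tendsto_Lim)
  next
    case False
    then show ?thesis
      using eq[OF False] by (simp only: gegenbauer_weighted_def if_False)
  qed
qed

lemma pochhammer_le_power_fact:
  assumes "0 \<le> (\<eta>::real)"
  shows "0 \<le> pochhammer (\<eta> + 1) m \<and> pochhammer (\<eta> + 1) m \<le> (\<eta> + 1) ^ m * fact m"
proof (induction m)
  case (Suc m)
  have "\<eta> + 1 + real m \<le> (\<eta> + 1) * (1 + real m)"
    using assms by (simp add: algebra_simps)
  then have "pochhammer (\<eta> + 1) m * (\<eta> + 1 + real m) \<le> ((\<eta> + 1) ^ m * fact m) * ((\<eta> + 1) * (1 + real m))"
    using Suc assms by (intro mult_mono) auto
  then show ?case
    using Suc assms by (simp add: pochhammer_Suc algebra_simps)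
qed simp

text \<open>Exponential growth in j is good enough, since the kernel is summed for small z. The
  rising factorial over k! gives (\<eta> + 1)^j; the binomial coefficient and the power of -2 give
  2^j each.\<close>

lemma abs_gegenbauer_coeff_le:
  assumes "0 \<le> \<eta>" "k \<in> {1..j}"
  shows "\<bar>gegenbauer_coeff j \<eta> k\<bar> \<le> (\<eta> + real j) * (4 * (\<eta> + 1)) ^ j"
proof -
  have p: "0 \<le> pochhammer (\<eta> + 1) (k - 1)" "pochhammer (\<eta> + 1) (k - 1) \<le> (\<eta> + 1) ^ (k - 1) * fact (k - 1)"
    using pochhammer_le_power_fact[OF assms(1)] by auto
  have "pochhammer (\<eta> + 1) (k - 1) / fact k \<le> (\<eta> + 1) ^ j"
  proof -
    have "(\<eta> + 1) ^ (k - 1) * fact (k - 1) \<le> (\<eta> + 1) ^ j * fact k"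
      using assms by (intro mult_mono power_increasing fact_mono) auto
    with p(2) show ?thesis by (simp add: divide_simps)
  qed
  then have 1: "\<bar>(- 1) ^ k * ((\<eta> + real j) * pochhammer (\<eta> + 1) (k - 1) / fact k)\<bar> \<le> (\<eta> + real j) * (\<eta> + 1) ^ j"
    using p(1) assms by (simp add: abs_mult mult_left_mono flip: times_divide_eq_right)
  have "real (k choose (j - k)) \<le> 2 ^ j"
  proof -
    have "k choose (j - k) \<le> 2 ^ k" by (rule binomial_le_pow2)
    also have "\<dots> \<le> 2 ^ j" using assms by (intro power_increasing) auto
    finally show ?thesis by (metis of_nat_le_iff of_nat_numeral of_nat_power)
  qed
  moreover have "(2::real) ^ (2 * k - j) \<le> 2 ^ j"
    using assms by (intro power_increasing) auto
  ultimately have 2: "\<bar>real (k choose (j - k)) * (- 2) ^ (2 * k - j)\<bar> \<le> 2 ^ j * 2 ^ j"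
    by (simp add: abs_mult power_abs mult_mono)
  have "\<bar>gegenbauer_coeff j \<eta> k\<bar> \<le> ((\<eta> + real j) * (\<eta> + 1) ^ j) * (2 ^ j * 2 ^ j)"
    unfolding gegenbauer_coeff_def abs_mult[of _ "real _ * _"] using 1 2 assms by (intro mult_mono) auto
  also have "\<dots> = (\<eta> + real j) * (4 * (\<eta> + 1)) ^ j"
  proof -
    have "(2::real) ^ j * 2 ^ j = 4 ^ j" by (simp flip: power_mult_distrib)
    then show ?thesis by (simp only: power_mult_distrib mult_ac)
  qed
  finally show ?thesis .
qed

context dunkl
begin

lemma U_gegenbauer_weighted:
  assumes "j > 0"
  shows "U (\<lambda>u. gegenbauer_weighted j \<eta> (\<xi> \<bullet> u)) y
    = (\<Sum>k\<in>{1..j}. gegenbauer_coeff j \<eta> k * U (\<lambda>u. (\<xi> \<bullet> u) ^ (2 * k - j)) y)"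
proof -
  have "real_polynomial_function (\<lambda>u. gegenbauer_coeff j \<eta> k * (\<xi> \<bullet> u) ^ (2 * k - j))" for k
    by (intro real_polynomial_function.intros(2,4) polynomial_inner_power)
  then show ?thesis
    unfolding gegenbauer_weighted_eq_sum[OF assms]
    by (subst U_sum) (simp_all add: U_cmult polynomial_inner_power)
qed

lemma U_gegenbauer_weighted_1:
  "U (\<lambda>u. gegenbauer_weighted 1 \<eta> (\<xi> \<bullet> u)) y = 2 * (\<eta> + 1) * U (\<lambda>u. \<xi> \<bullet> u) y"
  by (subst U_gegenbauer_weighted) (simp_all add: gegenbauer_coeff_def)

text \<open>Summing the coefficient bounds costs j terms and a factor \<eta> + j, together at most
  (\<eta> + 1) j^2; the estimate j^2 \<le> 4^j turns the base 4 into 16.\<close>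

lemma abs_U_gegenbauer_weighted_le:
  assumes "0 \<le> \<eta>" "norm \<xi> = 1" "norm y = 1"
  shows "\<bar>U (\<lambda>u. gegenbauer_weighted j \<eta> (\<xi> \<bullet> u)) y\<bar> \<le> (\<eta> + 1) * (16 * (\<eta> + 1)) ^ j"
proof (cases "j = 0")
  case True
  then show ?thesis using assms by (simp add: U_one)
next
  case False
  have "\<bar>U (\<lambda>u. gegenbauer_weighted j \<eta> (\<xi> \<bullet> u)) y\<bar>
      \<le> (\<Sum>k\<in>{1..j}. \<bar>gegenbauer_coeff j \<eta> k * U (\<lambda>u. (\<xi> \<bullet> u) ^ (2 * k - j)) y\<bar>)"
    using False by (subst U_gegenbauer_weighted) auto
  also have "\<dots> \<le> (\<Sum>k\<in>{1..j}. (\<eta> + real j) * (4 * (\<eta> + 1)) ^ j)"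
  proof (rule sum_mono)
    fix k assume "k \<in> {1..j}"
    then have "\<bar>gegenbauer_coeff j \<eta> k\<bar> * \<bar>U (\<lambda>u. (\<xi> \<bullet> u) ^ (2 * k - j)) y\<bar>
        \<le> (\<eta> + real j) * (4 * (\<eta> + 1)) ^ j * 1"
      using assms by (intro mult_mono abs_gegenbauer_coeff_le abs_U_power_le) auto
    then show "\<bar>gegenbauer_coeff j \<eta> k * U (\<lambda>u. (\<xi> \<bullet> u) ^ (2 * k - j)) y\<bar> \<le> (\<eta> + real j) * (4 * (\<eta> + 1)) ^ j"
      by (simp add: abs_mult)
  qed
  also have "\<dots> = (real j * (\<eta> + real j)) * (4 * (\<eta> + 1)) ^ j"
    by simp
  also have "\<dots> \<le> ((\<eta> + 1) * 4 ^ j) * (4 * (\<eta> + 1)) ^ j"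
  proof (rule mult_right_mono)
    have "real j \<le> 2 ^ j" using of_nat_less_two_power[of j, where ?'a = real] by linarith
    then have "real j * real j \<le> 2 ^ j * 2 ^ j" by (intro mult_mono) auto
    also have "\<dots> = 4 ^ j" by (simp flip: power_mult_distrib)
    finally have jj: "real j * real j \<le> 4 ^ j" .
    have "\<eta> * 1 \<le> \<eta> * real j"
      using assms False by (intro mult_left_mono) auto
    then have "real j * (\<eta> + real j) \<le> real j * ((\<eta> + 1) * real j)"
      by (intro mult_left_mono) (auto simp: algebra_simps)
    also have "\<dots> = (\<eta> + 1) * (real j * real j)" by simp
    also have "\<dots> \<le> (\<eta> + 1) * 4 ^ j"
      using assms jj by (intro mult_left_mono) auto
    finally show "real j * (\<eta> + real j) \<le> (\<eta> + 1) * 4 ^ j" .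
  qed (use assms in auto)
  also have "\<dots> = (\<eta> + 1) * (16 * (\<eta> + 1)) ^ j"
  proof -
    have "(4::real) ^ j * (4 * (\<eta> + 1)) ^ j = (16 * (\<eta> + 1)) ^ j" by (simp flip: power_mult_distrib)
    then show ?thesis by (simp add: mult.assoc)
  qed
  finally show ?thesis .
qed

end

section \<open>Normalized Bessel functions\<close>

lemma bessel_j_term:
  assumes "-1 < \<nu>"
  shows "Gamma (\<nu> + 1) * ((- 1) ^ k * (x / 2) ^ (2 * k) / (fact k * Gamma (real k + \<nu> + 1)))
    = (- 1) ^ k * ((x\<^sup>2 / 4) ^ k / (fact k * pochhammer (\<nu> + 1) k))"
proof -
  have "pochhammer (\<nu> + 1) k = Gamma (\<nu> + 1 + real k) / Gamma (\<nu> + 1)"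
    using assms by (intro pochhammer_Gamma) (auto elim!: nonpos_Ints_cases)
  moreover have "(x / 2) ^ (2 * k) = (x\<^sup>2 / 4) ^ k"
    by (simp add: power_mult power_divide)
  moreover have "Gamma (\<nu> + 1) > 0" using assms by simp
  ultimately show ?thesis by (simp add: add.commute add.left_commute)
qed

text \<open>The ratio of successive terms is at most (x^2/4) / (\<nu> + 1) < 1 in absolute value, so
  the alternating series lies between its first two partial sums.\<close>

lemma
  assumes \<nu>: "-1 < \<nu>" and x: "x\<^sup>2 / 4 < \<nu> + 1"
  shows bessel_j_ge: "1 - x\<^sup>2 / 4 / (\<nu> + 1) \<le> bessel_j \<nu> x"
    and bessel_j_le_1: "bessel_j \<nu> x \<le> 1"
proof -
  define q where "q = x\<^sup>2 / 4"
  define t where "t k = q ^ k / (fact k * pochhammer (\<nu> + 1) k)" for k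
  have q: "0 \<le> q" "q < \<nu> + 1" using x by (auto simp: q_def)
  have P: "0 < pochhammer (\<nu> + 1) k" for k
    using \<nu> by (intro pochhammer_pos) simp
  have t0: "0 \<le> t k" for k
    using q P[of k] by (simp add: t_def less_imp_le)
  have ratio: "t (Suc k) \<le> (q / (\<nu> + 1)) * t k" for k
  proof -
    have "t (Suc k) = t k * (q / ((1 + real k) * (\<nu> + 1 + real k)))"
      by (simp add: t_def pochhammer_Suc mult_ac)
    also have "\<dots> \<le> t k * (q / (\<nu> + 1))"
    proof (intro mult_left_mono divide_left_mono t0 q)
      have "1 * (\<nu> + 1) \<le> (1 + real k) * (\<nu> + 1 + real k)"
        using \<nu> by (intro mult_mono) auto
      then show "\<nu> + 1 \<le> (1 + real k) * (\<nu> + 1 + real k)" by simp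
      then show "0 < ((1 + real k) * (\<nu> + 1 + real k)) * (\<nu> + 1)"
        using \<nu> by (intro mult_pos_pos) auto
    qed
    finally show ?thesis by (simp add: mult.commute)
  qed
  have r: "0 \<le> q / (\<nu> + 1)" "q / (\<nu> + 1) < 1"
    using q \<nu> by auto
  have le: "t k \<le> (q / (\<nu> + 1)) ^ k" for k
  proof (induction k)
    case (Suc k)
    have "t (Suc k) \<le> (q / (\<nu> + 1)) * t k" by (rule ratio)
    also have "\<dots> \<le> (q / (\<nu> + 1)) * (q / (\<nu> + 1)) ^ k"
      using Suc r by (intro mult_left_mono) auto
    finally show ?case by simp
  qed (simp add: t_def)
  have "t \<longlonglongrightarrow> 0"
    using t0 le r by (intro tendsto_sandwich[OF _ _ tendsto_const LIMSEQ_realpow_zero[of "q / (\<nu> + 1)"]]) auto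
  moreover have "t (Suc k) \<le> t k" for k
    using ratio[of k] mult_right_mono[of "q / (\<nu> + 1)" 1 "t k"] r t0[of k] by linarith
  ultimately have leibniz: "summable (\<lambda>k. (- 1) ^ k * t k)"
      "\<And>n. (\<Sum>i<2 * n. (- 1) ^ i * t i) \<le> (\<Sum>i. (- 1) ^ i * t i)"
      "\<And>n. (\<Sum>i. (- 1) ^ i * t i) \<le> (\<Sum>i<2 * n + 1. (- 1) ^ i * t i)"
    using t0 summable_Leibniz'[of t] by blast+
  let ?g = "\<lambda>k. (- 1) ^ k * (x / 2) ^ (2 * k) / (fact k * Gamma (real k + \<nu> + 1))"
  have G: "Gamma (\<nu> + 1) \<noteq> 0" 
    by (rule less_imp_neq[THEN not_sym], rule Gamma_real_pos) (use \<nu> in simp)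
  have term_eq: "Gamma (\<nu> + 1) * ?g k = (- 1) ^ k * t k" for k
    unfolding bessel_j_term[OF \<nu>] by (simp add: t_def q_def)
  \<comment> \<open>The definition keeps the Gamma factor outside the series. Moving it inside needs
    summability of the raw series, which is recovered by dividing by this nonzero factor.\<close>
  have "summable (\<lambda>k. Gamma (\<nu> + 1) * ?g k)"
    using leibniz(1) by (simp only: term_eq)
  then have "summable ?g"
    using G by (simp only: summable_cmult_iff simp_thms)
  then have "bessel_j \<nu> x = (\<Sum>k. Gamma (\<nu> + 1) * ?g k)"
    unfolding bessel_j_def by (rule suminf_mult[symmetric])
  then have eq: "bessel_j \<nu> x = (\<Sum>k. (- 1) ^ k * t k)"
    by (simp only: term_eq)
  have "t 0 = 1" "t 1 = q / (\<nu> + 1)" by (simp_all add: t_def)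
  then show "1 - x\<^sup>2 / 4 / (\<nu> + 1) \<le> bessel_j \<nu> x" "bessel_j \<nu> x \<le> 1"
    using leibniz(2)[of 1] leibniz(3)[of 0] by (simp_all add: eq q_def numeral_2_eq_2)
qed

text \<open>The factorization (2k)! = 4^k k! (1/2)_k identifies the series with that of the
  cosine.\<close>

lemma bessel_j_minus_half: "bessel_j (- 1 / 2) x = cos x"
proof -
  let ?g = "\<lambda>k. (- 1) ^ k * (x / 2) ^ (2 * k) / (fact k * Gamma (real k + (- 1 / 2) + 1))"
  have G: "Gamma (- 1 / 2 + 1 :: real) \<noteq> 0" by (rule less_imp_neq[THEN not_sym], rule Gamma_real_pos) simp
  have "Gamma (- 1 / 2 + 1) * ?g k = (- 1) ^ k / fact (2 * k) * x ^ (2 * k)" for k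
  proof -
    have "(fact (2 * k) :: real) = 4 ^ k * (fact k * pochhammer (1 / 2) k)"
      using fact_double[of k, where ?'a = real] by (simp add: power_mult)
    then show ?thesis
      by (subst bessel_j_term) (simp_all add: power_divide power_mult)
  qed
  then have sums: "(\<lambda>k. Gamma (- 1 / 2 + 1) * ?g k) sums cos x"
    using cos_paired[of x] by simp
  then have "summable ?g"
    using G sums_summable summable_cmult_iff by blast
  then have "bessel_j (- 1 / 2) x = (\<Sum>k. Gamma (- 1 / 2 + 1) * ?g k)"
    unfolding bessel_j_def by (rule suminf_mult[symmetric])
  then show ?thesis
    using sums_unique[OF sums] by simp
qed

text \<open>Gamma increases from 3/2 on; between 1 and 3/2 use Gamma(s) = Gamma(s + 1) / s. The
  result bounds all Gamma denominators of the kernel series at once.\<close>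

lemma Gamma_real_lower_bound:
  assumes "1 \<le> (s::real)"
  shows "Gamma (3 / 2) / (3 / 2) \<le> Gamma s"
proof -
  have mono: "Gamma (3 / 2) \<le> Gamma t" if "3 / 2 \<le> t" for t :: real
  proof (cases "t = 3 / 2")
    case False
    then show ?thesis using that Gamma_real_strict_mono[of "3 / 2" t] by linarith
  qed (simp only: order_refl)
  have pos: "0 < Gamma (3 / 2 :: real)" by simp
  show ?thesis
  proof (cases "s \<ge> 3 / 2")
    case True
    have "Gamma (3 / 2) / (3 / 2) \<le> Gamma (3 / 2 :: real)" using pos by simp
    with mono[OF True] show ?thesis by linarith
  next
    case False
    have "Gamma (3 / 2) / (3 / 2) \<le> Gamma (s + 1) / (3 / 2)"
      using mono[of "s + 1"] assms by simp
    also have "\<dots> \<le> Gamma (s + 1) / s"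
      using assms False Gamma_real_pos[of "s + 1"] by (intro divide_left_mono) auto
    also have "\<dots> = Gamma s"
      using assms Gamma_plus1[of s] nonpos_Ints_nonpos[of s] by force
    finally show ?thesis .
  qed
qed

lemma ereal_less_SUP_pair:
  assumes "1 < f x y"
  shows "(SUP (x, y) \<in> UNIV. ereal (f x y)) > 1"
proof -
  have "ereal (f x y) \<le> (SUP (x, y) \<in> UNIV. ereal (f x y))"
    by (rule SUP_upper2[of "(x, y)"]) auto
  then show ?thesis using assms by (metis ereal_less(3) less_le_trans one_ereal_def ereal_less_eq(3) less_ereal.simps(1))
qed

text \<open>After division by z both z^(a - 1) and z tend to 0, which is where a > 1 is decisive.
  The bound \<delta> collects the other smallness conditions into the same choice of z.\<close>

lemma exists_small_linear_dominates:
  assumes "1 < (a::real)" "0 < c" "0 < \<delta>"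
  shows "\<exists>z>0. z < \<delta> \<and> z powr a < \<delta> \<and> K * z powr a + L * z\<^sup>2 < c * z"
proof -
  have lim: "((\<lambda>z. z powr b) \<longlongrightarrow> 0) (at_right 0)" if "0 < b" for b :: real
    by (rule tendsto_zero_powrI[where b = b]) (use that in \<open>auto simp: eventually_at_filter\<close>)
  have "((\<lambda>z. K * z powr (a - 1) + L * z) \<longlongrightarrow> K * 0 + L * 0) (at_right 0)"
    using assms by (intro tendsto_intros lim) auto
  then have "\<forall>\<^sub>F z in at_right 0. K * z powr (a - 1) + L * z < c"
    using assms by (auto dest: order_tendstoD(2))
  moreover have "\<forall>\<^sub>F z in at_right 0. z powr a < \<delta>"
    using lim[of a] assms by (auto dest: order_tendstoD(2))
  moreover have "\<forall>\<^sub>F z in at_right 0. z < \<delta>"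
    using assms by (simp add: eventually_at_right_less eventually_at_right_field) blast
  moreover have "\<forall>\<^sub>F z in at_right 0. (0::real) < z"
    by (simp add: eventually_at_right_less)
  ultimately have "\<forall>\<^sub>F z in at_right 0. 0 < z \<and> z < \<delta> \<and> z powr a < \<delta> \<and> K * z powr (a - 1) + L * z < c"
    by eventually_elim simp
  then obtain z where z: "0 < z" "z < \<delta>" "z powr a < \<delta>" "K * z powr (a - 1) + L * z < c"
    using eventually_happens[of _ "at_right (0::real)"] by auto
  have "z powr a = z powr (a - 1) * z"
    using z(1) by (simp add: powr_diff)
  then have "K * z powr a + L * z\<^sup>2 = (K * z powr (a - 1) + L * z) * z"
    by (simp add: power2_eq_square algebra_simps)
  also have "\<dots> < c * z"
    using z by (intro mult_strict_right_mono)
  finally show ?thesis using z by blast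
qed

section \<open>The kernel\<close>

text \<open>The angle lies strictly between 0 and pi, and equals pi/2 only for a = 2.\<close>

lemma cos_pi_divide_nonzero:
  assumes "1 < (a::real)" "a \<noteq> 2"
  shows "cos (pi / a) \<noteq> 0"
proof (cases "a < 2")
  case True
  then have "cos (pi / a) < cos (pi / 2)"
    using assms by (intro cos_monotone_0_pi) (auto simp: divide_simps)
  then show ?thesis by simp
next
  case False
  then have "0 < cos (pi / a)"
    using assms by (intro cos_gt_zero) (auto simp: divide_simps)
  then show ?thesis by simp
qed

lemma exp_minus_i_times: "exp (- (\<i> * complex_of_real t)) = cis (- t)"
  by (simp add: cis_conv_exp)

lemma bessel_argument_squared_le:
  fixes z a :: real
  assumes "0 < z" "1 < a"
  shows "(2 / a * z powr (a / 2))\<^sup>2 / 4 \<le> z powr a"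
proof -
  have "(z powr (a / 2))\<^sup>2 = z powr a"
    by (simp add: power2_eq_square flip: powr_add)
  then have "(2 / a * z powr (a / 2))\<^sup>2 / 4 = z powr a / a\<^sup>2"
    by (simp add: power_mult_distrib power_divide)
  also have "\<dots> \<le> z powr a / 1"
    using assms one_le_power[of a 2] by (intro divide_left_mono) auto
  finally show ?thesis by simp
qed

text \<open>With points b and s b for a unit vector b, the inner product is s, of either sign, so
  the sign of the second term of the kernel is free.\<close>

lemma kernel_B_dim_one:
  fixes b :: "real ^ 'n"
  assumes "CARD('n) = 1" "norm b = 1"
  shows "kernel_B \<Omega> \<kappa> a b (s *\<^sub>R b) =
    (let \<nu> = lambda_ka \<Omega> \<kappa> a; u = 2 / a * \<bar>s\<bar> powr (a / 2) in
      of_real (bessel_j \<nu> u) + cis (- (pi / a)) *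
        of_real (Gamma (\<nu> + 1) / Gamma (\<nu> + 1 + 2 / a) * (s / a powr (2 / a)) * bessel_j (\<nu> + 2 / a) u))"
  using assms unfolding kernel_B_def Let_def exp_minus_i_times by (simp add: norm_eq_1 mult_ac)

text \<open>The prescribed multiplicity is the one for which \<open>lambda_ka\<close> equals -1/2,
  the index at which the first Bessel factor is the cosine.\<close>

lemma exists_kernel_gt_1_critical:
  fixes \<Omega> :: "(real ^ 'n) set"
  assumes card: "CARD('n) = 1" and a: "0 < a" "a \<le> 1" and k: "mult_sum \<Omega> \<kappa> = 1 / 2 - a / 4"
  shows "\<exists>x y. 1 < cmod (kernel_B \<Omega> \<kappa> a x y)"
proof -
  obtain b :: "real ^ 'n" where b: "norm b = 1" using vector_choose_size[of 1] by auto
  have \<nu>: "lambda_ka \<Omega> \<kappa> a = - 1 / 2"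
    using a k card by (simp add: lambda_ka_def lambda_k_def field_simps)
  \<comment> \<open>Chosen so that the Bessel argument becomes exactly pi.\<close>
  define z where "z = (pi * a / 2) powr (2 / a)"
  have z: "0 < z" using a by (simp add: z_def)
  have arg: "2 / a * z powr (a / 2) = pi"
    using a by (simp add: z_def powr_powr)
  have J: "0 < bessel_j (- 1 / 2 + 2 / a) pi"
  proof -
    \<comment> \<open>Since a \<le> 1, the index plus one is at least 5/2, just above pi^2/4 < 10/4;
      hence the two-term lower bound of the alternating series is positive.\<close>
    have "2 \<le> 2 / a" using a by (simp add: le_divide_eq)
    moreover have "pi\<^sup>2 \<le> (3.15)\<^sup>2"
      using pi_approx by (intro power_mono) auto
    then have "pi\<^sup>2 < 10" by (simp add: power2_eq_square)
    ultimately have lt: "pi\<^sup>2 / 4 < - 1 / 2 + 2 / a + 1" by simp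
    have "0 < 1 - pi\<^sup>2 / 4 / (- 1 / 2 + 2 / a + 1)"
      using lt by (smt (verit) divide_less_eq_1_pos pi_gt_zero zero_le_power2 divide_nonneg_pos)
    also have "\<dots> \<le> bessel_j (- 1 / 2 + 2 / a) pi"
      using lt a by (intro bessel_j_ge) (auto intro: less_trans[of _ 0])
    finally show ?thesis .
  qed
  define c where "c = Gamma (- 1 / 2 + 1) / Gamma (- 1 / 2 + 1 + 2 / a) * (z / a powr (2 / a)) * bessel_j (- 1 / 2 + 2 / a) pi"
  have "0 < Gamma (- 1 / 2 + 1 :: real)" "0 < Gamma (- 1 / 2 + 1 + 2 / a)"
    using a by (intro Gamma_real_pos; simp add: add_pos_pos)+
  then have c: "0 < c"
    unfolding c_def using J z a by (intro mult_pos_pos divide_pos_pos) auto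
  \<comment> \<open>This sign makes the cross term in |-1 + \<sigma> c e^(-i pi/a)|^2 nonnegative,
    so the square is at least 1 + c^2, even if the cosine vanishes.\<close>
  define \<sigma> where "\<sigma> = (if cos (pi / a) \<le> 0 then 1 else - 1 :: real)"
  have \<sigma>: "\<bar>\<sigma> * z\<bar> = z" "\<sigma>\<^sup>2 = 1" "\<sigma> * cos (pi / a) \<le> 0"
    using z by (auto simp: \<sigma>_def)
  have B: "kernel_B \<Omega> \<kappa> a b ((\<sigma> * z) *\<^sub>R b) = of_real (- 1) + cis (- (pi / a)) * of_real (\<sigma> * c)"
    unfolding kernel_B_dim_one[OF card b] Let_def \<nu> \<sigma> arg bessel_j_minus_half
    by (simp add: c_def mult_ac)
  have "(cmod (kernel_B \<Omega> \<kappa> a b ((\<sigma> * z) *\<^sub>R b)))\<^sup>2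
      = (\<sigma> * c * cos (pi / a) - 1)\<^sup>2 + (\<sigma> * c * sin (pi / a))\<^sup>2"
    unfolding B cmod_power2 by (simp add: mult_ac)
  also have "\<dots> = 1 - 2 * c * (\<sigma> * cos (pi / a)) + \<sigma>\<^sup>2 * c\<^sup>2 * ((cos (pi / a))\<^sup>2 + (sin (pi / a))\<^sup>2)"
    by (simp only: power2_eq_square) algebra
  also have "\<dots> = 1 - 2 * c * (\<sigma> * cos (pi / a)) + c\<^sup>2"
    by (simp add: \<sigma>)
  also have "\<dots> > 1"
    using c \<sigma>(3) mult_nonneg_nonpos[of "2 * c" "\<sigma> * cos (pi / a)"] by (smt (verit) zero_less_power)
  finally have "1 < cmod (kernel_B \<Omega> \<kappa> a b ((\<sigma> * z) *\<^sub>R b))"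
    using power_le_one[of "cmod (kernel_B \<Omega> \<kappa> a b ((\<sigma> * z) *\<^sub>R b))" 2] by force
  then show ?thesis by blast
qed

lemma exists_kernel_gt_1_dim_one:
  fixes \<Omega> :: "(real ^ 'n) set"
  assumes card: "CARD('n) = 1" and a: "1 < a" "a \<noteq> 2" and k: "0 \<le> mult_sum \<Omega> \<kappa>"
  shows "\<exists>x y. 1 < cmod (kernel_B \<Omega> \<kappa> a x y)"
proof -
  obtain b :: "real ^ 'n" where b: "norm b = 1" using vector_choose_size[of 1] by auto
  define \<nu> where "\<nu> = lambda_ka \<Omega> \<kappa> a"
  have "\<nu> = (2 * mult_sum \<Omega> \<kappa> - 1) / a"
    using card by (simp add: \<nu>_def lambda_ka_def lambda_k_def)
  \<comment> \<open>Here \<nu> may be negative: without multiplicity it is -1/a, which exceeds -1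
    because a > 1.\<close>
  moreover have "- 1 < (2 * mult_sum \<Omega> \<kappa> - 1) / a"
    using a k by (simp add: divide_simps)
  ultimately have \<nu>: "- 1 < \<nu>" by simp
  define c where "c = Gamma (\<nu> + 1) / Gamma (\<nu> + 1 + 2 / a) / a powr (2 / a) * \<bar>cos (pi / a)\<bar>"
  have "0 < Gamma (\<nu> + 1)" "0 < Gamma (\<nu> + 1 + 2 / a)"
    using a \<nu> by (intro Gamma_real_pos; simp add: add_pos_pos)+
  then have c: "0 < c"
    unfolding c_def using a cos_pi_divide_nonzero[OF a] by (intro mult_pos_pos divide_pos_pos) auto
  \<comment> \<open>The condition z^a < (\<nu> + 1)/2 keeps the second Bessel factor above 1/2, so
    c/2 is the linear coefficient. The quadratic coefficient is 0 because the one-dimensional kernel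
    has no tail.\<close>
  obtain z where z: "0 < z" "z powr a < (\<nu> + 1) / 2" "1 / (\<nu> + 1) * z powr a < c / 2 * z"
    using exists_small_linear_dominates[of a "c / 2" "(\<nu> + 1) / 2" "1 / (\<nu> + 1)" 0] a c \<nu> by auto
  define u where "u = 2 / a * z powr (a / 2)"
  have u_le: "u\<^sup>2 / 4 \<le> z powr a"
    unfolding u_def using z(1) a(1) by (rule bessel_argument_squared_le)
  have J0: "1 - 1 / (\<nu> + 1) * z powr a \<le> bessel_j \<nu> u"
  proof -
    have "1 - u\<^sup>2 / 4 / (\<nu> + 1) \<le> bessel_j \<nu> u"
      using \<nu> u_le z(2) by (intro bessel_j_ge) auto
    moreover have "u\<^sup>2 / 4 / (\<nu> + 1) \<le> z powr a / (\<nu> + 1)"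
      using u_le \<nu> by (intro divide_right_mono) auto
    ultimately show ?thesis by simp
  qed
  have J1: "1 / 2 \<le> bessel_j (\<nu> + 2 / a) u"
  proof -
    have gt: "\<nu> + 1 < \<nu> + 2 / a + 1" using a by simp
    have "1 - u\<^sup>2 / 4 / (\<nu> + 2 / a + 1) \<le> bessel_j (\<nu> + 2 / a) u"
    proof (rule bessel_j_ge)
      have "u\<^sup>2 / 4 < \<nu> + 1" using \<nu> u_le z(2) by simp
      then show "u\<^sup>2 / 4 < \<nu> + 2 / a + 1" using gt by (rule less_trans)
    qed (use gt \<nu> in linarith)
    moreover have "u\<^sup>2 / 4 / (\<nu> + 2 / a + 1) \<le> u\<^sup>2 / 4 / (\<nu> + 1)"
      using gt \<nu> by (intro divide_left_mono mult_pos_pos) (linarith | simp)+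
    moreover have "u\<^sup>2 / 4 / (\<nu> + 1) \<le> 1 / 2"
      using \<nu> u_le z(2) by (simp add: divide_le_eq)
    ultimately show ?thesis by linarith
  qed
  \<comment> \<open>Giving the product of the points the sign of the cosine makes the real part of
    the second term positive.\<close>
  define \<sigma> where "\<sigma> = sgn (cos (pi / a))"
  have \<sigma>: "\<bar>\<sigma> * z\<bar> = z" "\<sigma> * cos (pi / a) = \<bar>cos (pi / a)\<bar>"
    using z(1) cos_pi_divide_nonzero[OF a] by (simp_all add: \<sigma>_def sgn_if)
  have "Re (kernel_B \<Omega> \<kappa> a b ((\<sigma> * z) *\<^sub>R b)) = bessel_j \<nu> u
      + Gamma (\<nu> + 1) / Gamma (\<nu> + 1 + 2 / a) / a powr (2 / a) * (\<sigma> * cos (pi / a)) * z * bessel_j (\<nu> + 2 / a) u"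
    unfolding kernel_B_dim_one[OF card b] Let_def \<nu>_def[symmetric] \<sigma>(1) u_def[symmetric]
    by (simp add: mult_ac)
  also have "\<dots> = bessel_j \<nu> u + c * z * bessel_j (\<nu> + 2 / a) u"
    by (simp add: \<sigma> c_def)
  also have "\<dots> \<ge> bessel_j \<nu> u + c * z * (1 / 2)"
    using c z(1) J1 by (intro add_left_mono mult_left_mono) auto
  finally have "1 < Re (kernel_B \<Omega> \<kappa> a b ((\<sigma> * z) *\<^sub>R b))"
    using J0 z(3) by simp
  then have "1 < cmod (kernel_B \<Omega> \<kappa> a b ((\<sigma> * z) *\<^sub>R b))"
    using complex_Re_le_cmod less_le_trans by blast
  then show ?thesis by blast
qed

context dunkl
begin

lemma exists_kernel_gt_1_higher_dim:
  assumes card: "CARD('n) \<noteq> 1" and a: "1 < a" "a \<noteq> 2"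
  shows "\<exists>x y. 1 < cmod (kernel_B \<Omega> \<kappa> a x y)"
proof -
  obtain \<xi> :: "real ^ 'n" where \<xi>: "norm \<xi> = 1" using vector_choose_size[of 1] by auto
  obtain y where y: "norm y = 1" "0 < cos (pi / a) * U (\<lambda>u. \<xi> \<bullet> u) y"
    using U_linear_sign[OF \<xi> cos_pi_divide_nonzero[OF a]] by blast
  define \<eta> where "\<eta> = lambda_k \<Omega> \<kappa>"
  define \<nu> where "\<nu> = lambda_ka \<Omega> \<kappa> a"
  \<comment> \<open>Dimension at least two makes \<eta> nonnegative, as the Gegenbauer bound
    requires, and then \<nu> as well, as the Gamma bound requires.\<close>
  have "CARD('n) \<noteq> 0" by simp
  then have "2 \<le> CARD('n)" using card by linarith
  then have \<eta>: "0 \<le> \<eta>"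
    using \<gamma>_nonneg by (simp add: \<eta>_def lambda_k_def)
  then have \<nu>: "0 \<le> \<nu>"
    using a by (simp add: \<nu>_def lambda_ka_def \<eta>_def)
  define W where "W j = U (\<lambda>u. gegenbauer_weighted j \<eta> (\<xi> \<bullet> u)) y" for j
  define D where "D = 16 * (\<eta> + 1)"
  \<comment> \<open>Bound every Gamma denominator below by the constant of
    \<open>Gamma_real_lower_bound\<close>, the powers of a by 1 and the Bessel factors above by 1 in
    absolute value: the j-th term is then at most \<open>A * (D * z) ^ j\<close>.\<close>
  define A where "A = Gamma (\<nu> + 1) / (Gamma (3 / 2) / (3 / 2)) * (\<eta> + 1)"
  have D: "0 < D" and W: "\<bar>W j\<bar> \<le> (\<eta> + 1) * D ^ j" for j
    using abs_U_gegenbauer_weighted_le[OF \<eta> \<xi> y(1)] \<eta> by (auto simp: W_def D_def)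
  have G\<nu>: "0 < Gamma (\<nu> + 1)" using \<nu> by simp
  have A: "0 < A"
    unfolding A_def using G\<nu> \<eta> by (intro mult_pos_pos divide_pos_pos) auto
  define c where "c = Gamma (\<nu> + 1) / (a powr (2 / a) * Gamma (\<nu> + 1 + 2 / a)) * (2 * (\<eta> + 1))
      * (cos (pi / a) * U (\<lambda>u. \<xi> \<bullet> u) y)"
  have "0 < Gamma (\<nu> + 1 + 2 / a)"
    using a \<nu> by (intro Gamma_real_pos) (simp add: add_nonneg_pos)
  then have c: "0 < c"
    unfolding c_def using a \<eta> G\<nu> by (intro mult_pos_pos[OF _ y(2)]) (auto intro!: mult_pos_pos divide_pos_pos)
  \<comment> \<open>The first entry gives D z < 1/2, so the geometric tail is at most twice its
    first term; the second keeps all Bessel factors above 1/2.\<close>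
  define \<delta> where "\<delta> = min (1 / (2 * D)) ((\<nu> + 1) / 2)"
  have \<delta>: "0 < \<delta>" using D \<nu> by (simp add: \<delta>_def)
  \<comment> \<open>The three coefficients are the loss of the term j = 0, the tail from j = 2 on,
    and the gain of the term j = 1 after its Bessel factor is replaced by 1/2.\<close>
  obtain z where z: "0 < z" "z < \<delta>" "z powr a < \<delta>"
    "1 / (\<nu> + 1) * z powr a + 2 * A * D\<^sup>2 * z\<^sup>2 < c / 2 * z"
    using exists_small_linear_dominates[of a "c / 2" \<delta> "1 / (\<nu> + 1)" "2 * A * D\<^sup>2"] a c \<delta> by auto
  have Dz: "0 < D * z" "D * z < 1 / 2"
    using z(1,2) D by (auto simp: \<delta>_def field_simps)
  define u where "u = 2 / a * z powr (a / 2)"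
  have u_le: "u\<^sup>2 / 4 \<le> z powr a"
    unfolding u_def using z(1) a(1) by (rule bessel_argument_squared_le)
  then have u_lt: "u\<^sup>2 / 4 < (\<nu> + 1) / 2"
    using z(3) by (simp add: \<delta>_def)
  have bessel: "1 - u\<^sup>2 / 4 / (\<nu> + 1) \<le> bessel_j (\<nu> + 2 * real j / a) u" "bessel_j (\<nu> + 2 * real j / a) u \<le> 1" for j
  proof -
    have ge: "\<nu> \<le> \<nu> + 2 * real j / a" using a by simp
    then have "1 - u\<^sup>2 / 4 / (\<nu> + 2 * real j / a + 1) \<le> bessel_j (\<nu> + 2 * real j / a) u"
      using \<nu> u_lt by (intro bessel_j_ge) auto
    moreover have "u\<^sup>2 / 4 / (\<nu> + 2 * real j / a + 1) \<le> u\<^sup>2 / 4 / (\<nu> + 1)"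
      using ge \<nu> by (intro divide_left_mono mult_pos_pos) auto
    ultimately show "1 - u\<^sup>2 / 4 / (\<nu> + 1) \<le> bessel_j (\<nu> + 2 * real j / a) u" by linarith
    show "bessel_j (\<nu> + 2 * real j / a) u \<le> 1"
      using ge \<nu> u_lt by (intro bessel_j_le_1) auto
  qed
  have half: "u\<^sup>2 / 4 / (\<nu> + 1) \<le> 1 / 2"
    using u_lt \<nu> by (simp add: divide_le_eq)
  define r where "r j = Gamma (\<nu> + 1) * z ^ j / (a powr (2 * real j / a) * Gamma (\<nu> + 1 + 2 * real j / a))
      * bessel_j (\<nu> + 2 * real j / a) u * W j" for j
  define F where "F j = cis (- (pi * real j / a)) * of_real (r j)" for j
  have "sgn (z *\<^sub>R \<xi>) = \<xi>" "sgn y = y" "norm (z *\<^sub>R \<xi>) * norm y = z"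
    using z(1) \<xi> y(1) by (simp_all add: sgn_div_norm)
  then have B: "kernel_B \<Omega> \<kappa> a (z *\<^sub>R \<xi>) y = (\<Sum>j. F j)"
    using card unfolding kernel_B_def Let_def \<eta>_def[symmetric] \<nu>_def[symmetric] F_def r_def W_def u_def exp_minus_i_times
    by simp
  have r_le: "\<bar>r j\<bar> \<le> A * (D * z) ^ j" for j
  proof -
    define g where "g = a powr (2 * real j / a) * Gamma (\<nu> + 1 + 2 * real j / a)"
    have G: "Gamma (3 / 2) / (3 / 2) \<le> Gamma (\<nu> + 1 + 2 * real j / a)"
      using \<nu> a by (intro Gamma_real_lower_bound) simp
    have pos: "0 < Gamma (3 / 2 :: real) / (3 / 2)" by (intro divide_pos_pos Gamma_real_pos) auto
    moreover have "1 \<le> a powr (2 * real j / a)"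
      using a by (intro ge_one_powr_ge_zero) auto
    ultimately have "1 * (Gamma (3 / 2) / (3 / 2)) \<le> g"
      unfolding g_def using G by (intro mult_mono) linarith+
    then have G': "Gamma (3 / 2) / (3 / 2) \<le> g" by simp
    with pos have "0 < g" by linarith
    then have "Gamma (\<nu> + 1) * z ^ j / g \<le> Gamma (\<nu> + 1) * z ^ j / (Gamma (3 / 2) / (3 / 2))"
      and "0 \<le> Gamma (\<nu> + 1) * z ^ j / g"
      using pos G' G\<nu> z(1) by (intro divide_left_mono divide_nonneg_pos mult_pos_pos; simp)+
    then have "\<bar>Gamma (\<nu> + 1) * z ^ j / g\<bar> \<le> Gamma (\<nu> + 1) * z ^ j / (Gamma (3 / 2) / (3 / 2))"
      by linarith
    moreover have "\<bar>bessel_j (\<nu> + 2 * real j / a) u\<bar> \<le> 1"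
      using bessel[of j] half by linarith
    ultimately have "\<bar>r j\<bar> \<le> Gamma (\<nu> + 1) * z ^ j / (Gamma (3 / 2) / (3 / 2)) * 1 * ((\<eta> + 1) * D ^ j)"
      unfolding r_def g_def[symmetric] abs_mult[of "_ * bessel_j _ _"] abs_mult[of _ "bessel_j _ _"]
      using W[of j] G\<nu> z(1) by (intro mult_mono) auto
    also have "\<dots> = A * (D * z) ^ j"
      by (simp add: A_def power_mult_distrib)
    finally show ?thesis .
  qed
  have F_le: "norm (F j) \<le> A * (D * z) ^ j" for j
    using r_le[of j] by (simp add: F_def norm_mult)
  have geom: "summable (\<lambda>j. A * (D * z) ^ j)"
    using Dz by (intro summable_mult summable_geometric) auto
  have "summable F"
    using geom by (rule summable_comparison_test') (rule F_le)
  then have "(\<Sum>j. F j) = (\<Sum>j. F (j + 2)) + (\<Sum>j<2. F j)"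
    by (rule suminf_split_initial_segment)
  then have split: "Re (\<Sum>j. F j) = Re (\<Sum>j. F (j + 2)) + (Re (F 0) + Re (F 1))"
    by (simp add: numeral_2_eq_2)
  have "norm (\<Sum>j. F (j + 2)) \<le> (\<Sum>j. A * (D * z)\<^sup>2 * (D * z) ^ j)"
  proof (rule norm_suminf_le)
    show "summable (\<lambda>j. A * (D * z)\<^sup>2 * (D * z) ^ j)"
      using Dz by (intro summable_mult summable_geometric) auto
    show "norm (F (j + 2)) \<le> A * (D * z)\<^sup>2 * (D * z) ^ j" for j
      using F_le[of "j + 2"] by (simp only: power_add mult_ac)
  qed
  also have "\<dots> = A * (D * z)\<^sup>2 * (1 / (1 - D * z))"
    using Dz by (subst suminf_mult) (auto intro!: summable_geometric simp: suminf_geometric)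
  also have "\<dots> \<le> A * (D * z)\<^sup>2 * 2"
    using Dz A by (intro mult_left_mono) (auto simp: divide_simps)
  finally have tail: "norm (\<Sum>j. F (j + 2)) \<le> 2 * A * D\<^sup>2 * z\<^sup>2"
    by (simp add: power_mult_distrib mult_ac)
  have tail': "- (2 * A * D\<^sup>2 * z\<^sup>2) \<le> Re (\<Sum>j. F (j + 2))"
    using tail abs_Re_le_cmod[of "\<Sum>j. F (j + 2)"] by linarith
  have "Re (F 0) = bessel_j (\<nu> + 2 * real 0 / a) u"
    using G\<nu> a by (simp add: F_def r_def W_def U_one)
  also have "\<dots> \<ge> 1 - u\<^sup>2 / 4 / (\<nu> + 1)"
    by (rule bessel)
  finally have "1 - u\<^sup>2 / 4 / (\<nu> + 1) \<le> Re (F 0)" .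
  moreover have "u\<^sup>2 / 4 / (\<nu> + 1) \<le> 1 / (\<nu> + 1) * z powr a"
    using divide_right_mono[OF u_le, of "\<nu> + 1"] \<nu> by simp
  ultimately have F0: "1 - 1 / (\<nu> + 1) * z powr a \<le> Re (F 0)" by linarith
  have "Re (F 1) = c * z * bessel_j (\<nu> + 2 * real 1 / a) u"
    by (simp add: F_def r_def W_def U_gegenbauer_weighted_1[unfolded One_nat_def] c_def)
  also have "\<dots> \<ge> c * z * (1 / 2)"
    using bessel(1)[of 1] half c z(1) by (intro mult_left_mono) auto
  finally have F1: "c / 2 * z \<le> Re (F 1)" by simp
  have "1 < Re (kernel_B \<Omega> \<kappa> a (z *\<^sub>R \<xi>) y)"
    unfolding B split using tail' F0 F1 z(4) by linarith
  then have "1 < cmod (kernel_B \<Omega> \<kappa> a (z *\<^sub>R \<xi>) y)"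
    using complex_Re_le_cmod less_le_trans by blast
  then show ?thesis by blast
qed

end

theorem theorem1p2:
  fixes \<Omega> :: "(real ^ 'n) set" and \<kappa> :: "real ^ 'n \<Rightarrow> real" and a :: real
  assumes "a > 0"
    and "root_system \<Omega>"
    and "nonneg_multiplicity \<Omega> \<kappa>"
    and "(CARD('n) = 1 \<and> 0 < a \<and> a \<le> 1 \<and> mult_sum \<Omega> \<kappa> = 1 / 2 - a / 4) \<or>
         (CARD('n) \<ge> 1 \<and> a \<in> {1<..<2} \<union> {2<..} \<and> mult_sum \<Omega> \<kappa> \<ge> 0)"
  shows "(SUP (x, y) \<in> UNIV. ereal (cmod (kernel_B \<Omega> \<kappa> a x y))) > 1"
proof -
  interpret dunkl \<Omega> \<kappa> by standard (fact assms)+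
  have "\<exists>x y. 1 < cmod (kernel_B \<Omega> \<kappa> a x y)"
    using assms(4)
  proof
    assume "CARD('n) = 1 \<and> 0 < a \<and> a \<le> 1 \<and> mult_sum \<Omega> \<kappa> = 1 / 2 - a / 4"
    then show ?thesis by (intro exists_kernel_gt_1_critical) auto
  next
    assume *: "CARD('n) \<ge> 1 \<and> a \<in> {1<..<2} \<union> {2<..} \<and> mult_sum \<Omega> \<kappa> \<ge> 0"
    then have a: "1 < a" "a \<noteq> 2" by auto
    show ?thesis
    proof (cases "CARD('n) = 1")
      case True
      then show ?thesis using a * by (intro exists_kernel_gt_1_dim_one) auto
    next
      case False
      then show ?thesis using a by (rule exists_kernel_gt_1_higher_dim)
    qed
  qed
  then obtain x y where "1 < cmod (kernel_B \<Omega> \<kappa> a x y)" by blast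
  then show ?thesis by (rule ereal_less_SUP_pair)
qed

end
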